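(* Let $\Omega$ be a compact Hausdorff space, and let $\mathcal C,\mathcal C_1,\mathcal C_2$ be $C^*$-categories. Then: (1) Each $C^*$-functor $F:\mathcal C_1\times\mathcal C_1\to\mathcal C_2$ induces a $C^*$-functor $F^\Omega:\mathcal C_1^\Omega\times\mathcal C_1^\Omega\to\mathcal C_2^\Omega$, given on arrows by the extension of $F^\Omega(a\otimes s,\,a'\otimes s')=aa'\otimes F(s,s')$ ($a,a'\in C(\Omega)$, $s,s'$ arrows of $\mathcal C_1$). (2) If $\mathcal C$ is a strict tensor $C^*$-category then so is $\mathcal C^\Omega$; the space of intertwiners of the identity object $\iota_\Omega:=1\otimes 1_\iota$ of $\mathcal C^\Omega$ is $(\iota_\Omega,\iota_\Omega)\simeq C(\Omega)\otimes(\iota,\iota)$, where $\iota$ is the identity object of $\mathcal C$. (3) If $\mathcal C$ is symmetric then $\mathcal C^\Omega$ is symmetric. (4) If $\mathcal C$ has conjugates, then so does $\mathcal C^\Omega$.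
   Context: A $C^*$-category has Banach spaces of arrows $(\rho,\sigma)$ from $\rho$ to $\sigma$, bilinear submultiplicative composition, an antilinear involution $*:(\rho,\sigma)\to(\sigma,\rho)$ with $\|s^*s\|=\|s\|^2$, and $s^*s$ positive in the unital $C^*$-algebra $(\rho,\rho)$. A $C^*$-functor is a functor commuting with the involutions and inducing bounded linear maps on spaces of arrows; for a functor of two variables $\mathcal C_1\times\mathcal C_1\to\mathcal C_2$ the maps on arrows are bounded and bilinear. A strict tensor $C^*$-category carries a strictly associative tensor product given by a $C^*$-functor of two variables (objects $\rho,\sigma\mapsto\rho\sigma$, arrows $s,t\mapsto s\times t$), with a strict unit object $\iota$. It is symmetric if there are unitary arrows $\theta(\rho,\sigma)\in(\rho\sigma,\sigma\rho)$, natural in $\rho$ and $\sigma$, with $\theta(\sigma,\rho)\theta(\rho,\sigma)=1_{\rho\sigma}$ and $\theta(\rho\sigma,\tau)=(\theta(\rho,\tau)\times1_\sigma)\circ(1_\rho\times\theta(\sigma,\tau))$. It has conjugates if for each $\rho$ there are an object $\bar\rho$ and $R\in(\iota,\bar\rho\rho)$, $\bar R\in(\iota,\rho\bar\rho)$ with $(\bar R^*\times1_\rho)\circ(1_\rho\times R)=1_\rho$ and $(R^*\times1_{\bar\rho})\circ(1_{\bar\rho}\times\bar R)=1_{\bar\rho}$. Extension category $\mathcal C^\Omega$: for objects $\rho,\sigma$ of $\mathcal C$ put $(\rho,\sigma)^\Omega:=C(\Omega)\otimes(\rho,\sigma)\simeq C(\Omega,(\rho,\sigma))$ with sup norm, pointwise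 composition and involution. Objects of $\mathcal C^\Omega$ are projections $e\in(\rho,\rho)^\Omega$ for some object $\rho$ of $\mathcal C$; arrows are $(e,f):=\{x\in(\rho,\sigma)^\Omega: xe=fx=x\}$ for $e\in(\rho,\rho)^\Omega$, $f\in(\sigma,\sigma)^\Omega$; the identity arrow of $e$ is $e$. In (2)–(4) the tensor product on $\mathcal C^\Omega$ is the one induced, as in (1), by that of $\mathcal C$: for $e\in(\rho,\rho)^\Omega$, $f\in(\sigma,\sigma)^\Omega$, $ef\in(\rho\sigma,\rho\sigma)^\Omega$ is $(ef)(\omega)=e(\omega)\times f(\omega)$, and $(x\times y)(\omega)=x(\omega)\times y(\omega)$ on arrows. *)

theory Defs
  imports "HOL-Analysis.Analysis"
begin

section \<open>Complex Banach spaces with explicit carrier\<close>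

text \<open>The spaces of arrows of a category form a family indexed by pairs of objects, so each one is
  given by a carrier set together with its operations.\<close>

record 'a nspace =
  vecs :: "'a set"
  nzero :: "'a"  ("\<zero>\<index>")
  nadd :: "'a \<Rightarrow> 'a \<Rightarrow> 'a"  (infixl "\<oplus>\<index>" 65)
  nscale :: "complex \<Rightarrow> 'a \<Rightarrow> 'a"  (infixr "\<odot>\<index>" 75)
  nnorm :: "'a \<Rightarrow> real"

definition ndiff :: "'a nspace \<Rightarrow> 'a \<Rightarrow> 'a \<Rightarrow> 'a" where
  "ndiff V u v = u \<oplus>\<^bsub>V\<^esub> (- 1) \<odot>\<^bsub>V\<^esub> v"

text \<open>The value off the carrier is irrelevant; \<open>0\<close> is chosen because \<^locale>\<open>Metric_space\<close> asks for
  nonnegativity and symmetry of the distance on the whole type.\<close>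

definition ndist :: "'a nspace \<Rightarrow> 'a \<Rightarrow> 'a \<Rightarrow> real" where
  "ndist V u v = (if u \<in> vecs V \<and> v \<in> vecs V then nnorm V (ndiff V u v) else 0)"

definition ntopology :: "'a nspace \<Rightarrow> 'a topology" where
  "ntopology V = Metric_space.mtopology (vecs V) (ndist V)"

locale complex_banach =
  fixes V :: "'a nspace" (structure)
  assumes zero_closed: "\<zero> \<in> vecs V"
    and add_closed: "\<lbrakk>u \<in> vecs V; v \<in> vecs V\<rbrakk> \<Longrightarrow> u \<oplus> v \<in> vecs V"
    and scale_closed: "u \<in> vecs V \<Longrightarrow> c \<odot> u \<in> vecs V"
    and add_assoc: "\<lbrakk>u \<in> vecs V; v \<in> vecs V; w \<in> vecs V\<rbrakk> \<Longrightarrow> (u \<oplus> v) \<oplus> w = u \<oplus> (v \<oplus> w)"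
    and add_commute: "\<lbrakk>u \<in> vecs V; v \<in> vecs V\<rbrakk> \<Longrightarrow> u \<oplus> v = v \<oplus> u"
    and add_zero: "u \<in> vecs V \<Longrightarrow> \<zero> \<oplus> u = u"
    and add_neg: "u \<in> vecs V \<Longrightarrow> u \<oplus> (- 1) \<odot> u = \<zero>"
    and scale_add_right: "\<lbrakk>u \<in> vecs V; v \<in> vecs V\<rbrakk> \<Longrightarrow> c \<odot> (u \<oplus> v) = c \<odot> u \<oplus> c \<odot> v"
    and scale_add_left: "u \<in> vecs V \<Longrightarrow> (c + d) \<odot> u = c \<odot> u \<oplus> d \<odot> u"
    and scale_scale: "u \<in> vecs V \<Longrightarrow> c \<odot> (d \<odot> u) = (c * d) \<odot> u"
    and scale_one: "u \<in> vecs V \<Longrightarrow> 1 \<odot> u = u"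
    and norm_nonneg: "u \<in> vecs V \<Longrightarrow> 0 \<le> nnorm V u"
    and norm_eq_zero: "u \<in> vecs V \<Longrightarrow> nnorm V u = 0 \<longleftrightarrow> u = \<zero>"
    and norm_scale: "u \<in> vecs V \<Longrightarrow> nnorm V (c \<odot> u) = cmod c * nnorm V u"
    and norm_triangle: "\<lbrakk>u \<in> vecs V; v \<in> vecs V\<rbrakk> \<Longrightarrow> nnorm V (u \<oplus> v) \<le> nnorm V u + nnorm V v"
    and complete: "Metric_space.mcomplete (vecs V) (ndist V)"

definition bilinear_on ::
    "'a nspace \<Rightarrow> 'b nspace \<Rightarrow> 'c nspace \<Rightarrow> ('a \<Rightarrow> 'b \<Rightarrow> 'c) \<Rightarrow> bool" where
  "bilinear_on U V W G \<longleftrightarrow>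
     (\<forall>u\<in>vecs U. \<forall>v\<in>vecs V. G u v \<in> vecs W) \<and>
     (\<forall>u\<in>vecs U. \<forall>u'\<in>vecs U. \<forall>v\<in>vecs V. G (u \<oplus>\<^bsub>U\<^esub> u') v = G u v \<oplus>\<^bsub>W\<^esub> G u' v) \<and>
     (\<forall>u\<in>vecs U. \<forall>v\<in>vecs V. \<forall>v'\<in>vecs V. G u (v \<oplus>\<^bsub>V\<^esub> v') = G u v \<oplus>\<^bsub>W\<^esub> G u v') \<and>
     (\<forall>c. \<forall>u\<in>vecs U. \<forall>v\<in>vecs V. G (c \<odot>\<^bsub>U\<^esub> u) v = c \<odot>\<^bsub>W\<^esub> G u v) \<and>
     (\<forall>c. \<forall>u\<in>vecs U. \<forall>v\<in>vecs V. G u (c \<odot>\<^bsub>V\<^esub> v) = c \<odot>\<^bsub>W\<^esub> G u v)"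

definition bounded_bilinear_on ::
    "'a nspace \<Rightarrow> 'b nspace \<Rightarrow> 'c nspace \<Rightarrow> ('a \<Rightarrow> 'b \<Rightarrow> 'c) \<Rightarrow> bool" where
  "bounded_bilinear_on U V W G \<longleftrightarrow>
     bilinear_on U V W G \<and>
     (\<exists>K. \<forall>u\<in>vecs U. \<forall>v\<in>vecs V. nnorm W (G u v) \<le> K * nnorm U u * nnorm V v)"

definition closed_subspace :: "'a nspace \<Rightarrow> 'a set \<Rightarrow> bool" where
  "closed_subspace V S \<longleftrightarrow>
     closedin (ntopology V) S \<and> \<zero>\<^bsub>V\<^esub> \<in> S \<and>
     (\<forall>u\<in>S. \<forall>v\<in>S. u \<oplus>\<^bsub>V\<^esub> v \<in> S) \<and> (\<forall>c. \<forall>u\<in>S. c \<odot>\<^bsub>V\<^esub> u \<in> S)"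


section \<open>C*-categories\<close>

text \<open>\<open>Hom C a b\<close> is the space of arrows from \<open>a\<close> to \<open>b\<close>, and \<open>t \<cdot>\<^bsub>C\<^esub> s\<close> is \<open>t\<close> after \<open>s\<close>.
  Spaces of arrows are not required to be disjoint as sets: with the definition of arrows
  \<open>(e, f) = {x. x e = f x = x}\<close> the extension category below has overlapping spaces of arrows.\<close>

record ('o, 'a) cat =
  Obj :: "'o set"
  Hom :: "'o \<Rightarrow> 'o \<Rightarrow> 'a nspace"
  Ident :: "'o \<Rightarrow> 'a"
  Comp :: "'a \<Rightarrow> 'a \<Rightarrow> 'a"  (infixl "\<cdot>\<index>" 70)
  Star :: "'a \<Rightarrow> 'a"

abbreviation Arr :: "('o, 'a) cat \<Rightarrow> 'o \<Rightarrow> 'o \<Rightarrow> 'a set" where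
  "Arr C a b \<equiv> vecs (Hom C a b)"

definition spectrum :: "('o, 'a) cat \<Rightarrow> 'o \<Rightarrow> 'a \<Rightarrow> complex set" where
  "spectrum C a s =
     {z. let d = ndiff (Hom C a a) s (z \<odot>\<^bsub>Hom C a a\<^esub> Ident C a)
         in \<not> (\<exists>t\<in>Arr C a a. t \<cdot>\<^bsub>C\<^esub> d = Ident C a \<and> d \<cdot>\<^bsub>C\<^esub> t = Ident C a)}"

definition positive_arrow :: "('o, 'a) cat \<Rightarrow> 'o \<Rightarrow> 'a \<Rightarrow> bool" where
  "positive_arrow C a s \<longleftrightarrow>
     s \<in> Arr C a a \<and> Star C s = s \<and> spectrum C a s \<subseteq> complex_of_real ` {0..}"

locale cstar_category =
  fixes C :: "('o, 'a) cat" (structure)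
  assumes hom_banach: "\<lbrakk>a \<in> Obj C; b \<in> Obj C\<rbrakk> \<Longrightarrow> complex_banach (Hom C a b)"
    and ident_arr: "a \<in> Obj C \<Longrightarrow> Ident C a \<in> Arr C a a"
    and ident_left: "\<lbrakk>a \<in> Obj C; b \<in> Obj C; s \<in> Arr C a b\<rbrakk> \<Longrightarrow> Ident C b \<cdot> s = s"
    and ident_right: "\<lbrakk>a \<in> Obj C; b \<in> Obj C; s \<in> Arr C a b\<rbrakk> \<Longrightarrow> s \<cdot> Ident C a = s"
    and comp_assoc: "\<lbrakk>a \<in> Obj C; b \<in> Obj C; c \<in> Obj C; d \<in> Obj C;
          s \<in> Arr C a b; t \<in> Arr C b c; u \<in> Arr C c d\<rbrakk> \<Longrightarrow> (u \<cdot> t) \<cdot> s = u \<cdot> (t \<cdot> s)"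
    and comp_bilinear: "\<lbrakk>a \<in> Obj C; b \<in> Obj C; c \<in> Obj C\<rbrakk> \<Longrightarrow>
          bilinear_on (Hom C b c) (Hom C a b) (Hom C a c) (Comp C)"
    and comp_norm: "\<lbrakk>a \<in> Obj C; b \<in> Obj C; c \<in> Obj C; s \<in> Arr C a b; t \<in> Arr C b c\<rbrakk> \<Longrightarrow>
          nnorm (Hom C a c) (t \<cdot> s) \<le> nnorm (Hom C b c) t * nnorm (Hom C a b) s"
    and star_arr: "\<lbrakk>a \<in> Obj C; b \<in> Obj C; s \<in> Arr C a b\<rbrakk> \<Longrightarrow> Star C s \<in> Arr C b a"
    and star_add: "\<lbrakk>a \<in> Obj C; b \<in> Obj C; s \<in> Arr C a b; t \<in> Arr C a b\<rbrakk> \<Longrightarrow>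
          Star C (s \<oplus>\<^bsub>Hom C a b\<^esub> t) = Star C s \<oplus>\<^bsub>Hom C b a\<^esub> Star C t"
    and star_scale: "\<lbrakk>a \<in> Obj C; b \<in> Obj C; s \<in> Arr C a b\<rbrakk> \<Longrightarrow>
          Star C (z \<odot>\<^bsub>Hom C a b\<^esub> s) = cnj z \<odot>\<^bsub>Hom C b a\<^esub> Star C s"
    and star_star: "\<lbrakk>a \<in> Obj C; b \<in> Obj C; s \<in> Arr C a b\<rbrakk> \<Longrightarrow> Star C (Star C s) = s"
    and star_comp: "\<lbrakk>a \<in> Obj C; b \<in> Obj C; c \<in> Obj C; s \<in> Arr C a b; t \<in> Arr C b c\<rbrakk> \<Longrightarrow>
          Star C (t \<cdot> s) = Star C s \<cdot> Star C t"
    and cstar_identity: "\<lbrakk>a \<in> Obj C; b \<in> Obj C; s \<in> Arr C a b\<rbrakk> \<Longrightarrow>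
          nnorm (Hom C a a) (Star C s \<cdot> s) = (nnorm (Hom C a b) s)\<^sup>2"
    and star_comp_positive: "\<lbrakk>a \<in> Obj C; b \<in> Obj C; s \<in> Arr C a b\<rbrakk> \<Longrightarrow>
          positive_arrow C a (Star C s \<cdot> s)"

text \<open>C*-functors of two variables, given by a map on objects and a map on arrows.\<close>

locale cstar_bifunctor =
  C: cstar_category C + C': cstar_category C' + D: cstar_category D
  for C :: "('o, 'a) cat" and C' :: "('p, 'b) cat" and D :: "('q, 'c) cat" +
  fixes Fo :: "'o \<Rightarrow> 'p \<Rightarrow> 'q" and Fa :: "'a \<Rightarrow> 'b \<Rightarrow> 'c"
  assumes fun_obj: "\<lbrakk>a \<in> Obj C; a' \<in> Obj C'\<rbrakk> \<Longrightarrow> Fo a a' \<in> Obj D"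
    and fun_bilinear: "\<lbrakk>a \<in> Obj C; b \<in> Obj C; a' \<in> Obj C'; b' \<in> Obj C'\<rbrakk> \<Longrightarrow>
          bounded_bilinear_on (Hom C a b) (Hom C' a' b') (Hom D (Fo a a') (Fo b b')) Fa"
    and fun_ident: "\<lbrakk>a \<in> Obj C; a' \<in> Obj C'\<rbrakk> \<Longrightarrow>
          Fa (Ident C a) (Ident C' a') = Ident D (Fo a a')"
    and fun_comp: "\<lbrakk>a \<in> Obj C; b \<in> Obj C; c \<in> Obj C; a' \<in> Obj C'; b' \<in> Obj C'; c' \<in> Obj C';
          s \<in> Arr C a b; t \<in> Arr C b c; s' \<in> Arr C' a' b'; t' \<in> Arr C' b' c'\<rbrakk> \<Longrightarrow>
          Fa (t \<cdot>\<^bsub>C\<^esub> s) (t' \<cdot>\<^bsub>C'\<^esub> s') = Fa t t' \<cdot>\<^bsub>D\<^esub> Fa s s'"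
    and fun_star: "\<lbrakk>a \<in> Obj C; b \<in> Obj C; a' \<in> Obj C'; b' \<in> Obj C';
          s \<in> Arr C a b; s' \<in> Arr C' a' b'\<rbrakk> \<Longrightarrow>
          Fa (Star C s) (Star C' s') = Star D (Fa s s')"

locale strict_tensor_cstar_category =
  cstar_bifunctor C C C To Ta
  for C :: "('o, 'a) cat" and To :: "'o \<Rightarrow> 'o \<Rightarrow> 'o" and Ta :: "'a \<Rightarrow> 'a \<Rightarrow> 'a" +
  fixes unit :: 'o
  assumes unit_obj: "unit \<in> Obj C"
    and obj_assoc: "\<lbrakk>a \<in> Obj C; b \<in> Obj C; c \<in> Obj C\<rbrakk> \<Longrightarrow> To (To a b) c = To a (To b c)"
    and obj_unit_left: "a \<in> Obj C \<Longrightarrow> To unit a = a"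
    and obj_unit_right: "a \<in> Obj C \<Longrightarrow> To a unit = a"
    and arr_assoc: "\<lbrakk>a \<in> Obj C; a' \<in> Obj C; b \<in> Obj C; b' \<in> Obj C; c \<in> Obj C; c' \<in> Obj C;
          s \<in> Arr C a a'; t \<in> Arr C b b'; u \<in> Arr C c c'\<rbrakk> \<Longrightarrow> Ta (Ta s t) u = Ta s (Ta t u)"
    and arr_unit_left: "\<lbrakk>a \<in> Obj C; b \<in> Obj C; s \<in> Arr C a b\<rbrakk> \<Longrightarrow> Ta (Ident C unit) s = s"
    and arr_unit_right: "\<lbrakk>a \<in> Obj C; b \<in> Obj C; s \<in> Arr C a b\<rbrakk> \<Longrightarrow> Ta s (Ident C unit) = s"

definition unitary_arrow :: "('o, 'a) cat \<Rightarrow> 'o \<Rightarrow> 'o \<Rightarrow> 'a \<Rightarrow> bool" where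
  "unitary_arrow C a b u \<longleftrightarrow>
     u \<in> Arr C a b \<and> Star C u \<cdot>\<^bsub>C\<^esub> u = Ident C a \<and> u \<cdot>\<^bsub>C\<^esub> Star C u = Ident C b"

definition symmetric_tensor ::
    "('o, 'a) cat \<Rightarrow> ('o \<Rightarrow> 'o \<Rightarrow> 'o) \<Rightarrow> ('a \<Rightarrow> 'a \<Rightarrow> 'a) \<Rightarrow> bool" where
  "symmetric_tensor C To Ta \<longleftrightarrow> (\<exists>\<theta>.
     (\<forall>a\<in>Obj C. \<forall>b\<in>Obj C. unitary_arrow C (To a b) (To b a) (\<theta> a b)) \<and>
     (\<forall>a\<in>Obj C. \<forall>a'\<in>Obj C. \<forall>b\<in>Obj C. \<forall>b'\<in>Obj C. \<forall>s\<in>Arr C a a'. \<forall>t\<in>Arr C b b'.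
        \<theta> a' b' \<cdot>\<^bsub>C\<^esub> Ta s t = Ta t s \<cdot>\<^bsub>C\<^esub> \<theta> a b) \<and>
     (\<forall>a\<in>Obj C. \<forall>b\<in>Obj C. \<theta> b a \<cdot>\<^bsub>C\<^esub> \<theta> a b = Ident C (To a b)) \<and>
     (\<forall>a\<in>Obj C. \<forall>b\<in>Obj C. \<forall>c\<in>Obj C.
        \<theta> (To a b) c = Ta (\<theta> a c) (Ident C b) \<cdot>\<^bsub>C\<^esub> Ta (Ident C a) (\<theta> b c)))"

definition has_conjugates ::
    "('o, 'a) cat \<Rightarrow> ('o \<Rightarrow> 'o \<Rightarrow> 'o) \<Rightarrow> ('a \<Rightarrow> 'a \<Rightarrow> 'a) \<Rightarrow> 'o \<Rightarrow> bool" where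
  "has_conjugates C To Ta unit \<longleftrightarrow> (\<forall>a\<in>Obj C. \<exists>b\<in>Obj C.
     \<exists>R\<in>Arr C unit (To b a). \<exists>R'\<in>Arr C unit (To a b).
       Ta (Star C R') (Ident C a) \<cdot>\<^bsub>C\<^esub> Ta (Ident C a) R = Ident C a \<and>
       Ta (Star C R) (Ident C b) \<cdot>\<^bsub>C\<^esub> Ta (Ident C b) R' = Ident C b)"


section \<open>The extension category\<close>

text \<open>The space \<open>C(\<Omega>, V)\<close> with the supremum norm, for \<open>\<Omega> = X\<close> compact. Its elements are made
  extensional on the points of \<open>X\<close>, so that equality of functions is equality on \<open>X\<close>.\<close>

definition cfun_space :: "'w topology \<Rightarrow> 'a nspace \<Rightarrow> ('w \<Rightarrow> 'a) nspace" where
  "cfun_space X V =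
     \<lparr> vecs = {x \<in> extensional (topspace X). continuous_map X (ntopology V) x},
       nzero = (\<lambda>w\<in>topspace X. \<zero>\<^bsub>V\<^esub>),
       nadd = (\<lambda>x y. \<lambda>w\<in>topspace X. x w \<oplus>\<^bsub>V\<^esub> y w),
       nscale = (\<lambda>c x. \<lambda>w\<in>topspace X. c \<odot>\<^bsub>V\<^esub> x w),
       nnorm = (\<lambda>x. if topspace X = {} then 0 else (SUP w\<in>topspace X. nnorm V (x w))) \<rparr>"

text \<open>The elementary tensor \<open>f \<otimes> s\<close> of a scalar function \<open>f\<close> and a vector \<open>s\<close>.\<close>

definition etensor :: "'w topology \<Rightarrow> 'a nspace \<Rightarrow> ('w \<Rightarrow> complex) \<Rightarrow> 'a \<Rightarrow> ('w \<Rightarrow> 'a)" where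
  "etensor X V f s = (\<lambda>w\<in>topspace X. f w \<odot>\<^bsub>V\<^esub> s)"

text \<open>\<open>C(\<Omega>) \<otimes> V\<close>, realised inside \<open>C(\<Omega>, V)\<close> as the completion for the supremum norm of the
  algebraic tensor product, i.e. as the closed linear span of the elementary tensors.\<close>

definition ctensor :: "'w topology \<Rightarrow> 'a nspace \<Rightarrow> ('w \<Rightarrow> 'a) nspace" where
  "ctensor X V = (cfun_space X V)
     \<lparr> vecs := closed_subspace (cfun_space X V) hull
         {etensor X V f s | f s. continuous_map X euclidean f \<and> s \<in> vecs V} \<rparr>"

text \<open>The pointwise extension of a map of two variables.\<close>

definition ext_arr :: "'w topology \<Rightarrow> ('a \<Rightarrow> 'b \<Rightarrow> 'c) \<Rightarrow> ('w \<Rightarrow> 'a) \<Rightarrow> ('w \<Rightarrow> 'b) \<Rightarrow> ('w \<Rightarrow> 'c)" where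
  "ext_arr X F x y = (\<lambda>w\<in>topspace X. F (x w) (y w))"

definition ext_star :: "'w topology \<Rightarrow> ('o, 'a) cat \<Rightarrow> ('w \<Rightarrow> 'a) \<Rightarrow> ('w \<Rightarrow> 'a)" where
  "ext_star X C x = (\<lambda>w\<in>topspace X. Star C (x w))"

text \<open>An object is a pair \<open>(a, e)\<close>: a projection \<open>e\<close> together with the object \<open>a\<close> on which it
  lives.\<close>

definition ext_cat :: "'w topology \<Rightarrow> ('o, 'a) cat \<Rightarrow> ('o \<times> ('w \<Rightarrow> 'a), 'w \<Rightarrow> 'a) cat" where
  "ext_cat X C =
     \<lparr> Obj = {(a, e). a \<in> Obj C \<and> e \<in> vecs (cfun_space X (Hom C a a)) \<and>
               ext_arr X (Comp C) e e = e \<and> ext_star X C e = e},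
       Hom = (\<lambda>(a, e) (b, f). (cfun_space X (Hom C a b))
         \<lparr> vecs := {x \<in> vecs (cfun_space X (Hom C a b)).
               ext_arr X (Comp C) x e = x \<and> ext_arr X (Comp C) f x = x} \<rparr>),
       Ident = (\<lambda>(a, e). e),
       Comp = ext_arr X (Comp C),
       Star = ext_star X C \<rparr>"

definition ext_obj :: "'w topology \<Rightarrow> ('o \<Rightarrow> 'p \<Rightarrow> 'q) \<Rightarrow> ('a \<Rightarrow> 'b \<Rightarrow> 'c) \<Rightarrow>
    'o \<times> ('w \<Rightarrow> 'a) \<Rightarrow> 'p \<times> ('w \<Rightarrow> 'b) \<Rightarrow> 'q \<times> ('w \<Rightarrow> 'c)" where
  "ext_obj X Fo Fa = (\<lambda>(a, e) (b, f). (Fo a b, ext_arr X Fa e f))"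

text \<open>The object \<open>1 \<otimes> 1\<^sub>a\<close>.\<close>

definition ext_const :: "'w topology \<Rightarrow> ('o, 'a) cat \<Rightarrow> 'o \<Rightarrow> 'o \<times> ('w \<Rightarrow> 'a)" where
  "ext_const X C a = (a, etensor X (Hom C a a) (\<lambda>_. 1) (Ident C a))"

text \<open>\<open>G\<close> satisfies \<open>G (f \<otimes> s) (f' \<otimes> s') = f f' \<otimes> F s s'\<close> on elementary tensors.\<close>

definition extends_tensors :: "'w topology \<Rightarrow> 'a nspace \<Rightarrow> 'b nspace \<Rightarrow> 'c nspace \<Rightarrow>
    ('a \<Rightarrow> 'b \<Rightarrow> 'c) \<Rightarrow> (('w \<Rightarrow> 'a) \<Rightarrow> ('w \<Rightarrow> 'b) \<Rightarrow> ('w \<Rightarrow> 'c)) \<Rightarrow> bool" where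
  "extends_tensors X U V W F G \<longleftrightarrow>
     (\<forall>f f'. continuous_map X euclidean f \<and> continuous_map X euclidean f' \<longrightarrow>
        (\<forall>s\<in>vecs U. \<forall>s'\<in>vecs V.
           G (etensor X U f s) (etensor X V f' s') = etensor X W (\<lambda>w. f w * f' w) (F s s')))"

text \<open>\<open>G\<close> is the bounded bilinear extension of \<open>(f \<otimes> s, f' \<otimes> s') \<mapsto> f f' \<otimes> F s s'\<close> to the full
  function spaces; being the extension includes being the only one.\<close>

definition is_the_extension :: "'w topology \<Rightarrow> 'a nspace \<Rightarrow> 'b nspace \<Rightarrow> 'c nspace \<Rightarrow>
    ('a \<Rightarrow> 'b \<Rightarrow> 'c) \<Rightarrow> (('w \<Rightarrow> 'a) \<Rightarrow> ('w \<Rightarrow> 'b) \<Rightarrow> ('w \<Rightarrow> 'c)) \<Rightarrow> bool" where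
  "is_the_extension X U V W F G \<longleftrightarrow>
     bounded_bilinear_on (cfun_space X U) (cfun_space X V) (cfun_space X W) G \<and>
     extends_tensors X U V W F G \<and>
     (\<forall>G'. bounded_bilinear_on (cfun_space X U) (cfun_space X V) (cfun_space X W) G' \<and>
           extends_tensors X U V W F G' \<longrightarrow>
           (\<forall>x\<in>vecs (cfun_space X U). \<forall>y\<in>vecs (cfun_space X V). G' x y = G x y))"

end

theory Submission
  imports Defs
begin

text \<open>Arrows of the extension category are continuous maps \<open>w \<mapsto> x w\<close> into spaces of arrows of \<open>C\<close>,
  and all of its operations are pointwise. So every algebraic identity that it has to satisfy holds
  because it holds in \<open>C\<close> at each point of \<open>\<Omega>\<close>. The work lies in the analysis, and in the conjugates.

  \<^emph>\<open>Banach spaces.\<close> A uniform limit of continuous maps is continuous, so \<open>C(\<Omega>, V)\<close> is complete. The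
  space \<open>(e, f)\<close> is cut out of it by the equations \<open>x e = x = f x\<close>, which survive limits. Bounded
  bilinear maps extend pointwise, with the same bound (\<open>ext_arr_bounded_bilinear\<close>); this covers
  composition and tensor products alike.

  \<^emph>\<open>Positivity.\<close> Let \<open>x\<close> be an arrow from \<open>e\<close> to \<open>f\<close> and let \<open>z\<close> lie off the half line \<open>[0, \<infinity>)\<close>. In
  \<open>C\<close> the element \<open>x(w)\<^sup>* x(w) - z\<close> has an inverse \<open>t(w)\<close> for every \<open>w\<close>, by the positivity axiom. The
  resolvent identity \<open>t' - t = t' (d - d') t\<close> makes \<open>t\<close> continuous (\<open>CF_inverse\<close>), and compressing by
  \<open>e\<close>, which commutes with \<open>t\<close>, gives the inverse \<open>t e\<close> in the corner \<open>(e, e)\<close> (\<open>corner_positive\<close>).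

  \<^emph>\<open>Uniqueness of extensions, and \<open>(\<iota>\<^sub>\<Omega>, \<iota>\<^sub>\<Omega>)\<close>.\<close> Both rest on the density of the elementary tensors
  (\<open>etensor_dense\<close>). For \<open>\<epsilon> > 0\<close> finitely many values \<open>s\<^sub>i\<close> of \<open>x\<close> are \<open>\<epsilon>\<close>-dense in its range; the
  functions \<open>max 0 (\<epsilon> - \<parallel>x(w) - s\<^sub>i\<parallel>)\<close>, divided by their sum, form a partition of unity \<open>f\<^sub>i\<close>, and
  \<open>\<Sum>\<^sub>i f\<^sub>i \<otimes> s\<^sub>i\<close> is within \<open>\<epsilon>\<close> of \<open>x\<close>.

  \<^emph>\<open>Symmetry.\<close> The arrow \<open>\<theta>(a, b) (e(w) \<times> f(w))\<close> is the symmetry of \<open>(a, e)\<close> and \<open>(b, f)\<close>.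

  \<^emph>\<open>Conjugates.\<close> A solution \<open>R\<close>, \<open>R'\<close> of the conjugate equations for \<open>a\<close> and \<open>b\<close> says exactly that \<open>R\<close>
  and \<open>R'\<^sup>*\<close> exhibit \<open>b\<close> as a dual of \<open>a\<close>: one of the equations is a zigzag identity for this pair,
  the other is the adjoint of the second zigzag identity. The dual of
  the subobject \<open>e\<close> of \<open>a\<close> is therefore the transpose \<open>p\<close> of \<open>e\<close>, the arrow with
  \<open>(p \<times> 1) R = (1 \<times> e) R\<close>. Transposition need not commute with the involution, so \<open>p\<close> is an
  idempotent that may fail to be self-adjoint. Its range projection \<open>q\<close> (\<open>idempotent_range_projection\<close>,
  a formula of Kaplansky) satisfies \<open>p q = q\<close> and \<open>q p = p\<close>, hence is isomorphic to \<open>p\<close>, and carrying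
  the duality along this isomorphism gives the solution \<open>S = (1 \<times> e) R\<close>, \<open>S' = (e \<times> q) R'\<close> for \<open>e\<close> and
  \<open>q\<close> (\<open>conjugate_of_projection\<close>). This argument works in any strict tensor C*-category; it is applied
  to the extension category itself, which provides the continuity of \<open>q\<close>.\<close>

section \<open>Normed spaces with explicit carrier\<close>

text \<open>The axioms of \<^locale>\<open>complex_banach\<close> without completeness. Completeness is a statement about
  the metric, so for a space under construction the metric has to be established first.\<close>

locale complex_normed =
  fixes V :: "'a nspace" (structure)
  assumes zero_closed: "\<zero> \<in> vecs V"
    and add_closed: "\<lbrakk>u \<in> vecs V; v \<in> vecs V\<rbrakk> \<Longrightarrow> u \<oplus> v \<in> vecs V"
    and scale_closed: "u \<in> vecs V \<Longrightarrow> c \<odot> u \<in> vecs V"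
    and add_assoc: "\<lbrakk>u \<in> vecs V; v \<in> vecs V; w \<in> vecs V\<rbrakk> \<Longrightarrow> (u \<oplus> v) \<oplus> w = u \<oplus> (v \<oplus> w)"
    and add_commute: "\<lbrakk>u \<in> vecs V; v \<in> vecs V\<rbrakk> \<Longrightarrow> u \<oplus> v = v \<oplus> u"
    and add_zero: "u \<in> vecs V \<Longrightarrow> \<zero> \<oplus> u = u"
    and add_neg: "u \<in> vecs V \<Longrightarrow> u \<oplus> (- 1) \<odot> u = \<zero>"
    and scale_add_right: "\<lbrakk>u \<in> vecs V; v \<in> vecs V\<rbrakk> \<Longrightarrow> c \<odot> (u \<oplus> v) = c \<odot> u \<oplus> c \<odot> v"
    and scale_add_left: "u \<in> vecs V \<Longrightarrow> (c + d) \<odot> u = c \<odot> u \<oplus> d \<odot> u"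
    and scale_scale: "u \<in> vecs V \<Longrightarrow> c \<odot> (d \<odot> u) = (c * d) \<odot> u"
    and scale_one: "u \<in> vecs V \<Longrightarrow> 1 \<odot> u = u"
    and norm_nonneg: "u \<in> vecs V \<Longrightarrow> 0 \<le> nnorm V u"
    and norm_eq_zero: "u \<in> vecs V \<Longrightarrow> nnorm V u = 0 \<longleftrightarrow> u = \<zero>"
    and norm_scale: "u \<in> vecs V \<Longrightarrow> nnorm V (c \<odot> u) = cmod c * nnorm V u"
    and norm_triangle: "\<lbrakk>u \<in> vecs V; v \<in> vecs V\<rbrakk> \<Longrightarrow> nnorm V (u \<oplus> v) \<le> nnorm V u + nnorm V v"

context complex_normed
begin

abbreviation minus_vec (infixl "\<ominus>" 65) where "u \<ominus> v \<equiv> ndiff V u v"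

lemma diff_closed: "\<lbrakk>u \<in> vecs V; v \<in> vecs V\<rbrakk> \<Longrightarrow> u \<ominus> v \<in> vecs V"
  by (simp add: ndiff_def add_closed scale_closed)

lemma add_zero_right: "u \<in> vecs V \<Longrightarrow> u \<oplus> \<zero> = u"
  using add_zero add_commute zero_closed by metis

lemma scale_zero_left: assumes "u \<in> vecs V" shows "0 \<odot> u = \<zero>"
  using scale_add_left[OF assms, of 1 "-1"] scale_one[OF assms] add_neg[OF assms] by simp

lemma scale_zero_right: "c \<odot> \<zero> = \<zero>"
  using scale_scale[OF zero_closed, of c 0] scale_zero_left[OF zero_closed] by simp

lemma add_left_commute:
  "\<lbrakk>u \<in> vecs V; v \<in> vecs V; w \<in> vecs V\<rbrakk> \<Longrightarrow> u \<oplus> (v \<oplus> w) = v \<oplus> (u \<oplus> w)"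
  using add_assoc add_commute by metis

lemma diff_self: "u \<in> vecs V \<Longrightarrow> u \<ominus> u = \<zero>"
  by (simp add: ndiff_def add_neg)

lemma diff_add_cancel: "\<lbrakk>u \<in> vecs V; v \<in> vecs V\<rbrakk> \<Longrightarrow> (u \<ominus> v) \<oplus> v = u"
  unfolding ndiff_def using add_assoc add_commute scale_closed add_neg add_zero_right by metis

lemma diff_eq_zero: "\<lbrakk>u \<in> vecs V; v \<in> vecs V\<rbrakk> \<Longrightarrow> u \<ominus> v = \<zero> \<longleftrightarrow> u = v"
  using diff_add_cancel add_zero diff_self by metis

lemma diff_add_add:
  "\<lbrakk>u \<in> vecs V; v \<in> vecs V; u' \<in> vecs V; v' \<in> vecs V\<rbrakk> \<Longrightarrow>
    (u \<oplus> v) \<ominus> (u' \<oplus> v') = (u \<ominus> u') \<oplus> (v \<ominus> v')"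
  by (simp add: ndiff_def scale_add_right add_assoc add_closed scale_closed add_left_commute)

lemma scale_diff: "\<lbrakk>u \<in> vecs V; v \<in> vecs V\<rbrakk> \<Longrightarrow> c \<odot> (u \<ominus> v) = c \<odot> u \<ominus> c \<odot> v"
  by (simp add: ndiff_def scale_add_right scale_scale scale_closed mult.commute)

lemma diff_add_diff:
  "\<lbrakk>u \<in> vecs V; v \<in> vecs V; w \<in> vecs V\<rbrakk> \<Longrightarrow> (u \<ominus> v) \<oplus> (v \<ominus> w) = u \<ominus> w"
  using diff_add_cancel[of u v] add_assoc[of "u \<ominus> v" v "(-1) \<odot> w"]
  by (simp add: ndiff_def scale_closed add_closed)

lemma diff_minus: "\<lbrakk>u \<in> vecs V; v \<in> vecs V\<rbrakk> \<Longrightarrow> (-1) \<odot> (u \<ominus> v) = v \<ominus> u"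
  by (simp add: ndiff_def scale_add_right scale_scale scale_closed scale_one add_commute)

lemma norm_diff_commute: "\<lbrakk>u \<in> vecs V; v \<in> vecs V\<rbrakk> \<Longrightarrow> nnorm V (u \<ominus> v) = nnorm V (v \<ominus> u)"
  using diff_minus[of u v] norm_scale[OF diff_closed, of u v "-1"] by simp

lemma norm_diff_triangle:
  "\<lbrakk>u \<in> vecs V; v \<in> vecs V; w \<in> vecs V\<rbrakk> \<Longrightarrow>
    nnorm V (u \<ominus> w) \<le> nnorm V (u \<ominus> v) + nnorm V (v \<ominus> w)"
  using norm_triangle[OF diff_closed diff_closed, of u v v w] diff_add_diff[of u v w] by simp

lemma norm_diff_eq_zero: "\<lbrakk>u \<in> vecs V; v \<in> vecs V\<rbrakk> \<Longrightarrow> nnorm V (u \<ominus> v) = 0 \<longleftrightarrow> u = v"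
  using norm_eq_zero diff_closed diff_eq_zero by metis

lemma norm_diff_nonneg: "\<lbrakk>u \<in> vecs V; v \<in> vecs V\<rbrakk> \<Longrightarrow> 0 \<le> nnorm V (u \<ominus> v)"
  by (simp add: diff_closed norm_nonneg)

lemma norm_le_add_diff:
  "\<lbrakk>u \<in> vecs V; v \<in> vecs V\<rbrakk> \<Longrightarrow> nnorm V u \<le> nnorm V v + nnorm V (u \<ominus> v)"
  using norm_triangle[OF diff_closed, of u v v] diff_add_cancel[of u v] by simp

lemma norm_zero [simp]: "nnorm V \<zero> = 0"
  using norm_eq_zero[OF zero_closed] by simp

lemma Metric_space_ndist: "Metric_space (vecs V) (ndist V)"
  by unfold_locales
     (auto simp: ndist_def norm_diff_nonneg norm_diff_commute norm_diff_eq_zero norm_diff_triangle)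

sublocale M: Metric_space "vecs V" "ndist V"
  by (rule Metric_space_ndist)

lemma ntopology_eq: "ntopology V = M.mtopology"
  by (simp add: ntopology_def)

lemma topspace_ntopology [simp]: "topspace (ntopology V) = vecs V"
  by (simp add: ntopology_eq)

text \<open>Continuity becomes convergence to \<open>0\<close> of real functions, so that it can be proved by comparing
  them.\<close>

lemma continuous_map_ntopology_iff:
  "continuous_map X (ntopology V) x \<longleftrightarrow>
     x \<in> topspace X \<rightarrow> vecs V \<and>
     (\<forall>w\<in>topspace X. ((\<lambda>w'. nnorm V (x w' \<ominus> x w)) \<longlongrightarrow> 0) (atin X w))"
  (is "?L \<longleftrightarrow> ?R1 \<and> ?R2")
proof (cases ?R1)
  case True
  have ev: "eventually (\<lambda>w'. x w' \<in> vecs V) (atin X w)" for w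
    using True unfolding eventually_atin by (cases "w \<in> topspace X") auto
  have "((\<lambda>w'. ndist V (x w') (x w)) \<longlongrightarrow> 0) (atin X w) \<longleftrightarrow>
        ((\<lambda>w'. nnorm V (x w' \<ominus> x w)) \<longlongrightarrow> 0) (atin X w)" if "w \<in> topspace X" for w
  proof (rule tendsto_cong)
    show "\<forall>\<^sub>F w' in atin X w. ndist V (x w') (x w) = nnorm V (x w' \<ominus> x w)"
      using ev[of w] by eventually_elim (use True that in \<open>auto simp: ndist_def\<close>)
  qed
  then show ?thesis
    using True ev by (auto simp: continuous_map_atin ntopology_eq M.limitin_metric_dist_null)
next
  case False
  then show ?thesis using continuous_map_funspace[of X "ntopology V" x] by auto
qed

lemma closedin_ntopologyD:
  assumes "closedin (ntopology V) S" "x \<in> vecs V"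
    and approx: "\<And>\<epsilon>. \<epsilon> > 0 \<Longrightarrow> \<exists>y\<in>S. nnorm V (x \<ominus> y) \<le> \<epsilon>"
  shows "x \<in> S"
proof (rule ccontr)
  assume "x \<notin> S"
  then obtain r where r: "r > 0" "disjnt S (M.mball x r)" and S: "S \<subseteq> vecs V"
    using assms(1,2) unfolding ntopology_eq M.closedin_metric by auto
  obtain y where y: "y \<in> S" "nnorm V (x \<ominus> y) \<le> r / 2" using approx[of "r / 2"] r by auto
  then have "y \<in> M.mball x r" using S assms(2) r(1) by (auto simp: ndist_def)
  then show False using y r(2) by (auto simp: disjnt_def)
qed

lemma mcomplete_ndist_iff:
  "M.mcomplete \<longleftrightarrow> (\<forall>u. (\<forall>n. u n \<in> vecs V) \<and>
      (\<forall>\<epsilon>>0. \<exists>N. \<forall>m\<ge>N. \<forall>n\<ge>N. nnorm V (u m \<ominus> u n) < \<epsilon>) \<longrightarrow>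
      (\<exists>l\<in>vecs V. (\<lambda>n. nnorm V (u n \<ominus> l)) \<longlonglongrightarrow> 0))"
proof -
  have "M.MCauchy u \<longleftrightarrow> (\<forall>n. u n \<in> vecs V) \<and>
      (\<forall>\<epsilon>>0. \<exists>N. \<forall>m\<ge>N. \<forall>n\<ge>N. nnorm V (u m \<ominus> u n) < \<epsilon>)" for u :: "nat \<Rightarrow> 'a"
    unfolding M.MCauchy_def image_subset_iff ndist_def by auto
  moreover have "limitin M.mtopology u l sequentially \<longleftrightarrow>
      l \<in> vecs V \<and> (\<lambda>n. nnorm V (u n \<ominus> l)) \<longlonglongrightarrow> 0" if "\<forall>n. u n \<in> vecs V" for u l
    using that by (auto simp: M.limitin_metric_dist_null ndist_def)
  ultimately show ?thesis unfolding M.mcomplete_def by (intro all_cong1) blast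
qed

lemma complex_banachI:
  assumes "\<And>u. \<lbrakk>\<And>n. u n \<in> vecs V; \<And>\<epsilon>. \<epsilon> > 0 \<Longrightarrow> \<exists>N. \<forall>m\<ge>N. \<forall>n\<ge>N. nnorm V (u m \<ominus> u n) < \<epsilon>\<rbrakk> \<Longrightarrow>
      \<exists>l\<in>vecs V. (\<lambda>n. nnorm V (u n \<ominus> l)) \<longlonglongrightarrow> 0"
  shows "complex_banach V"
proof unfold_locales
  show "M.mcomplete" unfolding mcomplete_ndist_iff using assms by blast
qed (fact zero_closed add_closed scale_closed add_assoc add_commute add_zero add_neg
      scale_add_right scale_add_left scale_scale scale_one norm_nonneg norm_eq_zero norm_scale
      norm_triangle)+

end

sublocale complex_banach \<subseteq> complex_normed
  by unfold_locales
     (fact zero_closed add_closed scale_closed add_assoc add_commute add_zero add_neg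
      scale_add_right scale_add_left scale_scale scale_one norm_nonneg norm_eq_zero norm_scale
      norm_triangle)+

context complex_banach
begin

lemma Cauchy_limit:
  assumes "\<And>n. u n \<in> vecs V"
    and "\<And>\<epsilon>. \<epsilon> > 0 \<Longrightarrow> \<exists>N. \<forall>m\<ge>N. \<forall>n\<ge>N. nnorm V (ndiff V (u m) (u n)) < \<epsilon>"
  obtains l where "l \<in> vecs V" "(\<lambda>n. nnorm V (ndiff V (u n) l)) \<longlonglongrightarrow> 0"
  using complete assms unfolding mcomplete_ndist_iff by blast

lemma restrict_complex_banach:
  assumes S: "S \<subseteq> vecs V" "\<zero> \<in> S"
    "\<And>u v. \<lbrakk>u \<in> S; v \<in> S\<rbrakk> \<Longrightarrow> u \<oplus> v \<in> S" "\<And>c u. u \<in> S \<Longrightarrow> c \<odot> u \<in> S"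
    and closed: "\<And>u l. \<lbrakk>\<And>n. u n \<in> S; l \<in> vecs V;
        (\<lambda>n. nnorm V (ndiff V (u n) l)) \<longlonglongrightarrow> 0\<rbrakk> \<Longrightarrow> l \<in> S"
  shows "complex_banach (V\<lparr>vecs := S\<rparr>)"
proof -
  let ?W = "V\<lparr>vecs := S\<rparr>"
  have nd: "ndiff ?W = ndiff V" by (simp add: ndiff_def fun_eq_iff)
  have mem: "u \<in> vecs V" if "u \<in> S" for u using S(1) that by blast
  interpret W: complex_normed ?W
    using S(2-4)
    by unfold_locales
       (auto dest!: mem simp: add_assoc add_zero add_neg scale_add_right scale_add_left
          scale_scale scale_one norm_nonneg norm_eq_zero norm_scale norm_triangle
          intro: add_commute)
  show ?thesis
  proof (rule W.complex_banachI)
    fix u :: "nat \<Rightarrow> 'a"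
    assume u: "\<And>n. u n \<in> vecs ?W"
      and Cauchy: "\<And>\<epsilon>. \<epsilon> > 0 \<Longrightarrow> \<exists>N. \<forall>m\<ge>N. \<forall>n\<ge>N. nnorm ?W (ndiff ?W (u m) (u n)) < \<epsilon>"
    obtain l where "l \<in> vecs V" "(\<lambda>n. nnorm V (ndiff V (u n) l)) \<longlonglongrightarrow> 0"
      using Cauchy_limit[of u] u Cauchy mem by (auto simp: nd)
    then show "\<exists>l\<in>vecs ?W. (\<lambda>n. nnorm ?W (ndiff ?W (u n) l)) \<longlonglongrightarrow> 0"
      using closed[of u l] u by (auto simp: nd)
  qed
qed

end

section \<open>Continuous functions with values in a Banach space\<close>

lemma cfun_space_simps [simp]:
  "nzero (cfun_space X V) = (\<lambda>w\<in>topspace X. \<zero>\<^bsub>V\<^esub>)"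
  "nadd (cfun_space X V) x y = (\<lambda>w\<in>topspace X. x w \<oplus>\<^bsub>V\<^esub> y w)"
  "nscale (cfun_space X V) c x = (\<lambda>w\<in>topspace X. c \<odot>\<^bsub>V\<^esub> x w)"
  "ndiff (cfun_space X V) x y = (\<lambda>w\<in>topspace X. ndiff V (x w) (y w))"
  by (auto simp: cfun_space_def ndiff_def)

lemma cfun_space_extensional: "x \<in> vecs (cfun_space X V) \<Longrightarrow> x \<in> extensional (topspace X)"
  by (simp add: cfun_space_def)

lemma tendsto_zero_if_le:
  fixes f g :: "'i \<Rightarrow> real"
  assumes "(g \<longlongrightarrow> 0) F" "eventually (\<lambda>i. 0 \<le> f i \<and> f i \<le> g i) F"
  shows "(f \<longlongrightarrow> 0) F"
  using assms by (intro tendsto_sandwich[of "\<lambda>_. 0" f F g]) (auto elim: eventually_mono)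

lemma eventually_atin_topspace: "eventually (\<lambda>w'. w' \<in> topspace X) (atin X w)"
  unfolding eventually_atin using openin_topspace by (cases "w \<in> topspace X") auto

locale cfun_banach = complex_banach V for V :: "'a nspace" (structure) and X :: "'w topology" +
  assumes compact_X: "compact_space X"
begin

lemma cfun_space_mem_iff:
  "x \<in> vecs (cfun_space X V) \<longleftrightarrow> x \<in> extensional (topspace X) \<and> x \<in> topspace X \<rightarrow> vecs V \<and>
     (\<forall>w\<in>topspace X. ((\<lambda>w'. nnorm V (x w' \<ominus> x w)) \<longlongrightarrow> 0) (atin X w))"
  by (simp add: cfun_space_def continuous_map_ntopology_iff)

lemma cfun_space_value: "\<lbrakk>x \<in> vecs (cfun_space X V); w \<in> topspace X\<rbrakk> \<Longrightarrow> x w \<in> vecs V"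
  by (auto simp: cfun_space_mem_iff)

lemma cfun_space_tendsto:
  "\<lbrakk>x \<in> vecs (cfun_space X V); w \<in> topspace X\<rbrakk> \<Longrightarrow>
    ((\<lambda>w'. nnorm V (x w' \<ominus> x w)) \<longlongrightarrow> 0) (atin X w)"
  by (auto simp: cfun_space_mem_iff)

text \<open>Every continuity proof below goes through this rule: \<open>g w\<close> bounds the variation of \<open>f\<close> near \<open>w\<close>
  and tends to \<open>0\<close> there.\<close>

lemma cfun_space_memI:
  assumes "\<And>w. w \<in> topspace X \<Longrightarrow> f w \<in> vecs V"
    and "\<And>w. w \<in> topspace X \<Longrightarrow> (g w \<longlongrightarrow> 0) (atin X w)"
    and "\<And>w. w \<in> topspace X \<Longrightarrow>
           eventually (\<lambda>w'. w' \<in> topspace X \<longrightarrow> nnorm V (f w' \<ominus> f w) \<le> g w w') (atin X w)"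
  shows "(\<lambda>w\<in>topspace X. f w) \<in> vecs (cfun_space X V)"
proof -
  have "((\<lambda>w'. nnorm V ((\<lambda>w\<in>topspace X. f w) w' \<ominus> (\<lambda>w\<in>topspace X. f w) w)) \<longlongrightarrow> 0) (atin X w)"
    if w: "w \<in> topspace X" for w
  proof (rule tendsto_zero_if_le[OF assms(2)[OF w]])
    show "\<forall>\<^sub>F w' in atin X w. 0 \<le> nnorm V ((\<lambda>w\<in>topspace X. f w) w' \<ominus> (\<lambda>w\<in>topspace X. f w) w) \<and>
           nnorm V ((\<lambda>w\<in>topspace X. f w) w' \<ominus> (\<lambda>w\<in>topspace X. f w) w) \<le> g w w'"
      using assms(3)[OF w] eventually_atin_topspace[of X w]
      by eventually_elim (use w assms(1) in \<open>simp add: norm_diff_nonneg\<close>)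
  qed
  then show ?thesis using assms(1) by (auto simp: cfun_space_mem_iff)
qed

lemma cfun_space_const: "s \<in> vecs V \<Longrightarrow> (\<lambda>w\<in>topspace X. s) \<in> vecs (cfun_space X V)"
  by (rule cfun_space_memI[where g = "\<lambda>_ _. 0"]) (auto simp: diff_self norm_eq_zero zero_closed)

lemma cfun_space_norm_tendsto:
  assumes x: "x \<in> vecs (cfun_space X V)" and w: "w \<in> topspace X"
  shows "((\<lambda>w'. nnorm V (x w')) \<longlongrightarrow> nnorm V (x w)) (atin X w)"
proof -
  have "((\<lambda>w'. nnorm V (x w') - nnorm V (x w)) \<longlongrightarrow> 0) (atin X w)"
  proof (rule Lim_null_comparison[OF _ cfun_space_tendsto[OF x w]])
    show "\<forall>\<^sub>F w' in atin X w. norm (nnorm V (x w') - nnorm V (x w)) \<le> nnorm V (x w' \<ominus> x w)"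
      using eventually_atin_topspace[of X w]
    proof eventually_elim
      case (elim w')
      note v = cfun_space_value[OF x elim] cfun_space_value[OF x w]
      show ?case using norm_le_add_diff[OF v] norm_le_add_diff[OF v(2,1)] norm_diff_commute[OF v] by simp
    qed
  qed
  then show ?thesis by (simp add: LIM_zero_iff)
qed

lemma cfun_space_norm_bdd_above:
  assumes x: "x \<in> vecs (cfun_space X V)"
  shows "bdd_above ((\<lambda>w. nnorm V (x w)) ` topspace X)"
proof -
  have "continuous_map X euclideanreal (\<lambda>w. nnorm V (x w))"
    using cfun_space_norm_tendsto[OF x] by (simp add: continuous_map_atin)
  then have "compactin euclideanreal ((\<lambda>w. nnorm V (x w)) ` topspace X)"
    using compact_X image_compactin compact_space_def by metis
  then show ?thesis
    by (simp add: bounded_imp_bdd_above compact_imp_bounded)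
qed

lemma cfun_space_norm_ge:
  "\<lbrakk>x \<in> vecs (cfun_space X V); w \<in> topspace X\<rbrakk> \<Longrightarrow> nnorm V (x w) \<le> nnorm (cfun_space X V) x"
  using cSUP_upper[OF _ cfun_space_norm_bdd_above, of w x] by (auto simp: cfun_space_def)

text \<open>The bound has to be nonnegative because the norm on the empty space is \<open>0\<close>.\<close>

lemma cfun_space_norm_le:
  "\<lbrakk>0 \<le> c; \<And>w. w \<in> topspace X \<Longrightarrow> nnorm V (x w) \<le> c\<rbrakk> \<Longrightarrow> nnorm (cfun_space X V) x \<le> c"
  by (auto simp: cfun_space_def intro: cSUP_least)

lemma cfun_space_norm_nonneg:
  assumes "x \<in> vecs (cfun_space X V)" shows "0 \<le> nnorm (cfun_space X V) x"
proof (cases "topspace X = {}")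
  case False
  then obtain w where "w \<in> topspace X" by blast
  then show ?thesis
    using cfun_space_norm_ge[OF assms] norm_nonneg[OF cfun_space_value[OF assms]] by fastforce
qed (simp add: cfun_space_def)

lemma cfun_space_norm_eqI:
  assumes x: "x \<in> vecs (cfun_space X V)"
    and "0 \<le> c" "\<And>w. w \<in> topspace X \<Longrightarrow> nnorm V (x w) \<le> c" "\<And>d. \<lbrakk>0 \<le> d; \<And>w. w \<in> topspace X \<Longrightarrow> nnorm V (x w) \<le> d\<rbrakk> \<Longrightarrow> c \<le> d"
  shows "nnorm (cfun_space X V) x = c"
  using assms cfun_space_norm_le cfun_space_norm_ge cfun_space_norm_nonneg by (meson order_antisym)

lemma cfun_space_add_closed:
  assumes x: "x \<in> vecs (cfun_space X V)" and y: "y \<in> vecs (cfun_space X V)"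
  shows "(\<lambda>w\<in>topspace X. x w \<oplus> y w) \<in> vecs (cfun_space X V)"
proof (rule cfun_space_memI[where g = "\<lambda>w w'. nnorm V (x w' \<ominus> x w) + nnorm V (y w' \<ominus> y w)"])
  fix w assume w: "w \<in> topspace X"
  note v = cfun_space_value[OF x] cfun_space_value[OF y]
  show "x w \<oplus> y w \<in> vecs V" using w by (simp add: add_closed v)
  show "((\<lambda>w'. nnorm V (x w' \<ominus> x w) + nnorm V (y w' \<ominus> y w)) \<longlongrightarrow> 0) (atin X w)"
    using tendsto_add[OF cfun_space_tendsto[OF x w] cfun_space_tendsto[OF y w]] by simp
  show "\<forall>\<^sub>F w' in atin X w. w' \<in> topspace X \<longrightarrow>
      nnorm V (x w' \<oplus> y w' \<ominus> (x w \<oplus> y w)) \<le> nnorm V (x w' \<ominus> x w) + nnorm V (y w' \<ominus> y w)"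
    using w by (simp add: diff_add_add diff_closed norm_triangle v)
qed

lemma cfun_space_scale_closed:
  assumes x: "x \<in> vecs (cfun_space X V)" and f: "continuous_map X euclidean f"
  shows "(\<lambda>w\<in>topspace X. f w \<odot> x w) \<in> vecs (cfun_space X V)"
proof (rule cfun_space_memI[where g = "\<lambda>w w'. cmod (f w') * nnorm V (x w' \<ominus> x w) + cmod (f w' - f w) * nnorm V (x w)"])
  fix w assume w: "w \<in> topspace X"
  note v = cfun_space_value[OF x]
  show "f w \<odot> x w \<in> vecs V" using w by (simp add: scale_closed v)
  have f': "(f \<longlongrightarrow> f w) (atin X w)" using f w by (simp add: continuous_map_atin)
  have "((\<lambda>w'. cmod (f w') * nnorm V (x w' \<ominus> x w) + cmod (f w' - f w) * nnorm V (x w)) \<longlongrightarrow>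
      cmod (f w) * 0 + cmod (f w - f w) * nnorm V (x w)) (atin X w)"
    by (intro tendsto_intros f' cfun_space_tendsto x w)
  then show "((\<lambda>w'. cmod (f w') * nnorm V (x w' \<ominus> x w) + cmod (f w' - f w) * nnorm V (x w)) \<longlongrightarrow> 0) (atin X w)"
    by simp
  have "nnorm V (f w' \<odot> x w' \<ominus> f w \<odot> x w) \<le> cmod (f w') * nnorm V (x w' \<ominus> x w) + cmod (f w' - f w) * nnorm V (x w)"
    if w': "w' \<in> topspace X" for w'
  proof -
    have "f w' \<odot> x w \<ominus> f w \<odot> x w = (f w' - f w) \<odot> x w"
      using scale_add_left[OF v[OF w], of "f w'" "- f w"] v[OF w] by (simp add: ndiff_def scale_scale)
    then show ?thesis
      using norm_diff_triangle[of "f w' \<odot> x w'" "f w' \<odot> x w" "f w \<odot> x w"] v w w'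
      by (simp add: scale_closed diff_closed norm_scale flip: scale_diff)
  qed
  then show "\<forall>\<^sub>F w' in atin X w. w' \<in> topspace X \<longrightarrow> nnorm V (f w' \<odot> x w' \<ominus> f w \<odot> x w)
       \<le> cmod (f w') * nnorm V (x w' \<ominus> x w) + cmod (f w' - f w) * nnorm V (x w)" by simp
qed

text \<open>The usual three-\<open>\<epsilon>\<close> argument.\<close>

lemma cfun_space_uniform_limit:
  assumes u: "\<And>n. u n \<in> vecs (cfun_space X V)" and l: "\<And>w. w \<in> topspace X \<Longrightarrow> l w \<in> vecs V"
    and unif: "\<And>\<epsilon>. \<epsilon> > 0 \<Longrightarrow> \<exists>n::nat. \<forall>w\<in>topspace X. nnorm V (u n w \<ominus> l w) \<le> \<epsilon>"
  shows "(\<lambda>w\<in>topspace X. l w) \<in> vecs (cfun_space X V)"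
proof (rule cfun_space_memI[where g = "\<lambda>w w'. if w' \<in> topspace X then nnorm V (l w' \<ominus> l w) else 0"])
  fix w assume w: "w \<in> topspace X"
  show "l w \<in> vecs V" using l w .
  show "((\<lambda>w'. if w' \<in> topspace X then nnorm V (l w' \<ominus> l w) else 0) \<longlongrightarrow> 0) (atin X w)"
  proof (rule tendstoI)
    fix \<epsilon> :: real assume "\<epsilon> > 0"
    then obtain n where n: "\<And>w. w \<in> topspace X \<Longrightarrow> nnorm V (u n w \<ominus> l w) \<le> \<epsilon> / 3"
      using unif[of "\<epsilon> / 3"] by auto
    have "\<forall>\<^sub>F w' in atin X w. nnorm V (u n w' \<ominus> u n w) < \<epsilon> / 3"
      using cfun_space_tendsto[OF u w] by (rule order_tendstoD) (use \<open>\<epsilon> > 0\<close> in simp)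
    then show "\<forall>\<^sub>F w' in atin X w. dist (if w' \<in> topspace X then nnorm V (l w' \<ominus> l w) else 0) 0 < \<epsilon>"
    proof eventually_elim
      case (elim w')
      show ?case
      proof (cases "w' \<in> topspace X")
        case w': True
        note v = cfun_space_value[OF u w', of n] cfun_space_value[OF u w, of n] l[OF w] l[OF w']
        have "nnorm V (l w' \<ominus> l w) \<le> nnorm V (l w' \<ominus> u n w') + nnorm V (u n w' \<ominus> l w)"
          by (intro norm_diff_triangle v)
        also have "nnorm V (u n w' \<ominus> l w) \<le> nnorm V (u n w' \<ominus> u n w) + nnorm V (u n w \<ominus> l w)"
          by (intro norm_diff_triangle v)
        finally show ?thesis
          using elim n[OF w] n[OF w'] norm_diff_commute[OF v(1,4)] w' norm_diff_nonneg[OF v(4,3)] by simp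
      qed (use \<open>\<epsilon> > 0\<close> in simp)
    qed
  qed
qed simp

lemma cfun_space_normed: "complex_normed (cfun_space X V)"
proof
  note v = cfun_space_value
  note ext = cfun_space_extensional
  let ?F = "cfun_space X V"
  have eqI: "f = g" if "f \<in> extensional (topspace X)" "g \<in> extensional (topspace X)"
    "\<And>w. w \<in> topspace X \<Longrightarrow> f w = g w" for f g :: "'w \<Rightarrow> 'a" using that by (rule extensionalityI)
  fix c d :: complex and x y z :: "'w \<Rightarrow> 'a"
  show "\<zero>\<^bsub>?F\<^esub> \<in> vecs ?F" by (simp add: cfun_space_const zero_closed)
  assume x: "x \<in> vecs ?F"
  show "c \<odot>\<^bsub>?F\<^esub> x \<in> vecs ?F" using cfun_space_scale_closed[OF x, of "\<lambda>_. c"] by simp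
  show "\<zero>\<^bsub>?F\<^esub> \<oplus>\<^bsub>?F\<^esub> x = x" by (rule eqI) (auto simp: v[OF x] ext[OF x] add_zero)
  show "x \<oplus>\<^bsub>?F\<^esub> (- 1) \<odot>\<^bsub>?F\<^esub> x = \<zero>\<^bsub>?F\<^esub>" by (rule eqI) (auto simp: v[OF x] add_neg)
  show "(c + d) \<odot>\<^bsub>?F\<^esub> x = c \<odot>\<^bsub>?F\<^esub> x \<oplus>\<^bsub>?F\<^esub> d \<odot>\<^bsub>?F\<^esub> x" by (rule eqI) (auto simp: v[OF x] scale_add_left)
  show "c \<odot>\<^bsub>?F\<^esub> d \<odot>\<^bsub>?F\<^esub> x = (c * d) \<odot>\<^bsub>?F\<^esub> x" by (rule eqI) (auto simp: v[OF x] scale_scale)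
  show "1 \<odot>\<^bsub>?F\<^esub> x = x" by (rule eqI) (auto simp: v[OF x] ext[OF x] scale_one)
  show nn: "0 \<le> nnorm ?F x" using cfun_space_norm_nonneg[OF x] .
  show "nnorm ?F x = 0 \<longleftrightarrow> x = \<zero>\<^bsub>?F\<^esub>"
  proof
    assume "nnorm ?F x = 0"
    then have "nnorm V (x w) = 0" if "w \<in> topspace X" for w
      using cfun_space_norm_ge[OF x that] norm_nonneg[OF v[OF x that]] by simp
    then show "x = \<zero>\<^bsub>?F\<^esub>" by (intro eqI) (auto simp: ext[OF x] v[OF x] norm_eq_zero)
  next
    assume "x = \<zero>\<^bsub>?F\<^esub>"
    then have "nnorm ?F x \<le> 0" by (intro cfun_space_norm_le) (auto simp: norm_eq_zero zero_closed)
    then show "nnorm ?F x = 0" using nn by simp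
  qed
  show "nnorm ?F (c \<odot>\<^bsub>?F\<^esub> x) = cmod c * nnorm ?F x"
  proof (rule cfun_space_norm_eqI)
    show "c \<odot>\<^bsub>?F\<^esub> x \<in> vecs ?F" by fact
    show "0 \<le> cmod c * nnorm ?F x" using nn by simp
    show "nnorm V ((c \<odot>\<^bsub>?F\<^esub> x) w) \<le> cmod c * nnorm ?F x" if "w \<in> topspace X" for w
      using that cfun_space_norm_ge[OF x that] by (simp add: norm_scale v[OF x] mult_left_mono)
    fix d assume d: "0 \<le> d" "\<And>w. w \<in> topspace X \<Longrightarrow> nnorm V ((c \<odot>\<^bsub>?F\<^esub> x) w) \<le> d"
    show "cmod c * nnorm ?F x \<le> d"
    proof (cases "c = 0")
      case False
      have "nnorm ?F x \<le> d / cmod c"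
        using d False by (intro cfun_space_norm_le) (auto simp: norm_scale v[OF x] field_simps)
      then show ?thesis using False by (simp add: field_simps)
    qed (use d in simp)
  qed
  assume y: "y \<in> vecs ?F"
  show "x \<oplus>\<^bsub>?F\<^esub> y \<in> vecs ?F" using cfun_space_add_closed[OF x y] by simp
  show "x \<oplus>\<^bsub>?F\<^esub> y = y \<oplus>\<^bsub>?F\<^esub> x" by (rule eqI) (auto simp: v[OF x] v[OF y] intro: add_commute)
  show "c \<odot>\<^bsub>?F\<^esub> (x \<oplus>\<^bsub>?F\<^esub> y) = c \<odot>\<^bsub>?F\<^esub> x \<oplus>\<^bsub>?F\<^esub> c \<odot>\<^bsub>?F\<^esub> y"
    by (rule eqI) (auto simp: v[OF x] v[OF y] scale_add_right)
  show "nnorm ?F (x \<oplus>\<^bsub>?F\<^esub> y) \<le> nnorm ?F x + nnorm ?F y"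
  proof (rule cfun_space_norm_le)
    show "0 \<le> nnorm ?F x + nnorm ?F y" using x y by (simp add: cfun_space_norm_nonneg)
    fix w assume w: "w \<in> topspace X"
    show "nnorm V ((x \<oplus>\<^bsub>?F\<^esub> y) w) \<le> nnorm ?F x + nnorm ?F y"
      using norm_triangle[OF v[OF x w] v[OF y w]] cfun_space_norm_ge[OF x w] cfun_space_norm_ge[OF y w] w
      by simp
  qed
  assume z: "z \<in> vecs ?F"
  show "x \<oplus>\<^bsub>?F\<^esub> y \<oplus>\<^bsub>?F\<^esub> z = x \<oplus>\<^bsub>?F\<^esub> (y \<oplus>\<^bsub>?F\<^esub> z)"
    by (rule eqI) (auto simp: v[OF x] v[OF y] v[OF z] add_assoc)
qed

lemma cfun_space_pointwise_tendsto:
  assumes u: "\<And>n. u n \<in> vecs (cfun_space X V)" and l: "l \<in> vecs (cfun_space X V)" and w: "w \<in> topspace X"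
    and lim: "(\<lambda>n. nnorm (cfun_space X V) (ndiff (cfun_space X V) (u n) l)) \<longlonglongrightarrow> 0"
  shows "(\<lambda>n. nnorm V (u n w \<ominus> l w)) \<longlonglongrightarrow> 0"
proof (rule tendsto_zero_if_le[OF lim])
  interpret F: complex_normed "cfun_space X V" by (rule cfun_space_normed)
  show "\<forall>\<^sub>F n in sequentially. 0 \<le> nnorm V (u n w \<ominus> l w) \<and>
      nnorm V (u n w \<ominus> l w) \<le> nnorm (cfun_space X V) (ndiff (cfun_space X V) (u n) l)"
    using cfun_space_norm_ge[OF F.diff_closed[OF u l] w] w
    by (auto simp: norm_diff_nonneg cfun_space_value[OF u] cfun_space_value[OF l])
qed

text \<open>A Cauchy sequence converges at each point; letting one index tend to infinity in the uniform
  Cauchy estimate shows that it does so uniformly.\<close>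

lemma cfun_space_banach: "complex_banach (cfun_space X V)"
proof -
  let ?F = "cfun_space X V"
  interpret F: complex_normed ?F by (rule cfun_space_normed)
  show ?thesis
  proof (rule F.complex_banachI)
    fix u :: "nat \<Rightarrow> 'w \<Rightarrow> 'a"
    assume u: "\<And>n. u n \<in> vecs ?F"
      and Cauchy: "\<And>\<epsilon>. \<epsilon> > 0 \<Longrightarrow> \<exists>N. \<forall>m\<ge>N. \<forall>n\<ge>N. nnorm ?F (ndiff ?F (u m) (u n)) < \<epsilon>"
    have le: "nnorm V (u m w \<ominus> u n w) \<le> nnorm ?F (ndiff ?F (u m) (u n))" if "w \<in> topspace X" for m n w
      using cfun_space_norm_ge[OF F.diff_closed[OF u u] that] that by simp
    have "\<exists>l. l \<in> vecs V \<and> (\<lambda>n. nnorm V (u n w \<ominus> l)) \<longlonglongrightarrow> 0" if w: "w \<in> topspace X" for w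
    proof (rule Cauchy_limit[of "\<lambda>n. u n w"])
      show "\<exists>N. \<forall>m\<ge>N. \<forall>n\<ge>N. nnorm V (u m w \<ominus> u n w) < \<epsilon>" if "\<epsilon> > 0" for \<epsilon>
        using Cauchy[OF that] le[OF w] by (meson le_less_trans)
    qed (use cfun_space_value[OF u w] in auto)
    then obtain l where l: "\<And>w. w \<in> topspace X \<Longrightarrow> l w \<in> vecs V"
      and lim: "\<And>w. w \<in> topspace X \<Longrightarrow> (\<lambda>n. nnorm V (u n w \<ominus> l w)) \<longlonglongrightarrow> 0" by metis
    have unif: "\<exists>N. \<forall>n\<ge>N. \<forall>w\<in>topspace X. nnorm V (u n w \<ominus> l w) \<le> \<epsilon>" if "\<epsilon> > 0" for \<epsilon>
    proof -
      obtain N where N: "\<And>m n. \<lbrakk>m \<ge> N; n \<ge> N\<rbrakk> \<Longrightarrow> nnorm ?F (ndiff ?F (u m) (u n)) < \<epsilon>"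
        using Cauchy[OF \<open>\<epsilon> > 0\<close>] by blast
      have "nnorm V (u n w \<ominus> l w) \<le> \<epsilon>" if n: "n \<ge> N" and w: "w \<in> topspace X" for n w
      proof (rule tendsto_lowerbound)
        show "(\<lambda>m. nnorm V (u m w \<ominus> l w) + \<epsilon>) \<longlonglongrightarrow> \<epsilon>"
          using tendsto_add[OF lim[OF w] tendsto_const[of \<epsilon>]] by simp
        have "nnorm V (u n w \<ominus> l w) \<le> nnorm V (u m w \<ominus> l w) + \<epsilon>" if "m \<ge> N" for m
          using norm_diff_triangle[of "u n w" "u m w" "l w"] cfun_space_value[OF u w] l[OF w]
            N[OF n that] le[OF w, of n m] by fastforce
        then show "\<forall>\<^sub>F m in sequentially. nnorm V (u n w \<ominus> l w) \<le> nnorm V (u m w \<ominus> l w) + \<epsilon>"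
          by (auto simp: eventually_sequentially)
      qed simp
      then show ?thesis by blast
    qed
    let ?l = "\<lambda>w\<in>topspace X. l w"
    have L: "?l \<in> vecs ?F"
    proof (rule cfun_space_uniform_limit[where u = u])
      show "\<exists>n. \<forall>w\<in>topspace X. nnorm V (u n w \<ominus> l w) \<le> \<epsilon>" if "\<epsilon> > 0" for \<epsilon>
        using unif[OF that] order_refl by metis
    qed (use u l in simp_all)
    have "(\<lambda>n. nnorm ?F (ndiff ?F (u n) ?l)) \<longlonglongrightarrow> 0"
    proof (rule LIMSEQ_I)
      fix r :: real assume "0 < r"
      then obtain N where N: "\<And>n w. \<lbrakk>n \<ge> N; w \<in> topspace X\<rbrakk> \<Longrightarrow> nnorm V (u n w \<ominus> l w) \<le> r / 2"
        using unif[of "r / 2"] by auto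
      have "nnorm ?F (ndiff ?F (u n) ?l) \<le> r / 2" if "n \<ge> N" for n
        using N[OF that] \<open>0 < r\<close> by (intro cfun_space_norm_le) auto
      then show "\<exists>no. \<forall>n\<ge>no. norm (nnorm ?F (ndiff ?F (u n) ?l) - 0) < r"
        using \<open>0 < r\<close> F.norm_nonneg[OF F.diff_closed[OF u L]] by (intro exI[of _ N]) force
    qed
    then show "\<exists>l\<in>vecs ?F. (\<lambda>n. nnorm ?F (ndiff ?F (u n) l)) \<longlonglongrightarrow> 0" using L by blast
  qed
qed

lemma etensor_closed:
  "\<lbrakk>continuous_map X euclidean f; s \<in> vecs V\<rbrakk> \<Longrightarrow> etensor X V f s \<in> vecs (cfun_space X V)"
  using cfun_space_scale_closed[OF cfun_space_const, of s f]
  by (simp add: etensor_def cong: restrict_cong)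

end

section \<open>Bilinear maps and the density of the elementary tensors\<close>

lemma bilinear_onD:
  assumes "bilinear_on U V W G"
  shows bilinear_on_closed: "\<lbrakk>u \<in> vecs U; v \<in> vecs V\<rbrakk> \<Longrightarrow> G u v \<in> vecs W"
    and bilinear_on_add_left:
      "\<lbrakk>u \<in> vecs U; u' \<in> vecs U; v \<in> vecs V\<rbrakk> \<Longrightarrow> G (u \<oplus>\<^bsub>U\<^esub> u') v = G u v \<oplus>\<^bsub>W\<^esub> G u' v"
    and bilinear_on_add_right:
      "\<lbrakk>u \<in> vecs U; v \<in> vecs V; v' \<in> vecs V\<rbrakk> \<Longrightarrow> G u (v \<oplus>\<^bsub>V\<^esub> v') = G u v \<oplus>\<^bsub>W\<^esub> G u v'"
    and bilinear_on_scale_left: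
      "\<lbrakk>u \<in> vecs U; v \<in> vecs V\<rbrakk> \<Longrightarrow> G (c \<odot>\<^bsub>U\<^esub> u) v = c \<odot>\<^bsub>W\<^esub> G u v"
    and bilinear_on_scale_right:
      "\<lbrakk>u \<in> vecs U; v \<in> vecs V\<rbrakk> \<Longrightarrow> G u (c \<odot>\<^bsub>V\<^esub> v) = c \<odot>\<^bsub>W\<^esub> G u v"
  using assms unfolding bilinear_on_def by blast+

lemma bilinear_on_diff:
  assumes G: "bilinear_on U V W G" and "complex_banach U" "complex_banach V"
  shows bilinear_on_diff_left:
      "\<lbrakk>u \<in> vecs U; u' \<in> vecs U; v \<in> vecs V\<rbrakk> \<Longrightarrow> G (ndiff U u u') v = ndiff W (G u v) (G u' v)"
    and bilinear_on_diff_right: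
      "\<lbrakk>u \<in> vecs U; v \<in> vecs V; v' \<in> vecs V\<rbrakk> \<Longrightarrow> G u (ndiff V v v') = ndiff W (G u v) (G u v')"
  using bilinear_onD[OF G] assms(2,3)[THEN complex_banach.scale_closed]
  by (simp_all add: ndiff_def)

lemma bounded_bilinear_on_bound:
  assumes "bounded_bilinear_on U V W G" "complex_banach U" "complex_banach V"
  shows "\<exists>K\<ge>0. \<forall>u\<in>vecs U. \<forall>v\<in>vecs V. nnorm W (G u v) \<le> K * (nnorm U u * nnorm V v)"
proof -
  obtain K where K: "\<And>u v. \<lbrakk>u \<in> vecs U; v \<in> vecs V\<rbrakk> \<Longrightarrow> nnorm W (G u v) \<le> K * nnorm U u * nnorm V v"
    using assms(1) unfolding bounded_bilinear_on_def by blast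
  have "nnorm W (G u v) \<le> max K 0 * (nnorm U u * nnorm V v)" if "u \<in> vecs U" "v \<in> vecs V" for u v
  proof -
    have "0 \<le> nnorm U u * nnorm V v"
      using that assms(2,3) by (simp add: complex_banach.norm_nonneg)
    then show ?thesis using K[OF that] mult_right_mono[of K "max K 0" "nnorm U u * nnorm V v"]
      by (simp add: mult.assoc)
  qed
  then show ?thesis by (intro exI[of _ "max K 0"]) simp
qed

lemma bilinear_on_restrict:
  assumes "bilinear_on U V W G" "S \<subseteq> vecs U" "T \<subseteq> vecs V" "\<And>u v. \<lbrakk>u \<in> S; v \<in> T\<rbrakk> \<Longrightarrow> G u v \<in> R"
  shows "bilinear_on (U\<lparr>vecs := S\<rparr>) (V\<lparr>vecs := T\<rparr>) (W\<lparr>vecs := R\<rparr>) G"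
  using assms unfolding bilinear_on_def by (simp add: subset_iff)

lemma bounded_bilinear_on_restrict:
  assumes G: "bounded_bilinear_on U V W G" and ST: "S \<subseteq> vecs U" "T \<subseteq> vecs V"
    and R: "\<And>u v. \<lbrakk>u \<in> S; v \<in> T\<rbrakk> \<Longrightarrow> G u v \<in> R"
  shows "bounded_bilinear_on (U\<lparr>vecs := S\<rparr>) (V\<lparr>vecs := T\<rparr>) (W\<lparr>vecs := R\<rparr>) G"
proof -
  obtain K where K: "\<forall>u\<in>vecs U. \<forall>v\<in>vecs V. nnorm W (G u v) \<le> K * nnorm U u * nnorm V v"
    using G unfolding bounded_bilinear_on_def by (elim exE conjE)
  have "\<forall>u\<in>S. \<forall>v\<in>T. nnorm W (G u v) \<le> K * nnorm U u * nnorm V v"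
    using K ST by blast
  then show ?thesis
    using bilinear_on_restrict[OF _ ST R, of W] G unfolding bounded_bilinear_on_def by simp blast
qed

lemma ext_arr_apply [simp]: "w \<in> topspace X \<Longrightarrow> ext_arr X F x y w = F (x w) (y w)"
  by (simp add: ext_arr_def)

lemma ext_arr_extensional [simp]: "ext_arr X F x y \<in> extensional (topspace X)"
  by (simp add: ext_arr_def)

text \<open>Continuity follows from
  \<open>G x' y' - G x y = G (x' - x) y' + G x (y' - y)\<close>.\<close>

lemma ext_arr_closed:
  assumes X: "compact_space X" and U: "complex_banach U" and V: "complex_banach V" and W: "complex_banach W"
    and G: "bounded_bilinear_on U V W G"
    and x: "x \<in> vecs (cfun_space X U)" and y: "y \<in> vecs (cfun_space X V)"
  shows "ext_arr X G x y \<in> vecs (cfun_space X W)"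
proof -
  interpret U: cfun_banach U X by (intro cfun_banach.intro cfun_banach_axioms.intro U X)
  interpret V: cfun_banach V X by (intro cfun_banach.intro cfun_banach_axioms.intro V X)
  interpret W: cfun_banach W X by (intro cfun_banach.intro cfun_banach_axioms.intro W X)
  have bil: "bilinear_on U V W G" using G by (simp add: bounded_bilinear_on_def)
  obtain K where K0: "0 \<le> K" and K1:
    "\<forall>u\<in>vecs U. \<forall>v\<in>vecs V. nnorm W (G u v) \<le> K * (nnorm U u * nnorm V v)"
    using bounded_bilinear_on_bound[OF G U V] by (elim exE conjE)
  note K = K0 K1[rule_format]
  note xv = U.cfun_space_value[OF x] and yv = V.cfun_space_value[OF y]
  let ?g = "\<lambda>w w'. K * (nnorm U (U.minus_vec (x w') (x w)) * nnorm V (y w')) +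
        K * (nnorm U (x w) * nnorm V (V.minus_vec (y w') (y w)))"
  have "(\<lambda>w\<in>topspace X. G (x w) (y w)) \<in> vecs (cfun_space X W)"
  proof (rule W.cfun_space_memI[where g = ?g])
    fix w assume w: "w \<in> topspace X"
    show "G (x w) (y w) \<in> vecs W" by (rule bilinear_on_closed[OF bil xv[OF w] yv[OF w]])
    have "(?g w \<longlongrightarrow> K * (0 * nnorm V (y w)) + K * (nnorm U (x w) * 0)) (atin X w)"
      by (intro tendsto_intros U.cfun_space_tendsto V.cfun_space_tendsto V.cfun_space_norm_tendsto x y w)
    then show "(?g w \<longlongrightarrow> 0) (atin X w)" by simp
    have "nnorm W (W.minus_vec (G (x w') (y w')) (G (x w) (y w))) \<le> ?g w w'" if w': "w' \<in> topspace X" for w'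
    proof -
      note v = xv[OF w] xv[OF w'] yv[OF w] yv[OF w']
      have "nnorm W (W.minus_vec (G (x w') (y w')) (G (x w) (y w))) \<le>
          nnorm W (W.minus_vec (G (x w') (y w')) (G (x w) (y w'))) +
          nnorm W (W.minus_vec (G (x w) (y w')) (G (x w) (y w)))"
        by (intro W.norm_diff_triangle bilinear_on_closed[OF bil] v)
      also have "W.minus_vec (G (x w') (y w')) (G (x w) (y w')) = G (U.minus_vec (x w') (x w)) (y w')"
        by (rule bilinear_on_diff_left[OF bil U V, symmetric]) (fact v)+
      also have "W.minus_vec (G (x w) (y w')) (G (x w) (y w)) = G (x w) (V.minus_vec (y w') (y w))"
        by (rule bilinear_on_diff_right[OF bil U V, symmetric]) (fact v)+
      finally show ?thesis
        using K(2)[of "U.minus_vec (x w') (x w)" "y w'"] K(2)[of "x w" "V.minus_vec (y w') (y w)"] v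
        by (simp add: U.diff_closed V.diff_closed)
    qed
    then show "\<forall>\<^sub>F w' in atin X w. w' \<in> topspace X \<longrightarrow>
        nnorm W (W.minus_vec (G (x w') (y w')) (G (x w) (y w))) \<le> ?g w w'" by simp
  qed
  then show ?thesis by (simp add: ext_arr_def)
qed

lemma ext_arr_bounded_bilinear:
  assumes X: "compact_space X" and U: "complex_banach U" and V: "complex_banach V" and W: "complex_banach W"
    and G: "bounded_bilinear_on U V W G"
  shows "bounded_bilinear_on (cfun_space X U) (cfun_space X V) (cfun_space X W) (ext_arr X G)"
proof -
  interpret U: cfun_banach U X by (intro cfun_banach.intro cfun_banach_axioms.intro U X)
  interpret V: cfun_banach V X by (intro cfun_banach.intro cfun_banach_axioms.intro V X)
  interpret W: cfun_banach W X by (intro cfun_banach.intro cfun_banach_axioms.intro W X)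
  have bil: "bilinear_on U V W G" using G by (simp add: bounded_bilinear_on_def)
  obtain K where K0: "0 \<le> K" and K1:
    "\<forall>u\<in>vecs U. \<forall>v\<in>vecs V. nnorm W (G u v) \<le> K * (nnorm U u * nnorm V v)"
    using bounded_bilinear_on_bound[OF G U V] by (elim exE conjE)
  note K = K0 K1[rule_format]
  have bound: "nnorm (cfun_space X W) (ext_arr X G x y) \<le> K * nnorm (cfun_space X U) x * nnorm (cfun_space X V) y"
    if x: "x \<in> vecs (cfun_space X U)" and y: "y \<in> vecs (cfun_space X V)" for x y
  proof (rule W.cfun_space_norm_le)
    show "0 \<le> K * nnorm (cfun_space X U) x * nnorm (cfun_space X V) y"
      using K(1) x y by (simp add: U.cfun_space_norm_nonneg V.cfun_space_norm_nonneg)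
    fix w assume w: "w \<in> topspace X"
    have "nnorm W (G (x w) (y w)) \<le> K * (nnorm U (x w) * nnorm V (y w))"
      using K(2) U.cfun_space_value[OF x w] V.cfun_space_value[OF y w] .
    also have "\<dots> \<le> K * (nnorm (cfun_space X U) x * nnorm (cfun_space X V) y)"
      using K(1) w x y
      by (intro mult_left_mono mult_mono U.cfun_space_norm_ge V.cfun_space_norm_ge U.cfun_space_norm_nonneg
           V.norm_nonneg V.cfun_space_value)
    finally show "nnorm W (ext_arr X G x y w) \<le> K * nnorm (cfun_space X U) x * nnorm (cfun_space X V) y"
      using w by (simp add: mult.assoc)
  qed
  show ?thesis
    unfolding bounded_bilinear_on_def bilinear_on_def
    by (intro conjI ballI allI exI[of _ K] ext_arr_closed[OF X U V W G] bound)
       (auto simp: ext_arr_def bilinear_onD[OF bil] U.cfun_space_value V.cfun_space_value)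
qed

context cfun_banach
begin

text \<open>Here \<open>y\<close> is the sum of the tensors \<open>f\<^sub>i \<otimes> s\<^sub>i\<close>. The estimate is the triangle inequality for
  \<open>(\<Sum>\<^sub>i f\<^sub>i) x - y = \<Sum>\<^sub>i f\<^sub>i (x - s\<^sub>i)\<close>; asserting only that \<open>y\<close> exists lets the induction add one
  tensor at a time, without a notion of finite sums in \<open>V\<close>.\<close>

lemma etensor_combination:
  assumes S: "\<And>u v. \<lbrakk>u \<in> S; v \<in> S\<rbrakk> \<Longrightarrow> u \<oplus>\<^bsub>cfun_space X V\<^esub> v \<in> S" "\<zero>\<^bsub>cfun_space X V\<^esub> \<in> S"
    "S \<subseteq> vecs (cfun_space X V)"
    "\<And>f s. \<lbrakk>continuous_map X euclidean f; s \<in> vecs V\<rbrakk> \<Longrightarrow> etensor X V f s \<in> S"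
    and x: "x \<in> vecs (cfun_space X V)"
    and I: "finite I" and f: "\<And>i. i \<in> I \<Longrightarrow> continuous_map X euclideanreal (f i)"
    and pos: "\<And>i w. \<lbrakk>i \<in> I; w \<in> topspace X\<rbrakk> \<Longrightarrow> 0 \<le> f i w"
    and s: "\<And>i. i \<in> I \<Longrightarrow> s i \<in> vecs V"
  shows "\<exists>y\<in>S. \<forall>w\<in>topspace X. nnorm V (complex_of_real (\<Sum>i\<in>I. f i w) \<odot> x w \<ominus> y w) \<le>
           (\<Sum>i\<in>I. f i w * nnorm V (x w \<ominus> s i))"
  using I f pos s
proof (induction I rule: finite_induct)
  case empty
  then show ?case
    using S(2) by (intro bexI[of _ "\<zero>\<^bsub>cfun_space X V\<^esub>"])
      (auto simp: scale_zero_left cfun_space_value[OF x] diff_self zero_closed)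
next
  case (insert j I)
  then obtain y where y: "y \<in> S" and le: "\<And>w. w \<in> topspace X \<Longrightarrow>
       nnorm V (complex_of_real (\<Sum>i\<in>I. f i w) \<odot> x w \<ominus> y w) \<le> (\<Sum>i\<in>I. f i w * nnorm V (x w \<ominus> s i))"
    by auto
  let ?f = "\<lambda>w. complex_of_real (f j w)"
  let ?z = "etensor X V ?f (s j) \<oplus>\<^bsub>cfun_space X V\<^esub> y"
  have "continuous_map X euclidean ?f"
    using insert.prems(1)[of j] by (auto simp: continuous_map_atin intro: tendsto_of_real)
  then have z: "?z \<in> S" using S(1,4) y insert.prems(3) by blast
  have "nnorm V (complex_of_real (\<Sum>i\<in>insert j I. f i w) \<odot> x w \<ominus> ?z w) \<le>
      (\<Sum>i\<in>insert j I. f i w * nnorm V (x w \<ominus> s i))" if w: "w \<in> topspace X" for w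
  proof -
    have yw: "y w \<in> vecs V" using y S(3) cfun_space_value[OF _ w] by blast
    note v = cfun_space_value[OF x w] insert.prems(3)[of j, simplified]
    let ?c = "complex_of_real (\<Sum>i\<in>I. f i w)"
    have "complex_of_real (\<Sum>i\<in>insert j I. f i w) \<odot> x w \<ominus> ?z w =
        (?f w \<odot> x w \<oplus> ?c \<odot> x w) \<ominus> (?f w \<odot> s j \<oplus> y w)"
      using insert.hyps w v(1) by (simp add: etensor_def scale_add_left)
    also have "\<dots> = ?f w \<odot> (x w \<ominus> s j) \<oplus> (?c \<odot> x w \<ominus> y w)"
      using v yw by (simp add: diff_add_add scale_closed scale_diff)
    also have "nnorm V \<dots> \<le> nnorm V (?f w \<odot> (x w \<ominus> s j)) + nnorm V (?c \<odot> x w \<ominus> y w)"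
      using v yw by (intro norm_triangle scale_closed diff_closed)
    also have "\<dots> \<le> f j w * nnorm V (x w \<ominus> s j) + (\<Sum>i\<in>I. f i w * nnorm V (x w \<ominus> s i))"
      using v le[OF w] insert.prems(2)[of j w] w by (simp add: norm_scale diff_closed)
    finally show ?thesis using insert.hyps by simp
  qed
  then show ?case using z by blast
qed

text \<open>The bump \<open>g w0\<close> around \<open>w0\<close> is read off from \<open>x\<close> itself and vanishes where \<open>x\<close> is farther than
  \<open>\<epsilon>\<close> from \<open>x w0\<close>. Compactness selects finitely many bumps with positive sum \<open>G\<close>; in the convex
  combination with weights \<open>f w0 = g w0 / G\<close> only values within \<open>\<epsilon>\<close> of \<open>x w\<close> occur at \<open>w\<close>.\<close>

lemma etensor_dense:
  assumes S: "\<And>u v. \<lbrakk>u \<in> S; v \<in> S\<rbrakk> \<Longrightarrow> u \<oplus>\<^bsub>cfun_space X V\<^esub> v \<in> S" "\<zero>\<^bsub>cfun_space X V\<^esub> \<in> S"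
    "S \<subseteq> vecs (cfun_space X V)"
    "\<And>f s. \<lbrakk>continuous_map X euclidean f; s \<in> vecs V\<rbrakk> \<Longrightarrow> etensor X V f s \<in> S"
    and x: "x \<in> vecs (cfun_space X V)" and "\<epsilon> > 0"
  shows "\<exists>y\<in>S. nnorm (cfun_space X V) (ndiff (cfun_space X V) x y) \<le> \<epsilon>"
proof -
  note v = cfun_space_value[OF x]
  define g where "g w0 w = max 0 (\<epsilon> - nnorm V (x w \<ominus> x w0))" for w0 w
  have g_cont: "continuous_map X euclideanreal (g w0)" if w0: "w0 \<in> topspace X" for w0
  proof -
    have d: "(\<lambda>w\<in>topspace X. x w \<ominus> x w0) \<in> vecs (cfun_space X V)"
    proof -
      interpret F: complex_normed "cfun_space X V" by (rule cfun_space_normed)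
      show ?thesis
        using F.diff_closed[OF x cfun_space_const[OF v[OF w0]]] by (simp cong: restrict_cong)
    qed
    have "((\<lambda>w'. nnorm V (x w' \<ominus> x w0)) \<longlongrightarrow> nnorm V (x w \<ominus> x w0)) (atin X w)"
      if w: "w \<in> topspace X" for w
    proof -
      have "((\<lambda>w'. nnorm V ((\<lambda>w\<in>topspace X. x w \<ominus> x w0) w')) \<longlongrightarrow> nnorm V (x w \<ominus> x w0)) (atin X w)"
        using cfun_space_norm_tendsto[OF d w] w by simp
      then show ?thesis
        by (rule Lim_transform_eventually)
           (rule eventually_mono[OF eventually_atin_topspace], simp)
    qed
    then show ?thesis
      unfolding g_def continuous_map_atin limitin_canonical_iff
      by (intro ballI tendsto_max tendsto_diff tendsto_const) blast
  qed
  define N where "N w0 = {w \<in> topspace X. g w0 w \<in> {0<..}}" for w0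
  have "\<forall>A\<in>N ` topspace X. openin X A"
    unfolding N_def using openin_continuous_map_preimage[OF g_cont, of _ "{0<..}"] by simp
  moreover have "w \<in> N w" if "w \<in> topspace X" for w
    using that \<open>\<epsilon> > 0\<close> by (simp add: N_def g_def diff_self v)
  then have "topspace X \<subseteq> \<Union>(N ` topspace X)" by blast
  ultimately obtain \<F> where \<F>: "finite \<F>" "\<F> \<subseteq> N ` topspace X" "topspace X \<subseteq> \<Union>\<F>"
    using compact_X unfolding compact_space_alt by meson
  obtain I where I: "I \<subseteq> topspace X" "finite I" "\<F> = N ` I"
    using finite_subset_image[OF \<F>(1,2)] by blast
  have cover: "\<exists>w0\<in>I. g w0 w > 0" if "w \<in> topspace X" for w
    using that \<F>(3) unfolding I(3) N_def by auto
  define G where "G w = (\<Sum>w0\<in>I. g w0 w)" for w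
  have g_nonneg: "0 \<le> g w0 w" for w0 w by (simp add: g_def)
  have G_pos: "G w > 0" if w: "w \<in> topspace X" for w
  proof -
    obtain w0 where "w0 \<in> I" "g w0 w > 0" using cover[OF w] by blast
    then show ?thesis unfolding G_def by (intro sum_pos2[OF I(2)]) (auto simp: g_nonneg)
  qed
  define f where "f w0 w = g w0 w / G w" for w0 w
  have f_cont: "continuous_map X euclideanreal (f w0)" if "w0 \<in> I" for w0
  proof -
    have lim: "(g w0 \<longlongrightarrow> g w0 w) (atin X w)" if "w0 \<in> I" "w \<in> topspace X" for w0 w
      using g_cont[of w0] I(1) that by (auto simp: continuous_map_atin)
    have "(f w0 \<longlongrightarrow> f w0 w) (atin X w)" if w: "w \<in> topspace X" for w
      unfolding f_def G_def using G_pos[OF w]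
      by (intro tendsto_divide tendsto_sum lim w \<open>w0 \<in> I\<close>) (simp_all add: G_def)
    then show ?thesis by (simp add: continuous_map_atin)
  qed
  have f_sum: "(\<Sum>w0\<in>I. f w0 w) = 1" if "w \<in> topspace X" for w
    using G_pos[OF that] by (simp add: f_def G_def flip: sum_divide_distrib)
  have f_nonneg: "0 \<le> f w0 w" if "w \<in> topspace X" for w0 w
    using g_nonneg[of w0 w] G_pos[OF that] by (simp add: f_def)
  have "\<exists>y\<in>S. \<forall>w\<in>topspace X.
      nnorm V (complex_of_real (\<Sum>w0\<in>I. f w0 w) \<odot> x w \<ominus> y w) \<le> (\<Sum>w0\<in>I. f w0 w * nnorm V (x w \<ominus> x w0))"
    by (rule etensor_combination[OF S x I(2)]) (use f_cont f_nonneg v I(1) in auto)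
  then obtain y where y: "y \<in> S" and le: "\<And>w. w \<in> topspace X \<Longrightarrow>
      nnorm V (complex_of_real (\<Sum>w0\<in>I. f w0 w) \<odot> x w \<ominus> y w) \<le> (\<Sum>w0\<in>I. f w0 w * nnorm V (x w \<ominus> x w0))"
    by blast
  have "nnorm V (x w \<ominus> y w) \<le> \<epsilon>" if w: "w \<in> topspace X" for w
  proof -
    have "nnorm V (x w \<ominus> y w) \<le> (\<Sum>w0\<in>I. f w0 w * nnorm V (x w \<ominus> x w0))"
      using le[OF w] f_sum[OF w] by (simp add: scale_one v[OF w])
    also have "\<dots> \<le> (\<Sum>w0\<in>I. f w0 w * \<epsilon>)"
    proof (rule sum_mono)
      fix w0 assume "w0 \<in> I"
      show "f w0 w * nnorm V (x w \<ominus> x w0) \<le> f w0 w * \<epsilon>"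
      proof (cases "nnorm V (x w \<ominus> x w0) \<le> \<epsilon>")
        case True
        then show ?thesis using f_nonneg[OF w] by (intro mult_left_mono)
      qed (simp add: f_def g_def)
    qed
    also have "\<dots> = \<epsilon>" by (simp add: f_sum[OF w] flip: sum_distrib_right)
    finally show ?thesis .
  qed
  then have "nnorm (cfun_space X V) (ndiff (cfun_space X V) x y) \<le> \<epsilon>"
    using \<open>\<epsilon> > 0\<close> by (intro cfun_space_norm_le) auto
  then show ?thesis using y by blast
qed

lemma ctensor_eq_cfun_space: "ctensor X V = cfun_space X V"
proof -
  let ?F = "cfun_space X V"
  let ?T = "{etensor X V f s | f s. continuous_map X euclidean f \<and> s \<in> vecs V}"
  interpret F: complex_banach ?F by (rule cfun_space_banach)
  have "closed_subspace ?F (vecs ?F)"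
    unfolding closed_subspace_def
    using F.zero_closed F.add_closed F.scale_closed closedin_topspace[of "ntopology ?F"] by auto
  then have 1: "closed_subspace ?F hull ?T \<subseteq> vecs ?F"
    by (intro hull_minimal) (auto intro: etensor_closed)
  have "vecs ?F \<subseteq> S" if S: "closed_subspace ?F S" "?T \<subseteq> S" for S
  proof
    fix x assume x: "x \<in> vecs ?F"
    show "x \<in> S"
    proof (rule F.closedin_ntopologyD[OF _ x])
      show cl: "closedin (ntopology ?F) S" using S(1) by (simp add: closed_subspace_def)
      fix \<epsilon> :: real assume "\<epsilon> > 0"
      then show "\<exists>y\<in>S. nnorm ?F (ndiff ?F x y) \<le> \<epsilon>"
        using S x closedin_subset[OF cl] F.topspace_ntopology
        by (intro etensor_dense) (auto simp: closed_subspace_def)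
    qed
  qed
  then have "vecs ?F \<subseteq> closed_subspace ?F hull ?T" unfolding hull_def by blast
  with 1 have "closed_subspace ?F hull ?T = vecs ?F" by blast
  then show ?thesis by (simp add: ctensor_def)
qed

text \<open>The vectors on which \<open>A\<close> and \<open>B\<close> agree form a subspace that contains the elementary tensors, so
  some \<open>y\<close> in it is close to \<open>x\<close>, and then \<open>A x - B x = A (x - y) - B (x - y)\<close> is small.\<close>

lemma linear_determined_by_etensor:
  assumes W: "complex_banach W"
    and A: "\<And>u. u \<in> vecs (cfun_space X V) \<Longrightarrow> A u \<in> vecs W"
      "\<And>u v. \<lbrakk>u \<in> vecs (cfun_space X V); v \<in> vecs (cfun_space X V)\<rbrakk> \<Longrightarrow> A (u \<oplus>\<^bsub>cfun_space X V\<^esub> v) = A u \<oplus>\<^bsub>W\<^esub> A v"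
      "\<And>c u. u \<in> vecs (cfun_space X V) \<Longrightarrow> A (c \<odot>\<^bsub>cfun_space X V\<^esub> u) = c \<odot>\<^bsub>W\<^esub> A u"
      "\<And>u. u \<in> vecs (cfun_space X V) \<Longrightarrow> nnorm W (A u) \<le> K * nnorm (cfun_space X V) u"
    and B: "\<And>u. u \<in> vecs (cfun_space X V) \<Longrightarrow> B u \<in> vecs W"
      "\<And>u v. \<lbrakk>u \<in> vecs (cfun_space X V); v \<in> vecs (cfun_space X V)\<rbrakk> \<Longrightarrow> B (u \<oplus>\<^bsub>cfun_space X V\<^esub> v) = B u \<oplus>\<^bsub>W\<^esub> B v"
      "\<And>c u. u \<in> vecs (cfun_space X V) \<Longrightarrow> B (c \<odot>\<^bsub>cfun_space X V\<^esub> u) = c \<odot>\<^bsub>W\<^esub> B u"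
      "\<And>u. u \<in> vecs (cfun_space X V) \<Longrightarrow> nnorm W (B u) \<le> L * nnorm (cfun_space X V) u"
    and eq: "\<And>f s. \<lbrakk>continuous_map X euclidean f; s \<in> vecs V\<rbrakk> \<Longrightarrow> A (etensor X V f s) = B (etensor X V f s)"
    and x: "x \<in> vecs (cfun_space X V)"
  shows "A x = B x"
proof -
  let ?F = "cfun_space X V"
  interpret F: complex_banach ?F by (rule cfun_space_banach)
  interpret W: complex_banach W by (rule W)
  let ?S = "{y \<in> vecs ?F. A y = B y}"
  have zero: "A \<zero>\<^bsub>?F\<^esub> = B \<zero>\<^bsub>?F\<^esub>"
    using A(3)[OF F.zero_closed, of 0] B(3)[OF F.zero_closed, of 0] F.scale_zero_left[OF F.zero_closed]
      W.scale_zero_left[OF A(1)[OF F.zero_closed]] W.scale_zero_left[OF B(1)[OF F.zero_closed]] by simp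
  have diff: "A (ndiff ?F u v) = ndiff W (A u) (A v)" "B (ndiff ?F u v) = ndiff W (B u) (B v)"
    if "u \<in> vecs ?F" "v \<in> vecs ?F" for u v
    using that by (simp_all add: ndiff_def A(2,3) B(2,3) F.scale_closed del: cfun_space_simps)
  have "nnorm W (ndiff W (A x) (B x)) \<le> \<epsilon>" if "\<epsilon> > 0" for \<epsilon>
  proof -
    (* so that |K| \<delta> + |L| \<delta> \<le> \<epsilon>; the summand 1 covers K = L = 0 *)
    define \<delta> where "\<delta> = \<epsilon> / (\<bar>K\<bar> + \<bar>L\<bar> + 1)"
    have KL: "\<bar>K\<bar> + \<bar>L\<bar> + 1 > 0" by linarith
    have "\<delta> > 0" unfolding \<delta>_def using \<open>\<epsilon> > 0\<close> KL by (rule divide_pos_pos)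
    have "\<exists>y\<in>?S. nnorm ?F (ndiff ?F x y) \<le> \<delta>"
      using \<open>\<delta> > 0\<close> x
    proof (intro etensor_dense)
      show "\<And>u v. u \<in> ?S \<Longrightarrow> v \<in> ?S \<Longrightarrow> u \<oplus>\<^bsub>?F\<^esub> v \<in> ?S"
        using A(2) B(2) F.add_closed by auto
      show "\<zero>\<^bsub>?F\<^esub> \<in> ?S" using zero F.zero_closed by simp
      show "\<And>f s. continuous_map X euclidean f \<Longrightarrow> s \<in> vecs V \<Longrightarrow> etensor X V f s \<in> ?S"
        using eq etensor_closed by simp
    qed auto
    then obtain y where y: "y \<in> vecs ?F" "A y = B y" and d: "nnorm ?F (ndiff ?F x y) \<le> \<delta>" by blast
    note xy = F.diff_closed[OF x y(1)]
    have le: "M * nnorm ?F (ndiff ?F x y) \<le> \<bar>M\<bar> * \<delta>" for M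
      by (rule mult_mono[OF abs_ge_self d abs_ge_zero F.norm_nonneg[OF xy]])
    have "nnorm W (ndiff W (A x) (B x)) \<le> nnorm W (ndiff W (A x) (A y)) + nnorm W (ndiff W (A y) (B x))"
      by (rule W.norm_diff_triangle[OF A(1)[OF x] A(1)[OF y(1)] B(1)[OF x]])
    also have "ndiff W (A x) (A y) = A (ndiff ?F x y)" by (rule diff(1)[OF x y(1), symmetric])
    also have "nnorm W (ndiff W (A y) (B x)) = nnorm W (B (ndiff ?F x y))"
      unfolding diff(2)[OF x y(1)] y(2) by (rule W.norm_diff_commute[OF B(1)[OF y(1)] B(1)[OF x]])
    also have "nnorm W (A (ndiff ?F x y)) + nnorm W (B (ndiff ?F x y)) \<le> \<bar>K\<bar> * \<delta> + \<bar>L\<bar> * \<delta>"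
      using A(4)[OF xy] B(4)[OF xy] le[of K] le[of L] by linarith
    also have "\<dots> \<le> (\<bar>K\<bar> + \<bar>L\<bar> + 1) * \<delta>" using \<open>\<delta> > 0\<close> by (simp add: algebra_simps)
    also have "\<dots> = \<epsilon>" using KL by (simp add: \<delta>_def)
    finally show ?thesis .
  qed
  then have "nnorm W (ndiff W (A x) (B x)) \<le> 0" by (rule field_le_epsilon) simp
  then show ?thesis
    using W.norm_diff_nonneg[OF A(1) B(1), OF x x] W.norm_diff_eq_zero[OF A(1) B(1), OF x x] by simp
qed

end

text \<open>Apply the linear statement in the second variable, with an elementary tensor in the first, and
  then in the first variable.\<close>

lemma bounded_bilinear_determined_by_etensor:
  assumes X: "compact_space X" and U: "complex_banach U" and V: "complex_banach V" and W: "complex_banach W"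
    and G: "bounded_bilinear_on (cfun_space X U) (cfun_space X V) W G"
    and G': "bounded_bilinear_on (cfun_space X U) (cfun_space X V) W G'"
    and eq: "\<And>f s f' s'. \<lbrakk>continuous_map X euclidean f; s \<in> vecs U; continuous_map X euclidean f'; s' \<in> vecs V\<rbrakk> \<Longrightarrow>
        G (etensor X U f s) (etensor X V f' s') = G' (etensor X U f s) (etensor X V f' s')"
    and x: "x \<in> vecs (cfun_space X U)" and y: "y \<in> vecs (cfun_space X V)"
  shows "G x y = G' x y"
proof -
  interpret U: cfun_banach U X by (intro cfun_banach.intro cfun_banach_axioms.intro U X)
  interpret V: cfun_banach V X by (intro cfun_banach.intro cfun_banach_axioms.intro V X)
  note FU = U.cfun_space_banach and FV = V.cfun_space_banach
  obtain K where "\<forall>u\<in>vecs (cfun_space X U). \<forall>v\<in>vecs (cfun_space X V).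
      nnorm W (G u v) \<le> K * (nnorm (cfun_space X U) u * nnorm (cfun_space X V) v)"
    using bounded_bilinear_on_bound[OF G FU FV] by (elim exE conjE)
  note K = this[rule_format]
  obtain L where "\<forall>u\<in>vecs (cfun_space X U). \<forall>v\<in>vecs (cfun_space X V).
      nnorm W (G' u v) \<le> L * (nnorm (cfun_space X U) u * nnorm (cfun_space X V) v)"
    using bounded_bilinear_on_bound[OF G' FU FV] by (elim exE conjE)
  note L = this[rule_format]
  have b: "bilinear_on (cfun_space X U) (cfun_space X V) W G" "bilinear_on (cfun_space X U) (cfun_space X V) W G'"
    using G G' by (simp_all add: bounded_bilinear_on_def)
  note lin = b[THEN bilinear_on_closed] b[THEN bilinear_on_add_left] b[THEN bilinear_on_add_right]
    b[THEN bilinear_on_scale_left] b[THEN bilinear_on_scale_right]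
  have 1: "G (etensor X U f s) y = G' (etensor X U f s) y"
    if fs: "continuous_map X euclidean f" "s \<in> vecs U" for f s
  proof (rule V.linear_determined_by_etensor[OF W, where A = "G (etensor X U f s)" and B = "G' (etensor X U f s)"])
    note t = U.etensor_closed[OF fs]
    show "nnorm W (G (etensor X U f s) v) \<le> (K * nnorm (cfun_space X U) (etensor X U f s)) * nnorm (cfun_space X V) v"
      "nnorm W (G' (etensor X U f s) v) \<le> (L * nnorm (cfun_space X U) (etensor X U f s)) * nnorm (cfun_space X V) v"
      if "v \<in> vecs (cfun_space X V)" for v
      using K[OF t that] L[OF t that] by (simp_all add: mult.assoc)
  qed (simp_all add: lin U.etensor_closed eq fs y del: cfun_space_simps)
  show ?thesis
  proof (rule U.linear_determined_by_etensor[OF W, where A = "\<lambda>u. G u y" and B = "\<lambda>u. G' u y"])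
    show "nnorm W (G u y) \<le> (K * nnorm (cfun_space X V) y) * nnorm (cfun_space X U) u"
      "nnorm W (G' u y) \<le> (L * nnorm (cfun_space X V) y) * nnorm (cfun_space X U) u"
      if "u \<in> vecs (cfun_space X U)" for u
      using K[OF that y] L[OF that y] by (simp_all add: ac_simps)
  qed (simp_all add: lin 1 x y del: cfun_space_simps)
qed

lemma ext_arr_is_the_extension:
  assumes X: "compact_space X" and U: "complex_banach U" and V: "complex_banach V" and W: "complex_banach W"
    and G: "bounded_bilinear_on U V W G"
  shows "is_the_extension X U V W G (ext_arr X G)"
proof -
  interpret U: complex_banach U by (rule U)
  interpret V: complex_banach V by (rule V)
  interpret W: cfun_banach W X by (intro cfun_banach.intro cfun_banach_axioms.intro W X)
  have bil: "bilinear_on U V W G" using G by (simp add: bounded_bilinear_on_def)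
  have ext: "extends_tensors X U V W G (ext_arr X G)"
    unfolding extends_tensors_def
    by (auto simp: ext_arr_def etensor_def bilinear_onD[OF bil] U.scale_closed V.scale_closed W.scale_scale mult.commute
        intro!: restrict_ext)
  show ?thesis
    unfolding is_the_extension_def
  proof (intro conjI allI impI ballI)
    show bb: "bounded_bilinear_on (cfun_space X U) (cfun_space X V) (cfun_space X W) (ext_arr X G)"
      by (rule ext_arr_bounded_bilinear[OF X U V W G])
    show "extends_tensors X U V W G (ext_arr X G)" by (rule ext)
    fix G' x y
    assume G': "bounded_bilinear_on (cfun_space X U) (cfun_space X V) (cfun_space X W) G' \<and>
        extends_tensors X U V W G G'"
      and xy: "x \<in> vecs (cfun_space X U)" "y \<in> vecs (cfun_space X V)"
    show "G' x y = ext_arr X G x y"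
      by (rule bounded_bilinear_determined_by_etensor[OF X U V W.cfun_space_banach G'[THEN conjunct1] bb _ xy])
         (use ext G' in \<open>simp add: extends_tensors_def\<close>)
  qed
qed

section \<open>The extension of a C*-category\<close>

lemma ext_star_apply [simp]: "w \<in> topspace X \<Longrightarrow> ext_star X C x w = Star C (x w)"
  by (simp add: ext_star_def)

lemma ext_star_extensional [simp]: "ext_star X C x \<in> extensional (topspace X)"
  by (simp add: ext_star_def)

lemma ext_arr_eq_iff:
  assumes "z \<in> extensional (topspace X)"
  shows "ext_arr X F x y = z \<longleftrightarrow> (\<forall>w\<in>topspace X. F (x w) (y w) = z w)"
  using extensionalityI[OF ext_arr_extensional assms] by (metis ext_arr_apply)

lemma ext_star_eq_iff:
  assumes "z \<in> extensional (topspace X)"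
  shows "ext_star X C x = z \<longleftrightarrow> (\<forall>w\<in>topspace X. Star C (x w) = z w)"
  using extensionalityI[OF ext_star_extensional assms] by (metis ext_star_apply)

lemma ext_cat_simps [simp]:
  "Ident (ext_cat X C) p = snd p"
  "Comp (ext_cat X C) = ext_arr X (Comp C)"
  "Star (ext_cat X C) = ext_star X C"
  by (simp_all add: ext_cat_def case_prod_beta)

lemma Obj_ext_cat:
  "p \<in> Obj (ext_cat X C) \<longleftrightarrow> fst p \<in> Obj C \<and> snd p \<in> vecs (cfun_space X (Hom C (fst p) (fst p))) \<and>
     (\<forall>w\<in>topspace X. snd p w \<cdot>\<^bsub>C\<^esub> snd p w = snd p w \<and> Star C (snd p w) = snd p w)"
  by (cases p) (auto simp: ext_cat_def ext_arr_eq_iff ext_star_eq_iff cfun_space_extensional)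

text \<open>The arrows of the extension category. The equations \<open>x e = x = f x\<close> are stated at the points of
  the space, where the axioms of \<open>C\<close> apply to them.\<close>

definition corner :: "'w topology \<Rightarrow> ('o, 'a) cat \<Rightarrow> 'o \<times> ('w \<Rightarrow> 'a) \<Rightarrow> 'o \<times> ('w \<Rightarrow> 'a) \<Rightarrow> ('w \<Rightarrow> 'a) set" where
  "corner X C p q = {x \<in> vecs (cfun_space X (Hom C (fst p) (fst q))).
     \<forall>w\<in>topspace X. x w \<cdot>\<^bsub>C\<^esub> snd p w = x w \<and> snd q w \<cdot>\<^bsub>C\<^esub> x w = x w}"

lemma Hom_ext_cat:
  "Hom (ext_cat X C) p q = (cfun_space X (Hom C (fst p) (fst q)))\<lparr>vecs := corner X C p q\<rparr>"
proof -
  have "corner X C p q = {x \<in> vecs (cfun_space X (Hom C (fst p) (fst q))).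
          ext_arr X (Comp C) x (snd p) = x \<and> ext_arr X (Comp C) (snd q) x = x}"
    unfolding corner_def by (auto simp: ext_arr_eq_iff cfun_space_extensional)
  then show ?thesis by (cases p; cases q) (simp add: ext_cat_def)
qed

lemma Hom_ext_cat_simps [simp]:
  "nzero (Hom (ext_cat X C) p q) = nzero (cfun_space X (Hom C (fst p) (fst q)))"
  "nadd (Hom (ext_cat X C) p q) = nadd (cfun_space X (Hom C (fst p) (fst q)))"
  "nscale (Hom (ext_cat X C) p q) = nscale (cfun_space X (Hom C (fst p) (fst q)))"
  "nnorm (Hom (ext_cat X C) p q) = nnorm (cfun_space X (Hom C (fst p) (fst q)))"
  "ndiff (Hom (ext_cat X C) p q) = ndiff (cfun_space X (Hom C (fst p) (fst q)))"
  by (simp_all add: Hom_ext_cat ndiff_def fun_eq_iff)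

lemma Arr_ext_cat: "Arr (ext_cat X C) p q = corner X C p q"
  by (simp add: Hom_ext_cat)

context cstar_category
begin

lemma comp_closed:
  "\<lbrakk>a \<in> Obj C; b \<in> Obj C; c \<in> Obj C; t \<in> Arr C b c; s \<in> Arr C a b\<rbrakk> \<Longrightarrow> t \<cdot> s \<in> Arr C a c"
  using bilinear_on_closed[OF comp_bilinear] .

lemma comp_bounded_bilinear:
  assumes "a \<in> Obj C" "b \<in> Obj C" "c \<in> Obj C"
  shows "bounded_bilinear_on (Hom C b c) (Hom C a b) (Hom C a c) (Comp C)"
  unfolding bounded_bilinear_on_def
  using assms comp_bilinear comp_norm by (intro conjI exI[of _ 1]) auto

lemma comp_diff_left:
  assumes "a \<in> Obj C" "b \<in> Obj C" "c \<in> Obj C" "t \<in> Arr C b c" "t' \<in> Arr C b c" "s \<in> Arr C a b"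
  shows "ndiff (Hom C b c) t t' \<cdot> s = ndiff (Hom C a c) (t \<cdot> s) (t' \<cdot> s)"
  using assms by (intro bilinear_on_diff_left[OF comp_bilinear] hom_banach)

lemma comp_diff_right:
  assumes "a \<in> Obj C" "b \<in> Obj C" "c \<in> Obj C" "t \<in> Arr C b c" "s \<in> Arr C a b" "s' \<in> Arr C a b"
  shows "t \<cdot> ndiff (Hom C a b) s s' = ndiff (Hom C a c) (t \<cdot> s) (t \<cdot> s')"
  using assms by (intro bilinear_on_diff_right[OF comp_bilinear] hom_banach)

lemma star_ident: assumes a: "a \<in> Obj C" shows "Star C (Ident C a) = Ident C a"
  using star_comp[OF a a a star_arr[OF a a ident_arr[OF a]] ident_arr[OF a]] star_star[OF a a ident_arr[OF a]]
    ident_left[OF a a star_arr[OF a a ident_arr[OF a]]] by simp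

text \<open>From \<open>\<parallel>s\<parallel>\<^sup>2 = \<parallel>s\<^sup>* s\<parallel> \<le> \<parallel>s\<^sup>*\<parallel> \<parallel>s\<parallel>\<close>, applied to \<open>s\<close> and to \<open>s\<^sup>*\<close>. It makes the pointwise
  involution of a continuous map continuous.\<close>

lemma star_norm:
  assumes a: "a \<in> Obj C" and b: "b \<in> Obj C" and s: "s \<in> Arr C a b"
  shows "nnorm (Hom C b a) (Star C s) = nnorm (Hom C a b) s"
proof -
  have le: "nnorm (Hom C a b) s \<le> nnorm (Hom C b a) (Star C s)"
    if a: "a \<in> Obj C" and b: "b \<in> Obj C" and s: "s \<in> Arr C a b" for a b s
  proof (cases "nnorm (Hom C a b) s = 0")
    case True
    then show ?thesis
      using complex_banach.norm_nonneg[OF hom_banach[OF b a] star_arr[OF a b s]] by simp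
  next
    case False
    then have pos: "nnorm (Hom C a b) s > 0"
      using complex_banach.norm_nonneg[OF hom_banach[OF a b] s] by simp
    have "nnorm (Hom C a b) s * nnorm (Hom C a b) s = nnorm (Hom C a a) (Star C s \<cdot> s)"
      using cstar_identity[OF a b s] by (simp add: power2_eq_square)
    also have "\<dots> \<le> nnorm (Hom C b a) (Star C s) * nnorm (Hom C a b) s"
      by (rule comp_norm[OF a b a s star_arr[OF a b s]])
    finally show ?thesis using pos by simp
  qed
  show ?thesis
    using le[OF a b s] le[OF b a star_arr[OF a b s]] star_star[OF a b s] by simp
qed

lemma star_diff:
  assumes "a \<in> Obj C" "b \<in> Obj C" "s \<in> Arr C a b" "t \<in> Arr C a b"
  shows "Star C (ndiff (Hom C a b) s t) = ndiff (Hom C b a) (Star C s) (Star C t)"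
  using assms complex_banach.scale_closed[OF hom_banach]
  by (simp add: ndiff_def star_add star_scale)

text \<open>The projection \<open>e\<close> commutes with \<open>d\<close>, hence with its inverse \<open>t\<close>, and \<open>m = d e\<close> is the compression
  of \<open>d\<close>; so \<open>t e\<close> inverts \<open>m\<close> in the corner with identity \<open>e\<close>.\<close>

lemma corner_inverse:
  assumes a: "a \<in> Obj C" and mem: "k \<in> Arr C a a" "e \<in> Arr C a a" "t \<in> Arr C a a"
    and e: "e \<cdot> e = e" "k \<cdot> e = k" "e \<cdot> k = k"
    and d: "d = ndiff (Hom C a a) k (z \<odot>\<^bsub>Hom C a a\<^esub> Ident C a)"
    and m: "m = ndiff (Hom C a a) k (z \<odot>\<^bsub>Hom C a a\<^esub> e)"
    and t: "t \<cdot> d = Ident C a" "d \<cdot> t = Ident C a"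
  shows "(t \<cdot> e) \<cdot> e = t \<cdot> e" "e \<cdot> (t \<cdot> e) = t \<cdot> e" "(t \<cdot> e) \<cdot> m = e" "m \<cdot> (t \<cdot> e) = e"
proof -
  interpret H: complex_banach "Hom C a a" by (rule hom_banach[OF a a])
  note I = ident_arr[OF a] and assoc = comp_assoc[OF a a a a]
  have dm: "d \<in> Arr C a a" unfolding d by (intro H.diff_closed mem H.scale_closed I)
  have de: "d \<cdot> e = m"
    unfolding d m using a mem I e
    by (simp add: comp_diff_left H.scale_closed bilinear_on_scale_left[OF comp_bilinear] ident_left)
  have ed: "e \<cdot> d = m"
    unfolding d m using a mem I e
    by (simp add: comp_diff_right H.scale_closed bilinear_on_scale_right[OF comp_bilinear] ident_right)
  note cl = comp_closed[OF a a a]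
  have te: "t \<cdot> e = e \<cdot> t"
  proof -
    have "t \<cdot> e = (t \<cdot> e) \<cdot> (d \<cdot> t)" using t(2) ident_right[OF a a cl[OF mem(3,2)]] by simp
    also have "\<dots> = t \<cdot> ((e \<cdot> d) \<cdot> t)"
      using assoc[OF cl[OF dm mem(3)] mem(2,3)] assoc[OF mem(3) dm mem(2)] by simp
    also have "\<dots> = (t \<cdot> d) \<cdot> (e \<cdot> t)"
      unfolding ed de[symmetric]
      using assoc[OF mem(3,2) dm] assoc[OF cl[OF mem(2,3)] dm mem(3)] by simp
    also have "\<dots> = e \<cdot> t" using t(1) ident_left[OF a a cl[OF mem(2,3)]] by simp
    finally show ?thesis .
  qed
  show 1: "(t \<cdot> e) \<cdot> e = t \<cdot> e" using assoc[OF mem(2,2,3)] e by simp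
  show 2: "e \<cdot> (t \<cdot> e) = t \<cdot> e" using assoc[OF mem(3,2,2)] e te by simp
  have "(t \<cdot> e) \<cdot> m = (t \<cdot> e) \<cdot> (e \<cdot> d)" by (simp add: ed)
  also have "\<dots> = (t \<cdot> e) \<cdot> d" using assoc[OF dm mem(2) cl[OF mem(3,2)]] 1 by simp
  also have "\<dots> = e" unfolding te using assoc[OF dm mem(3,2)] t(1) ident_right[OF a a mem(2)] by simp
  finally show "(t \<cdot> e) \<cdot> m = e" .
  have "m \<cdot> (t \<cdot> e) = d \<cdot> (e \<cdot> (t \<cdot> e))" using assoc[OF cl[OF mem(3,2)] mem(2) dm] by (simp add: de)
  also have "\<dots> = e" unfolding 2 using assoc[OF mem(2,3) dm] t(2) ident_left[OF a a mem(2)] by simp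
  finally show "m \<cdot> (t \<cdot> e) = e" .
qed

end

locale ext_category = cstar_category C for C :: "('o, 'a) cat" (structure) and X :: "'w topology" +
  assumes compact_X: "compact_space X"
begin

abbreviation CF where "CF a b \<equiv> vecs (cfun_space X (Hom C a b))"
abbreviation D where "D \<equiv> ext_cat X C"

lemma cfun_hom: "\<lbrakk>a \<in> Obj C; b \<in> Obj C\<rbrakk> \<Longrightarrow> cfun_banach (Hom C a b) X"
  by (intro cfun_banach.intro cfun_banach_axioms.intro hom_banach compact_X)

lemmas CF_value = cfun_banach.cfun_space_value[OF cfun_hom]
lemmas CF_const = cfun_banach.cfun_space_const[OF cfun_hom]

lemma CF_comp:
  assumes "a \<in> Obj C" "b \<in> Obj C" "c \<in> Obj C" "y \<in> CF b c" "x \<in> CF a b"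
  shows "ext_arr X (Comp C) y x \<in> CF a c"
  using assms by (intro ext_arr_closed[OF compact_X _ _ _ comp_bounded_bilinear] hom_banach)

lemma CF_star:
  assumes a: "a \<in> Obj C" and b: "b \<in> Obj C" and x: "x \<in> CF a b"
  shows "ext_star X C x \<in> CF b a"
proof -
  interpret ab: cfun_banach "Hom C a b" X using cfun_hom[OF a b] .
  interpret ba: cfun_banach "Hom C b a" X using cfun_hom[OF b a] .
  note v = ab.cfun_space_value[OF x]
  have "(\<lambda>w\<in>topspace X. Star C (x w)) \<in> CF b a"
  proof (rule ba.cfun_space_memI[where g = "\<lambda>w w'. nnorm (Hom C a b) (ndiff (Hom C a b) (x w') (x w))"])
    fix w assume w: "w \<in> topspace X"
    show "Star C (x w) \<in> Arr C b a" by (rule star_arr[OF a b v[OF w]])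
    show "((\<lambda>w'. nnorm (Hom C a b) (ndiff (Hom C a b) (x w') (x w))) \<longlongrightarrow> 0) (atin X w)"
      by (rule ab.cfun_space_tendsto[OF x w])
    have "nnorm (Hom C b a) (ndiff (Hom C b a) (Star C (x w')) (Star C (x w))) =
        nnorm (Hom C a b) (ndiff (Hom C a b) (x w') (x w))" if w': "w' \<in> topspace X" for w'
      using star_diff[OF a b v[OF w'] v[OF w]] star_norm[OF a b ab.diff_closed[OF v[OF w'] v[OF w]]] by simp
    then show "\<forall>\<^sub>F w' in atin X w. w' \<in> topspace X \<longrightarrow>
        nnorm (Hom C b a) (ndiff (Hom C b a) (Star C (x w')) (Star C (x w))) \<le>
        nnorm (Hom C a b) (ndiff (Hom C a b) (x w') (x w))" by simp
  qed
  then show ?thesis by (simp add: ext_star_def)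
qed

text \<open>Write \<open>T = \<parallel>t w\<parallel>\<close>, \<open>r = \<parallel>t w' - t w\<parallel>\<close> and \<open>\<delta> = \<parallel>d w' - d w\<parallel>\<close>. The resolvent identity gives
  \<open>r \<le> (T + r) \<delta> T\<close>, so that \<open>r \<le> 2 T\<^sup>2 \<delta>\<close> as soon as \<open>\<delta> T \<le> 1/2\<close>.\<close>

lemma CF_inverse:
  assumes a: "a \<in> Obj C" and d: "d \<in> CF a a"
    and inv: "\<And>w. w \<in> topspace X \<Longrightarrow> \<exists>t\<in>Arr C a a. t \<cdot> d w = Ident C a \<and> d w \<cdot> t = Ident C a"
  shows "\<exists>t\<in>CF a a. \<forall>w\<in>topspace X. t w \<cdot> d w = Ident C a \<and> d w \<cdot> t w = Ident C a"
proof -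
  interpret H: cfun_banach "Hom C a a" X using cfun_hom[OF a a] .
  have "\<forall>w\<in>topspace X. \<exists>t. t \<in> Arr C a a \<and> t \<cdot> d w = Ident C a \<and> d w \<cdot> t = Ident C a"
    using inv by blast
  then obtain t where t: "\<And>w. w \<in> topspace X \<Longrightarrow> t w \<in> Arr C a a"
    "\<And>w. w \<in> topspace X \<Longrightarrow> t w \<cdot> d w = Ident C a" "\<And>w. w \<in> topspace X \<Longrightarrow> d w \<cdot> t w = Ident C a"
    unfolding bchoice_iff by blast
  note v = H.cfun_space_value[OF d]
  let ?n = "nnorm (Hom C a a)"
  let ?\<delta> = "\<lambda>w w'. ?n (H.minus_vec (d w') (d w))"
  have "(\<lambda>w\<in>topspace X. t w) \<in> CF a a"
  proof (rule H.cfun_space_memI[where g = "\<lambda>w w'. 2 * (?n (t w) * ?n (t w)) * ?\<delta> w w'"])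
    fix w assume w: "w \<in> topspace X"
    show "t w \<in> Arr C a a" using t w by simp
    have lim: "(?\<delta> w \<longlongrightarrow> 0) (atin X w)" by (rule H.cfun_space_tendsto[OF d w])
    show "((\<lambda>w'. 2 * (?n (t w) * ?n (t w)) * ?\<delta> w w') \<longlongrightarrow> 0) (atin X w)"
      using tendsto_mult_left[OF lim, of "2 * (?n (t w) * ?n (t w))"] by simp
    have "((\<lambda>w'. ?\<delta> w w' * ?n (t w)) \<longlongrightarrow> 0) (atin X w)"
      using tendsto_mult_right[OF lim, of "?n (t w)"] by simp
    then have "\<forall>\<^sub>F w' in atin X w. ?\<delta> w w' * ?n (t w) < 1 / 2" by (rule order_tendstoD) simp
    then show "\<forall>\<^sub>F w' in atin X w. w' \<in> topspace X \<longrightarrow>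
        ?n (H.minus_vec (t w') (t w)) \<le> 2 * (?n (t w) * ?n (t w)) * ?\<delta> w w'"
    proof eventually_elim
      case (elim w')
      show ?case
      proof
        assume w': "w' \<in> topspace X"
        define T \<delta> r where "T = ?n (t w)" and "\<delta> = ?\<delta> w w'" and "r = ?n (H.minus_vec (t w') (t w))"
        have nn: "0 \<le> T" "0 \<le> \<delta>" "0 \<le> r"
          unfolding T_def \<delta>_def r_def using t v w w' by (simp_all add: H.norm_nonneg H.diff_closed)
        have dd: "H.minus_vec (d w) (d w') \<in> Arr C a a" using v w w' by (intro H.diff_closed)
        have "t w' \<cdot> H.minus_vec (d w) (d w') \<cdot> t w = H.minus_vec (t w' \<cdot> d w) (Ident C a) \<cdot> t w"
          using comp_diff_right[OF a a a t(1)[OF w'] v[OF w] v[OF w']] t(2)[OF w'] by simp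
        also have "\<dots> = H.minus_vec ((t w' \<cdot> d w) \<cdot> t w) (Ident C a \<cdot> t w)"
          by (rule comp_diff_left[OF a a a comp_closed[OF a a a t(1)[OF w'] v[OF w]] ident_arr[OF a] t(1)[OF w]])
        also have "\<dots> = H.minus_vec (t w') (t w)"
          using comp_assoc[OF a a a a t(1)[OF w] v[OF w] t(1)[OF w']] t(3)[OF w]
            ident_right[OF a a t(1)[OF w']] ident_left[OF a a t(1)[OF w]] by simp
        finally have "r = ?n (t w' \<cdot> H.minus_vec (d w) (d w') \<cdot> t w)" by (simp add: r_def)
        also have "\<dots> \<le> ?n (t w' \<cdot> H.minus_vec (d w) (d w')) * T"
          unfolding T_def by (rule comp_norm[OF a a a t(1)[OF w] comp_closed[OF a a a t(1)[OF w'] dd]])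
        also have "\<dots> \<le> (?n (t w') * \<delta>) * T"
          using comp_norm[OF a a a dd t(1)[OF w']] H.norm_diff_commute[OF v[OF w] v[OF w']] nn
          by (intro mult_right_mono) (simp_all add: \<delta>_def)
        also have "\<dots> \<le> ((T + r) * \<delta>) * T"
          using H.norm_le_add_diff[OF t(1)[OF w'] t(1)[OF w]] nn
          by (intro mult_right_mono) (simp_all add: T_def r_def)
        also have "\<dots> = T * T * \<delta> + r * (\<delta> * T)" by (simp add: algebra_simps)
        also have "\<dots> \<le> T * T * \<delta> + r * (1 / 2)"
          using elim nn unfolding T_def[symmetric] \<delta>_def[symmetric] by (intro add_left_mono mult_left_mono) auto
        finally show "?n (H.minus_vec (t w') (t w)) \<le> 2 * (?n (t w) * ?n (t w)) * ?\<delta> w w'"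
          by (simp add: T_def r_def \<delta>_def)
      qed
    qed
  qed
  then show ?thesis using t by (intro bexI[of _ "\<lambda>w\<in>topspace X. t w"]) simp_all
qed

lemma ext_objD:
  assumes "p \<in> Obj D"
  shows "fst p \<in> Obj C" "snd p \<in> CF (fst p) (fst p)"
    "\<And>w. w \<in> topspace X \<Longrightarrow> snd p w \<in> Arr C (fst p) (fst p)"
    "\<And>w. w \<in> topspace X \<Longrightarrow> snd p w \<cdot> snd p w = snd p w"
    "\<And>w. w \<in> topspace X \<Longrightarrow> Star C (snd p w) = snd p w"
  using assms CF_value by (simp_all add: Obj_ext_cat)

lemma cornerD:
  assumes "x \<in> corner X C p q"
  shows "x \<in> CF (fst p) (fst q)"
    "\<And>w. w \<in> topspace X \<Longrightarrow> x w \<cdot> snd p w = x w" "\<And>w. w \<in> topspace X \<Longrightarrow> snd q w \<cdot> x w = x w"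
  using assms by (simp_all add: corner_def)

lemma corner_value:
  "\<lbrakk>x \<in> corner X C p q; p \<in> Obj D; q \<in> Obj D; w \<in> topspace X\<rbrakk> \<Longrightarrow> x w \<in> Arr C (fst p) (fst q)"
  using CF_value cornerD(1) ext_objD(1) by metis

lemma corner_comp:
  assumes p: "p \<in> Obj D" and q: "q \<in> Obj D" and r: "r \<in> Obj D"
    and y: "y \<in> corner X C q r" and x: "x \<in> corner X C p q"
  shows "ext_arr X (Comp C) y x \<in> corner X C p r"
proof -
  note o = ext_objD(1)[OF p] ext_objD(1)[OF q] ext_objD(1)[OF r]
  note xv = corner_value[OF x p q] and yv = corner_value[OF y q r]
  have "(y w \<cdot> x w) \<cdot> snd p w = y w \<cdot> x w" "snd r w \<cdot> (y w \<cdot> x w) = y w \<cdot> x w"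
    if w: "w \<in> topspace X" for w
    using comp_assoc[OF o(1,1,2,3) ext_objD(3)[OF p w] xv[OF w] yv[OF w]] cornerD(2)[OF x w]
      comp_assoc[OF o(1,2,3,3) xv[OF w] yv[OF w] ext_objD(3)[OF r w]] cornerD(3)[OF y w] by simp_all
  then show ?thesis
    using CF_comp[OF o cornerD(1)[OF y] cornerD(1)[OF x]] by (simp add: corner_def)
qed

lemma corner_star:
  assumes p: "p \<in> Obj D" and q: "q \<in> Obj D" and x: "x \<in> corner X C p q"
  shows "ext_star X C x \<in> corner X C q p"
proof -
  note o = ext_objD(1)[OF p] ext_objD(1)[OF q]
  note xv = corner_value[OF x p q]
  have "Star C (x w) \<cdot> snd q w = Star C (x w)" "snd p w \<cdot> Star C (x w) = Star C (x w)"
    if w: "w \<in> topspace X" for w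
    using star_comp[OF o(1,2,2) xv[OF w] ext_objD(3)[OF q w]] ext_objD(5)[OF q w] cornerD(3)[OF x w]
      star_comp[OF o(1,1,2) ext_objD(3)[OF p w] xv[OF w]] ext_objD(5)[OF p w] cornerD(2)[OF x w] by simp_all
  then show ?thesis using CF_star[OF o cornerD(1)[OF x]] by (simp add: corner_def)
qed

lemma corner_banach:
  assumes p: "p \<in> Obj D" and q: "q \<in> Obj D"
  shows "complex_banach (Hom D p q)"
proof -
  note o = ext_objD(1)[OF p] ext_objD(1)[OF q]
  let ?H = "Hom C (fst p) (fst q)"
  interpret H: cfun_banach ?H X using cfun_hom[OF o] .
  interpret F: complex_banach "cfun_space X ?H" by (rule H.cfun_space_banach)
  note bl = comp_bilinear[OF o(1,1,2)] and br = comp_bilinear[OF o(1,2,2)]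
  note P = ext_objD(3)[OF p] and Q = ext_objD(3)[OF q]
  show ?thesis unfolding Hom_ext_cat
  proof (rule F.restrict_complex_banach)
    show sub: "corner X C p q \<subseteq> CF (fst p) (fst q)" by (auto simp: corner_def)
    have "\<zero>\<^bsub>?H\<^esub> \<cdot> s = \<zero>\<^bsub>?H\<^esub>" if "s \<in> Arr C (fst p) (fst p)" for s
      using bilinear_on_scale_left[OF bl H.zero_closed that, of 0] bilinear_on_closed[OF bl H.zero_closed that]
      by (simp add: H.scale_zero_right H.scale_zero_left)
    moreover have "s \<cdot> \<zero>\<^bsub>?H\<^esub> = \<zero>\<^bsub>?H\<^esub>" if "s \<in> Arr C (fst q) (fst q)" for s
      using bilinear_on_scale_right[OF br that H.zero_closed, of 0] bilinear_on_closed[OF br that H.zero_closed]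
      by (simp add: H.scale_zero_right H.scale_zero_left)
    ultimately show "\<zero>\<^bsub>cfun_space X ?H\<^esub> \<in> corner X C p q"
      using F.zero_closed P Q by (simp add: corner_def)
    show "u \<oplus>\<^bsub>cfun_space X ?H\<^esub> v \<in> corner X C p q" if u: "u \<in> corner X C p q" and v: "v \<in> corner X C p q" for u v
      using F.add_closed[OF cornerD(1)[OF u] cornerD(1)[OF v]] cornerD(2,3)[OF u] cornerD(2,3)[OF v]
        corner_value[OF u p q] corner_value[OF v p q] P Q
      by (simp add: corner_def bilinear_on_add_left[OF bl] bilinear_on_add_right[OF br])
    show "c \<odot>\<^bsub>cfun_space X ?H\<^esub> u \<in> corner X C p q" if u: "u \<in> corner X C p q" for c u
      using F.scale_closed[OF cornerD(1)[OF u], of c] cornerD(2,3)[OF u] corner_value[OF u p q] P Q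
      by (simp add: corner_def bilinear_on_scale_left[OF bl] bilinear_on_scale_right[OF br])
    fix u :: "nat \<Rightarrow> 'w \<Rightarrow> 'a" and l
    assume u: "\<And>n. u n \<in> corner X C p q" and l: "l \<in> CF (fst p) (fst q)"
      and lim: "(\<lambda>n. nnorm (cfun_space X ?H) (ndiff (cfun_space X ?H) (u n) l)) \<longlonglongrightarrow> 0"
    have "l w \<cdot> snd p w = l w \<and> snd q w \<cdot> l w = l w" if w: "w \<in> topspace X" for w
    proof -
      note uv = corner_value[OF u p q w] and lv = H.cfun_space_value[OF l w]
      note up = cornerD(2)[OF u w] and uq = cornerD(3)[OF u w]
      have lw: "(\<lambda>n. nnorm ?H (ndiff ?H (u n w) (l w))) \<longlonglongrightarrow> 0"
        by (rule H.cfun_space_pointwise_tendsto[OF cornerD(1)[OF u] l w lim])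
      (* a vector g that u n w approaches at least as fast as l w, up to a factor, is l w *)
      have unique: "g = l w" if g: "g \<in> Arr C (fst p) (fst q)"
        and bound: "\<And>n. nnorm ?H (ndiff ?H (u n w) g) \<le> nnorm ?H (ndiff ?H (u n w) (l w)) * K" for g K
      proof -
        have "(\<lambda>n. nnorm ?H (ndiff ?H (u n w) (l w)) * K + nnorm ?H (ndiff ?H (u n w) (l w))) \<longlonglongrightarrow> 0 * K + 0"
          by (intro tendsto_intros lw)
        moreover have "nnorm ?H (ndiff ?H g (l w)) \<le>
            nnorm ?H (ndiff ?H (u n w) (l w)) * K + nnorm ?H (ndiff ?H (u n w) (l w))" for n
          using H.norm_diff_triangle[OF g uv[of n] lv] bound[of n] H.norm_diff_commute[OF g uv[of n]] by linarith
        ultimately have "nnorm ?H (ndiff ?H g (l w)) \<le> 0"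
          by (intro tendsto_lowerbound[of _ "0 * K + 0", simplified]) (auto intro: always_eventually)
        then show ?thesis
          using H.norm_diff_nonneg[OF g lv] H.norm_diff_eq_zero[OF g lv] by simp
      qed
      have "l w \<cdot> snd p w = l w"
      proof (rule unique)
        show "l w \<cdot> snd p w \<in> Arr C (fst p) (fst q)" by (rule comp_closed[OF o(1,1,2) lv P[OF w]])
        show "nnorm ?H (ndiff ?H (u n w) (l w \<cdot> snd p w)) \<le>
            nnorm ?H (ndiff ?H (u n w) (l w)) * nnorm (Hom C (fst p) (fst p)) (snd p w)" for n
          using comp_diff_left[OF o(1,1,2) uv lv P[OF w], of n] up[of n]
            comp_norm[OF o(1,1,2) P[OF w] H.diff_closed[OF uv lv], of n] by simp
      qed
      moreover have "snd q w \<cdot> l w = l w"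
      proof (rule unique)
        show "snd q w \<cdot> l w \<in> Arr C (fst p) (fst q)" by (rule comp_closed[OF o(1,2,2) Q[OF w] lv])
        show "nnorm ?H (ndiff ?H (u n w) (snd q w \<cdot> l w)) \<le>
            nnorm ?H (ndiff ?H (u n w) (l w)) * nnorm (Hom C (fst q) (fst q)) (snd q w)" for n
          using comp_diff_right[OF o(1,2,2) Q[OF w] uv lv, of n] uq[of n]
            comp_norm[OF o(1,2,2) H.diff_closed[OF uv lv] Q[OF w], of n] by (simp add: mult.commute)
      qed
      ultimately show ?thesis by simp
    qed
    then show "l \<in> corner X C p q" using l by (simp add: corner_def)
  qed
qed

text \<open>In \<open>C\<close> the spectrum of \<open>x(w)\<^sup>* x(w)\<close> is taken relative to the identity of \<open>a\<close>, in the extension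
  category relative to \<open>e\<close>; \<open>corner_inverse\<close> passes from the first to the second.\<close>

lemma corner_positive:
  assumes p: "p \<in> Obj D" and q: "q \<in> Obj D" and x: "x \<in> corner X C p q"
  shows "positive_arrow D p (ext_arr X (Comp C) (ext_star X C x) x)"
proof -
  note o = ext_objD(1)[OF p] ext_objD(1)[OF q]
  note xv = corner_value[OF x p q]
  let ?a = "fst p" and ?e = "snd p"
  let ?H = "Hom C ?a ?a"
  let ?I = "Ident C ?a"
  interpret H: cfun_banach ?H X using cfun_hom[OF o(1,1)] .
  interpret F: complex_banach "cfun_space X ?H" by (rule H.cfun_space_banach)
  define k where "k = ext_arr X (Comp C) (ext_star X C x) x"
  have k: "k \<in> corner X C p p" unfolding k_def by (rule corner_comp[OF p q p corner_star[OF p q x] x])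
  note kv = corner_value[OF k p p]
  have "ext_star X C k = k"
  proof (rule extensionalityI)
    show "ext_star X C k w = k w" if w: "w \<in> topspace X" for w
      using w star_comp[OF o(1,2,1) xv[OF w] star_arr[OF o xv[OF w]]] star_star[OF o xv[OF w]]
      by (simp add: k_def)
  qed (simp_all add: k_def)
  moreover have "z \<in> complex_of_real ` {0..}" if z: "z \<in> spectrum D p k" for z
  proof (rule ccontr)
    assume nz: "z \<notin> complex_of_real ` {0..}"
    define d where "d = ndiff (cfun_space X ?H) k (z \<odot>\<^bsub>cfun_space X ?H\<^esub> (\<lambda>w\<in>topspace X. ?I))"
    have d: "d \<in> CF ?a ?a"
      unfolding d_def by (intro F.diff_closed F.scale_closed cornerD(1)[OF k] H.cfun_space_const ident_arr o)
    have dw: "d w = ndiff ?H (k w) (z \<odot>\<^bsub>?H\<^esub> ?I)" if "w \<in> topspace X" for w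
      using that by (simp add: d_def)
    have "\<exists>t\<in>Arr C ?a ?a. t \<cdot> d w = ?I \<and> d w \<cdot> t = ?I" if w: "w \<in> topspace X" for w
    proof -
      have "positive_arrow C ?a (k w)" using star_comp_positive[OF o xv[OF w]] w by (simp add: k_def)
      then have "z \<notin> spectrum C ?a (k w)" using nz by (auto simp: positive_arrow_def)
      then show ?thesis by (simp add: spectrum_def Let_def dw[OF w])
    qed
    then obtain t where t: "t \<in> CF ?a ?a"
      and tw: "\<forall>w\<in>topspace X. t w \<cdot> d w = ?I \<and> d w \<cdot> t w = ?I"
      using CF_inverse[OF o(1) d] by blast
    note tv = H.cfun_space_value[OF t]
    let ?m = "ndiff (cfun_space X ?H) k (z \<odot>\<^bsub>cfun_space X ?H\<^esub> ?e)"
    have inv: "(t w \<cdot> ?e w) \<cdot> ?e w = t w \<cdot> ?e w" "?e w \<cdot> (t w \<cdot> ?e w) = t w \<cdot> ?e w"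
      "(t w \<cdot> ?e w) \<cdot> ?m w = ?e w" "?m w \<cdot> (t w \<cdot> ?e w) = ?e w" if w: "w \<in> topspace X" for w
      using corner_inverse[OF o(1) kv[OF w] ext_objD(3)[OF p w] tv[OF w] ext_objD(4)[OF p w]
          cornerD(2)[OF k w] cornerD(3)[OF k w] dw[OF w] refl] tw w by simp_all
    let ?t = "ext_arr X (Comp C) t ?e"
    have "?t \<in> corner X C p p"
      using CF_comp[OF o(1,1,1) t ext_objD(2)[OF p]] inv(1,2) by (simp add: corner_def)
    moreover have "ext_arr X (Comp C) ?t ?m = ?e" "ext_arr X (Comp C) ?m ?t = ?e"
      using inv(3,4) by (auto intro!: extensionalityI[OF ext_arr_extensional cfun_space_extensional[OF ext_objD(2)[OF p]]] simp del: cfun_space_simps)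
    ultimately have "z \<notin> spectrum D p k"
      by (cases p) (auto simp: spectrum_def Let_def Arr_ext_cat simp del: cfun_space_simps)
    then show False using z by simp
  qed
  ultimately show ?thesis using k by (auto simp: positive_arrow_def Arr_ext_cat k_def)
qed

lemma corner_bilinear:
  assumes p: "p \<in> Obj D" and q: "q \<in> Obj D" and r: "r \<in> Obj D"
  shows "bilinear_on (Hom D q r) (Hom D p q) (Hom D p r) (ext_arr X (Comp C))"
proof -
  note o = ext_objD(1)[OF p] ext_objD(1)[OF q] ext_objD(1)[OF r]
  have "bounded_bilinear_on (cfun_space X (Hom C (fst q) (fst r))) (cfun_space X (Hom C (fst p) (fst q)))
      (cfun_space X (Hom C (fst p) (fst r))) (ext_arr X (Comp C))"
    by (intro ext_arr_bounded_bilinear compact_X comp_bounded_bilinear hom_banach o)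
  then show ?thesis
    unfolding Hom_ext_cat bounded_bilinear_on_def
    by (intro bilinear_on_restrict[OF _ _ _ corner_comp[OF p q r]]) (auto simp: corner_def)
qed

theorem ext_cat_cstar_category: "cstar_category D"
proof (rule cstar_category.intro)
  show "Ident D p \<in> Arr D p p" if "p \<in> Obj D" for p
    using ext_objD[OF that] by (cases p) (simp add: Arr_ext_cat corner_def)
  show "bilinear_on (Hom D q r) (Hom D p q) (Hom D p r) (Comp D)"
    if "p \<in> Obj D" "q \<in> Obj D" "r \<in> Obj D" for p q r
    using corner_bilinear[OF that] by simp
  fix p q assume p: "p \<in> Obj D" and q: "q \<in> Obj D"
  note o = ext_objD(1)[OF p] ext_objD(1)[OF q]
  show "complex_banach (Hom D p q)" by (rule corner_banach[OF p q])
  fix x assume x': "x \<in> Arr D p q"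
  then have x: "x \<in> corner X C p q" by (simp add: Arr_ext_cat)
  interpret H: cfun_banach "Hom C (fst p) (fst q)" X using cfun_hom[OF o] .
  interpret K: cfun_banach "Hom C (fst p) (fst p)" X using cfun_hom[OF o(1,1)] .
  note xv = corner_value[OF x p q] and xe = cfun_space_extensional[OF cornerD(1)[OF x]]
  show "Ident D q \<cdot>\<^bsub>D\<^esub> x = x"
    using cornerD(3)[OF x] xe by (cases q) (simp add: ext_arr_eq_iff)
  show "x \<cdot>\<^bsub>D\<^esub> Ident D p = x"
    using cornerD(2)[OF x] xe by (cases p) (simp add: ext_arr_eq_iff)
  show "Star D x \<in> Arr D q p" using corner_star[OF p q x] by (simp add: Arr_ext_cat)
  show "Star D (z \<odot>\<^bsub>Hom D p q\<^esub> x) = cnj z \<odot>\<^bsub>Hom D q p\<^esub> Star D x" for z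
    by (auto intro!: extensionalityI[where A = "topspace X"] simp: star_scale[OF o xv])
  show "Star D (Star D x) = x"
    by (auto intro!: extensionalityI[OF _ xe] simp: star_star[OF o xv])
  show "positive_arrow D p (Star D x \<cdot>\<^bsub>D\<^esub> x)" using corner_positive[OF p q x] by simp
  show "nnorm (Hom D p p) (Star D x \<cdot>\<^bsub>D\<^esub> x) = (nnorm (Hom D p q) x)\<^sup>2"
  proof -
    let ?n = "nnorm (cfun_space X (Hom C (fst p) (fst q))) x"
    have "nnorm (cfun_space X (Hom C (fst p) (fst p))) (ext_arr X (Comp C) (ext_star X C x) x) = ?n\<^sup>2"
    proof (rule K.cfun_space_norm_eqI)
      show "ext_arr X (Comp C) (ext_star X C x) x \<in> CF (fst p) (fst p)"
        by (rule CF_comp[OF o(1,2,1) CF_star[OF o cornerD(1)[OF x]] cornerD(1)[OF x]])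
      show "nnorm (Hom C (fst p) (fst p)) (ext_arr X (Comp C) (ext_star X C x) x w) \<le> ?n\<^sup>2"
        if w: "w \<in> topspace X" for w
        using w cstar_identity[OF o xv[OF w]] H.cfun_space_norm_ge[OF cornerD(1)[OF x] w] H.norm_nonneg[OF xv[OF w]]
        by (simp add: power_mono)
      show "?n\<^sup>2 \<le> c" if c: "0 \<le> c"
        "\<And>w. w \<in> topspace X \<Longrightarrow> nnorm (Hom C (fst p) (fst p)) (ext_arr X (Comp C) (ext_star X C x) x w) \<le> c" for c
      proof -
        have "nnorm (Hom C (fst p) (fst q)) (x w) \<le> sqrt c" if w: "w \<in> topspace X" for w
          using c(2)[OF w] w cstar_identity[OF o xv[OF w]] by (simp add: real_le_rsqrt)
        then have "?n \<le> sqrt c" using c(1) by (intro H.cfun_space_norm_le) auto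
        then have "?n\<^sup>2 \<le> (sqrt c)\<^sup>2"
          using H.cfun_space_norm_nonneg[OF cornerD(1)[OF x]] by (intro power_mono)
        then show ?thesis using c(1) by simp
      qed
    qed simp
    then show ?thesis by simp
  qed
  { fix y assume y': "y \<in> Arr D p q"
    then have y: "y \<in> corner X C p q" by (simp add: Arr_ext_cat)
    note yv = corner_value[OF y p q]
    show "Star D (x \<oplus>\<^bsub>Hom D p q\<^esub> y) = Star D x \<oplus>\<^bsub>Hom D q p\<^esub> Star D y"
      by (auto intro!: extensionalityI[where A = "topspace X"] simp: star_add[OF o xv yv]) }
  fix r assume r: "r \<in> Obj D"
  note r' = ext_objD(1)[OF r]
  fix y assume y': "y \<in> Arr D q r"
  then have y: "y \<in> corner X C q r" by (simp add: Arr_ext_cat)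
  note yv = corner_value[OF y q r]
  interpret L: cfun_banach "Hom C (fst q) (fst r)" X using cfun_hom[OF o(2) r'] .
  interpret M: cfun_banach "Hom C (fst p) (fst r)" X using cfun_hom[OF o(1) r'] .
  show "Star D (y \<cdot>\<^bsub>D\<^esub> x) = Star D x \<cdot>\<^bsub>D\<^esub> Star D y"
    by (auto intro!: extensionalityI[where A = "topspace X"] simp: star_comp[OF o r' xv yv])
  show "nnorm (Hom D p r) (y \<cdot>\<^bsub>D\<^esub> x) \<le> nnorm (Hom D q r) y * nnorm (Hom D p q) x"
  proof -
    have "nnorm (Hom C (fst p) (fst r)) (y w \<cdot> x w) \<le>
       nnorm (cfun_space X (Hom C (fst q) (fst r))) y * nnorm (cfun_space X (Hom C (fst p) (fst q))) x"
      if w: "w \<in> topspace X" for w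
      using comp_norm[OF o r' xv[OF w] yv[OF w]]
        mult_mono[OF L.cfun_space_norm_ge[OF cornerD(1)[OF y] w] H.cfun_space_norm_ge[OF cornerD(1)[OF x] w]
          L.cfun_space_norm_nonneg[OF cornerD(1)[OF y]] H.norm_nonneg[OF xv[OF w]]]
      by linarith
    then show ?thesis
      using L.cfun_space_norm_nonneg[OF cornerD(1)[OF y]] H.cfun_space_norm_nonneg[OF cornerD(1)[OF x]]
      by (simp add: M.cfun_space_norm_le)
  qed
  fix s u assume s: "s \<in> Obj D" and u': "u \<in> Arr D r s"
  then have u: "u \<in> corner X C r s" by (simp add: Arr_ext_cat)
  note s' = ext_objD(1)[OF s] and uv = corner_value[OF u r s]
  show "(u \<cdot>\<^bsub>D\<^esub> y) \<cdot>\<^bsub>D\<^esub> x = u \<cdot>\<^bsub>D\<^esub> (y \<cdot>\<^bsub>D\<^esub> x)"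
    by (auto intro!: extensionalityI[where A = "topspace X"] simp: comp_assoc[OF o r' s' xv yv uv])
qed

end

section \<open>Bifunctors, tensor products and symmetries\<close>

lemma ext_obj_simps [simp]:
  "fst (ext_obj X Fo Fa p q) = Fo (fst p) (fst q)"
  "snd (ext_obj X Fo Fa p q) = ext_arr X Fa (snd p) (snd q)"
  by (cases p; cases q; simp add: ext_obj_def)+

context cstar_bifunctor
begin

lemma fun_closed:
  "\<lbrakk>a \<in> Obj C; b \<in> Obj C; a' \<in> Obj C'; b' \<in> Obj C'; s \<in> Arr C a b; s' \<in> Arr C' a' b'\<rbrakk> \<Longrightarrow>
    Fa s s' \<in> Arr D (Fo a a') (Fo b b')"
  using fun_bilinear bilinear_on_closed unfolding bounded_bilinear_on_def by metis

text \<open>The condition that \<open>F(x, x')\<close> lies in the right corner is the functoriality of \<open>F\<close> applied to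
  \<open>x e = x\<close> and \<open>x' e' = x'\<close>, and likewise on the left; that \<open>F(e, e')\<close> is a projection is its
  compatibility with composition and involution.\<close>

theorem ext_cstar_bifunctor:
  fixes X :: "'w topology"
  assumes X: "compact_space X"
  shows "cstar_bifunctor (ext_cat X C) (ext_cat X C') (ext_cat X D) (ext_obj X Fo Fa) (ext_arr X Fa)"
proof -
  interpret EC: ext_category C X by (intro ext_category.intro ext_category_axioms.intro C.cstar_category_axioms X)
  interpret EC': ext_category C' X by (intro ext_category.intro ext_category_axioms.intro C'.cstar_category_axioms X)
  interpret ED: ext_category D X by (intro ext_category.intro ext_category_axioms.intro D.cstar_category_axioms X)
  let ?F = "ext_obj X Fo Fa"
  have CF: "ext_arr X Fa x x' \<in> ED.CF (Fo a a') (Fo b b')"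
    if "a \<in> Obj C" "b \<in> Obj C" "a' \<in> Obj C'" "b' \<in> Obj C'" "x \<in> EC.CF a b" "x' \<in> EC'.CF a' b'" for a b a' b' x x'
    by (rule ext_arr_closed[OF X C.hom_banach[OF that(1,2)] C'.hom_banach[OF that(3,4)]
          D.hom_banach[OF fun_obj[OF that(1,3)] fun_obj[OF that(2,4)]] fun_bilinear[OF that(1-4)] that(5,6)])
  have corner: "ext_arr X Fa x x' \<in> corner X D (?F p p') (?F q q')"
    if p: "p \<in> Obj (ext_cat X C)" and q: "q \<in> Obj (ext_cat X C)"
      and p': "p' \<in> Obj (ext_cat X C')" and q': "q' \<in> Obj (ext_cat X C')"
      and x: "x \<in> corner X C p q" and x': "x' \<in> corner X C' p' q'" for p q p' q' x x'
  proof -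
    note o = EC.ext_objD(1)[OF p] EC.ext_objD(1)[OF q] and o' = EC'.ext_objD(1)[OF p'] EC'.ext_objD(1)[OF q']
    have "Fa (x w) (x' w) \<cdot>\<^bsub>D\<^esub> Fa (snd p w) (snd p' w) = Fa (x w) (x' w) \<and>
        Fa (snd q w) (snd q' w) \<cdot>\<^bsub>D\<^esub> Fa (x w) (x' w) = Fa (x w) (x' w)" if w: "w \<in> topspace X" for w
    proof -
      note xv = EC.corner_value[OF x p q w] and xv' = EC'.corner_value[OF x' p' q' w]
      show ?thesis
        using fun_comp[OF o(1,1,2) o'(1,1,2) EC.ext_objD(3)[OF p w] xv EC'.ext_objD(3)[OF p' w] xv']
          fun_comp[OF o(1,2,2) o'(1,2,2) xv EC.ext_objD(3)[OF q w] xv' EC'.ext_objD(3)[OF q' w]]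
          EC.cornerD(2,3)[OF x w] EC'.cornerD(2,3)[OF x' w] by simp
    qed
    then show ?thesis
      using CF[OF o o' EC.cornerD(1)[OF x] EC'.cornerD(1)[OF x']] by (simp add: corner_def)
  qed
  show ?thesis
  proof (intro cstar_bifunctor.intro cstar_bifunctor_axioms.intro
      EC.ext_cat_cstar_category EC'.ext_cat_cstar_category ED.ext_cat_cstar_category)
    fix p p' assume p: "p \<in> Obj (ext_cat X C)" and p': "p' \<in> Obj (ext_cat X C')"
    note o = EC.ext_objD(1)[OF p] and o' = EC'.ext_objD(1)[OF p']
    have "Fa (snd p w) (snd p' w) \<cdot>\<^bsub>D\<^esub> Fa (snd p w) (snd p' w) = Fa (snd p w) (snd p' w) \<and>
        Star D (Fa (snd p w) (snd p' w)) = Fa (snd p w) (snd p' w)" if w: "w \<in> topspace X" for w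
      using EC.ext_objD(4,5)[OF p w] EC'.ext_objD(4,5)[OF p' w]
        fun_comp[OF o o o o' o' o' EC.ext_objD(3,3)[OF p w] EC'.ext_objD(3,3)[OF p' w]]
        fun_star[OF o o o' o' EC.ext_objD(3)[OF p w] EC'.ext_objD(3)[OF p' w]] by simp
    then show "?F p p' \<in> Obj (ext_cat X D)"
      using CF[OF o o o' o' EC.ext_objD(2)[OF p] EC'.ext_objD(2)[OF p']] fun_obj[OF o o'] by (simp add: Obj_ext_cat)
    show "ext_arr X Fa (Ident (ext_cat X C) p) (Ident (ext_cat X C') p') = Ident (ext_cat X D) (?F p p')"
      by simp
  next
    fix p q p' q'
    assume p: "p \<in> Obj (ext_cat X C)" and q: "q \<in> Obj (ext_cat X C)"
      and p': "p' \<in> Obj (ext_cat X C')" and q': "q' \<in> Obj (ext_cat X C')"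
    note o = EC.ext_objD(1)[OF p] EC.ext_objD(1)[OF q] and o' = EC'.ext_objD(1)[OF p'] EC'.ext_objD(1)[OF q']
    show "bounded_bilinear_on (Hom (ext_cat X C) p q) (Hom (ext_cat X C') p' q')
        (Hom (ext_cat X D) (?F p p') (?F q q')) (ext_arr X Fa)"
      unfolding Hom_ext_cat
    proof (rule bounded_bilinear_on_restrict)
      show "bounded_bilinear_on (cfun_space X (Hom C (fst p) (fst q))) (cfun_space X (Hom C' (fst p') (fst q')))
          (cfun_space X (Hom D (fst (?F p p')) (fst (?F q q')))) (ext_arr X Fa)"
        unfolding ext_obj_simps
        by (rule ext_arr_bounded_bilinear[OF X C.hom_banach[OF o] C'.hom_banach[OF o']
              D.hom_banach[OF fun_obj[OF o(1) o'(1)] fun_obj[OF o(2) o'(2)]] fun_bilinear[OF o o']])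
      show "ext_arr X Fa x x' \<in> corner X D (?F p p') (?F q q')"
        if "x \<in> corner X C p q" "x' \<in> corner X C' p' q'" for x x'
        by (rule corner[OF p q p' q' that])
    qed (auto simp: corner_def)
    fix x x' assume "x \<in> Arr (ext_cat X C) p q" "x' \<in> Arr (ext_cat X C') p' q'"
    then have x: "x \<in> corner X C p q" and x': "x' \<in> corner X C' p' q'" by (simp_all add: Arr_ext_cat)
    show "ext_arr X Fa (Star (ext_cat X C) x) (Star (ext_cat X C') x') = Star (ext_cat X D) (ext_arr X Fa x x')"
      by (simp add: ext_arr_eq_iff fun_star[OF o o' EC.corner_value[OF x p q] EC'.corner_value[OF x' p' q']])
    fix r r' y y'
    assume r: "r \<in> Obj (ext_cat X C)" and r': "r' \<in> Obj (ext_cat X C')"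
      and "y \<in> Arr (ext_cat X C) q r" "y' \<in> Arr (ext_cat X C') q' r'"
    then have y: "y \<in> corner X C q r" and y': "y' \<in> corner X C' q' r'" by (simp_all add: Arr_ext_cat)
    show "ext_arr X Fa (y \<cdot>\<^bsub>ext_cat X C\<^esub> x) (y' \<cdot>\<^bsub>ext_cat X C'\<^esub> x') =
        ext_arr X Fa y y' \<cdot>\<^bsub>ext_cat X D\<^esub> ext_arr X Fa x x'"
      by (simp add: ext_arr_eq_iff fun_comp[OF o EC.ext_objD(1)[OF r] o' EC'.ext_objD(1)[OF r']
            EC.corner_value[OF x p q] EC.corner_value[OF y q r] EC'.corner_value[OF x' p' q'] EC'.corner_value[OF y' q' r']])
  qed
qed

end

context ext_category
begin

lemma ext_const_eq: "a \<in> Obj C \<Longrightarrow> ext_const X C a = (a, \<lambda>w\<in>topspace X. Ident C a)"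
  using complex_banach.scale_one[OF hom_banach ident_arr]
  by (simp add: ext_const_def etensor_def)

lemma ext_const_obj:
  assumes a: "a \<in> Obj C"
  shows "ext_const X C a \<in> Obj D"
  using a ident_left[OF a a ident_arr[OF a]] CF_const[OF a a ident_arr[OF a]] star_ident[OF a]
  by (simp add: Obj_ext_cat ext_const_eq)

lemma corner_ext_const:
  assumes a: "a \<in> Obj C" and b: "b \<in> Obj C"
  shows "corner X C (ext_const X C a) (ext_const X C b) = CF a b"
  using ident_left[OF a b] ident_right[OF a b] CF_value[OF a b]
  by (auto simp: corner_def ext_const_eq a b)

text \<open>Between objects \<open>1 \<otimes> 1\<^sub>a\<close> the corner conditions are void, which leaves all of \<open>C(\<Omega>, (a, b))\<close>.\<close>

lemma Hom_ext_const:
  assumes a: "a \<in> Obj C" and b: "b \<in> Obj C"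
  shows "Hom D (ext_const X C a) (ext_const X C b) = ctensor X (Hom C a b)"
proof -
  have "Hom D (ext_const X C a) (ext_const X C b) = (cfun_space X (Hom C a b))\<lparr>vecs := CF a b\<rparr>"
    using corner_ext_const[OF a b] by (simp add: Hom_ext_cat ext_const_eq[OF a] ext_const_eq[OF b])
  then show ?thesis by (simp add: cfun_banach.ctensor_eq_cfun_space[OF cfun_hom[OF a b]])
qed

lemma ext_star_etensor:
  assumes a: "a \<in> Obj C" and b: "b \<in> Obj C" and s: "s \<in> Arr C a b"
  shows "ext_star X C (etensor X (Hom C a b) f s) = etensor X (Hom C b a) (\<lambda>w. cnj (f w)) (Star C s)"
  by (simp add: ext_star_def etensor_def star_scale[OF a b s] cong: restrict_cong)

end

context strict_tensor_cstar_category
begin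

theorem ext_strict_tensor:
  fixes X :: "'w topology"
  assumes X: "compact_space X"
  shows "strict_tensor_cstar_category (ext_cat X C) (ext_obj X To Ta) (ext_arr X Ta) (ext_const X C unit)"
proof -
  interpret E: ext_category C X by (intro ext_category.intro ext_category_axioms.intro C.cstar_category_axioms X)
  interpret F: cstar_bifunctor E.D E.D E.D "ext_obj X To Ta" "ext_arr X Ta" by (rule ext_cstar_bifunctor[OF X])
  let ?o = "ext_obj X To Ta" and ?u = "ext_const X C unit"
  note val = E.ext_objD(3)
  have eq: "(\<lambda>w\<in>topspace X. snd p w) = snd p" if "p \<in> Obj E.D" for p
    using cfun_space_extensional[OF E.ext_objD(2)[OF that]] by (simp add: extensional_restrict)
  show ?thesis
  proof (intro strict_tensor_cstar_category.intro strict_tensor_cstar_category_axioms.intro F.cstar_bifunctor_axioms)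
    show "?u \<in> Obj E.D" by (rule E.ext_const_obj[OF unit_obj])
    fix p assume p: "p \<in> Obj E.D"
    note o = E.ext_objD(1)[OF p]
    note pe = cfun_space_extensional[OF E.ext_objD(2)[OF p]]
    show "?o ?u p = p"
      by (rule prod_eqI)
         (simp_all add: E.ext_const_eq[OF unit_obj] obj_unit_left[OF o] ext_arr_eq_iff[OF pe]
           arr_unit_left[OF o o val[OF p]])
    show "?o p ?u = p"
      by (rule prod_eqI)
         (simp_all add: E.ext_const_eq[OF unit_obj] obj_unit_right[OF o] ext_arr_eq_iff[OF pe]
           arr_unit_right[OF o o val[OF p]])
    fix q assume q: "q \<in> Obj E.D"
    note o' = E.ext_objD(1)[OF q]
    { fix x assume "x \<in> Arr E.D p q"
      then have x: "x \<in> corner X C p q" by (simp add: Arr_ext_cat)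
      note xe = cfun_space_extensional[OF E.cornerD(1)[OF x]] and xv = E.corner_value[OF x p q]
      show "ext_arr X Ta (Ident E.D ?u) x = x"
        by (simp add: ext_arr_eq_iff[OF xe] E.ext_const_eq[OF unit_obj] arr_unit_left[OF o o' xv])
      show "ext_arr X Ta x (Ident E.D ?u) = x"
        by (simp add: ext_arr_eq_iff[OF xe] E.ext_const_eq[OF unit_obj] arr_unit_right[OF o o' xv]) }
    fix r assume r: "r \<in> Obj E.D"
    note o'' = E.ext_objD(1)[OF r]
    show "?o (?o p q) r = ?o p (?o q r)"
      by (rule prod_eqI)
         (simp_all add: obj_assoc[OF o o' o''] ext_arr_eq_iff arr_assoc[OF o o o' o' o'' o'' val[OF p] val[OF q] val[OF r]])
  next
    fix p p' q q' r r' x y z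
    assume o: "p \<in> Obj E.D" "p' \<in> Obj E.D" "q \<in> Obj E.D" "q' \<in> Obj E.D" "r \<in> Obj E.D" "r' \<in> Obj E.D"
      and "x \<in> Arr E.D p p'" "y \<in> Arr E.D q q'" "z \<in> Arr E.D r r'"
    then have "x \<in> corner X C p p'" "y \<in> corner X C q q'" "z \<in> corner X C r r'" by (simp_all add: Arr_ext_cat)
    note v = E.corner_value[OF this(1) o(1,2)] E.corner_value[OF this(2) o(3,4)] E.corner_value[OF this(3) o(5,6)]
    show "ext_arr X Ta (ext_arr X Ta x y) z = ext_arr X Ta x (ext_arr X Ta y z)"
      by (simp add: ext_arr_eq_iff arr_assoc[OF o[THEN E.ext_objD(1)] v])
  qed
qed

text \<open>By naturality \<open>\<theta>(a, b) (e \<times> f) = (f \<times> e) \<theta>(a, b)\<close>, which makes this arrow a unitary from \<open>e \<times> f\<close>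
  to \<open>f \<times> e\<close> although \<open>\<theta>(a, b)\<close> itself lies outside the corner in general.\<close>

theorem ext_symmetric:
  fixes X :: "'w topology"
  assumes X: "compact_space X" and sym: "symmetric_tensor C To Ta"
  shows "symmetric_tensor (ext_cat X C) (ext_obj X To Ta) (ext_arr X Ta)"
proof -
  interpret E: ext_category C X by (intro ext_category.intro ext_category_axioms.intro C.cstar_category_axioms X)
  interpret F: cstar_bifunctor E.D E.D E.D "ext_obj X To Ta" "ext_arr X Ta" by (rule ext_cstar_bifunctor[OF X])
  obtain \<theta> where th: "\<forall>a\<in>Obj C. \<forall>b\<in>Obj C. unitary_arrow C (To a b) (To b a) (\<theta> a b)"
    and nat: "\<forall>a\<in>Obj C. \<forall>a'\<in>Obj C. \<forall>b\<in>Obj C. \<forall>b'\<in>Obj C. \<forall>s\<in>Arr C a a'. \<forall>t\<in>Arr C b b'.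
        \<theta> a' b' \<cdot>\<^bsub>C\<^esub> Ta s t = Ta t s \<cdot>\<^bsub>C\<^esub> \<theta> a b"
    and inv: "\<forall>a\<in>Obj C. \<forall>b\<in>Obj C. \<theta> b a \<cdot>\<^bsub>C\<^esub> \<theta> a b = Ident C (To a b)"
    and hex: "\<forall>a\<in>Obj C. \<forall>b\<in>Obj C. \<forall>c\<in>Obj C.
        \<theta> (To a b) c = Ta (\<theta> a c) (Ident C b) \<cdot>\<^bsub>C\<^esub> Ta (Ident C a) (\<theta> b c)"
    using sym unfolding symmetric_tensor_def by (elim exE conjE)
  have th_arr: "\<theta> a b \<in> Arr C (To a b) (To b a)" "Star C (\<theta> a b) \<cdot>\<^bsub>C\<^esub> \<theta> a b = Ident C (To a b)"
    "\<theta> a b \<cdot>\<^bsub>C\<^esub> Star C (\<theta> a b) = Ident C (To b a)" if "a \<in> Obj C" "b \<in> Obj C" for a b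
    using th that by (auto simp: unitary_arrow_def)
  note nat = nat[rule_format] and inv = inv[rule_format] and hex = hex[rule_format]
  define \<Theta> where "\<Theta> p q = (\<lambda>w\<in>topspace X. \<theta> (fst p) (fst q) \<cdot>\<^bsub>C\<^esub> Ta (snd p w) (snd q w))" for p q
  let ?o = "ext_obj X To Ta"
  note assoc = C.comp_assoc
  have T: "Ta s t \<in> Arr C (To a b) (To a' b')"
    if "a \<in> Obj C" "a' \<in> Obj C" "b \<in> Obj C" "b' \<in> Obj C" "s \<in> Arr C a a'" "t \<in> Arr C b b'" for a a' b b' s t
    by (rule fun_closed[OF that])
  have point: "\<theta> a b \<cdot>\<^bsub>C\<^esub> Ta e f \<cdot>\<^bsub>C\<^esub> Ta e f = \<theta> a b \<cdot>\<^bsub>C\<^esub> Ta e f"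
    "Ta f e \<cdot>\<^bsub>C\<^esub> (\<theta> a b \<cdot>\<^bsub>C\<^esub> Ta e f) = \<theta> a b \<cdot>\<^bsub>C\<^esub> Ta e f"
    "Star C (\<theta> a b \<cdot>\<^bsub>C\<^esub> Ta e f) \<cdot>\<^bsub>C\<^esub> (\<theta> a b \<cdot>\<^bsub>C\<^esub> Ta e f) = Ta e f"
    "\<theta> a b \<cdot>\<^bsub>C\<^esub> Ta e f \<cdot>\<^bsub>C\<^esub> Star C (\<theta> a b \<cdot>\<^bsub>C\<^esub> Ta e f) = Ta f e"
    "(\<theta> b a \<cdot>\<^bsub>C\<^esub> Ta f e) \<cdot>\<^bsub>C\<^esub> (\<theta> a b \<cdot>\<^bsub>C\<^esub> Ta e f) = Ta e f"
    if a: "a \<in> Obj C" and b: "b \<in> Obj C" and e: "e \<in> Arr C a a" "e \<cdot>\<^bsub>C\<^esub> e = e" "Star C e = e"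
      and f: "f \<in> Arr C b b" "f \<cdot>\<^bsub>C\<^esub> f = f" "Star C f = f" for a b e f
  proof -
    let ?h = "\<theta> a b" and ?T = "Ta e f" and ?T' = "Ta f e"
    note ab = fun_obj[OF a b] and ba = fun_obj[OF b a]
    note Tm = T[OF a a b b e(1) f(1)] and Tm' = T[OF b b a a f(1) e(1)]
    note h = th_arr[OF a b] and h' = C.star_arr[OF ab ba th_arr(1)[OF a b]]
    have TT: "?T \<cdot>\<^bsub>C\<^esub> ?T = ?T" "?T' \<cdot>\<^bsub>C\<^esub> ?T' = ?T'"
      using fun_comp[OF a a a b b b e(1) e(1) f(1) f(1)] fun_comp[OF b b b a a a f(1) f(1) e(1) e(1)] e f by simp_all
    have sT: "Star C ?T = ?T" "Star C ?T' = ?T'"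
      using fun_star[OF a a b b e(1) f(1)] fun_star[OF b b a a f(1) e(1)] e f by simp_all
    have hT: "?h \<cdot>\<^bsub>C\<^esub> ?T = ?T' \<cdot>\<^bsub>C\<^esub> ?h" by (rule nat[OF a a b b e(1) f(1)])
    show 1: "?h \<cdot>\<^bsub>C\<^esub> ?T \<cdot>\<^bsub>C\<^esub> ?T = ?h \<cdot>\<^bsub>C\<^esub> ?T" using assoc[OF ab ab ab ba Tm Tm h(1)] TT by simp
    show 2: "?T' \<cdot>\<^bsub>C\<^esub> (?h \<cdot>\<^bsub>C\<^esub> ?T) = ?h \<cdot>\<^bsub>C\<^esub> ?T"
      unfolding hT using assoc[OF ab ba ba ba h(1) Tm' Tm'] TT by simp
    note hTm = C.comp_closed[OF ab ab ba h(1) Tm]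
    show "Star C (?h \<cdot>\<^bsub>C\<^esub> ?T) \<cdot>\<^bsub>C\<^esub> (?h \<cdot>\<^bsub>C\<^esub> ?T) = ?T"
      using C.star_comp[OF ab ab ba Tm h(1)] sT assoc[OF ab ba ab ab hTm h' Tm] assoc[OF ab ab ba ab Tm h(1) h']
        h(2) C.ident_left[OF ab ab Tm] TT by simp
    show "?h \<cdot>\<^bsub>C\<^esub> ?T \<cdot>\<^bsub>C\<^esub> Star C (?h \<cdot>\<^bsub>C\<^esub> ?T) = ?T'"
      unfolding hT
      using C.star_comp[OF ab ba ba h(1) Tm'] sT assoc[OF ba ab ba ba C.comp_closed[OF ba ba ab h' Tm'] h(1) Tm']
        assoc[OF ba ba ab ba Tm' h' h(1)] h(3) C.ident_left[OF ba ba Tm'] TT by simp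
    show "(\<theta> b a \<cdot>\<^bsub>C\<^esub> ?T') \<cdot>\<^bsub>C\<^esub> (?h \<cdot>\<^bsub>C\<^esub> ?T) = ?T"
      using assoc[OF ab ba ba ab hTm Tm' th_arr(1)[OF b a]] 2 assoc[OF ab ab ba ab Tm h(1) th_arr(1)[OF b a]]
        inv[OF a b] C.ident_left[OF ab ab Tm] by simp
  qed
  have corner: "\<Theta> p q \<in> corner X C (?o p q) (?o q p)" if p: "p \<in> Obj E.D" and q: "q \<in> Obj E.D" for p q
  proof -
    note o = E.ext_objD(1)[OF p] E.ext_objD(1)[OF q]
    note ab = fun_obj[OF o(1,2)] fun_obj[OF o(2,1)]
    have "\<Theta> p q = ext_arr X (Comp C) (\<lambda>w\<in>topspace X. \<theta> (fst p) (fst q)) (ext_arr X Ta (snd p) (snd q))"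
      by (auto simp: \<Theta>_def ext_arr_def)
    also have "\<dots> \<in> E.CF (To (fst p) (fst q)) (To (fst q) (fst p))"
      using E.ext_objD(2)[OF F.fun_obj[OF p q]]
      by (intro E.CF_comp[OF ab(1,1,2)] E.CF_const[OF ab] th_arr o) simp
    finally show ?thesis
      using point[OF o E.ext_objD(3-5)[OF p] E.ext_objD(3-5)[OF q]] by (simp add: corner_def \<Theta>_def)
  qed
  show ?thesis
    unfolding symmetric_tensor_def
  proof (intro exI[of _ \<Theta>] conjI ballI)
    fix p q assume p: "p \<in> Obj E.D" and q: "q \<in> Obj E.D"
    note o = E.ext_objD(1)[OF p] E.ext_objD(1)[OF q]
    note pt = point[OF o E.ext_objD(3-5)[OF p] E.ext_objD(3-5)[OF q]]
    show "unitary_arrow E.D (?o p q) (?o q p) (\<Theta> p q)"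
      using corner[OF p q] pt by (simp add: unitary_arrow_def Arr_ext_cat ext_arr_eq_iff \<Theta>_def)
    show "\<Theta> q p \<cdot>\<^bsub>E.D\<^esub> \<Theta> p q = Ident E.D (?o p q)"
      using pt by (simp add: ext_arr_eq_iff \<Theta>_def)
    fix r assume r: "r \<in> Obj E.D"
    note o'' = E.ext_objD(1)[OF r]
    show "\<Theta> (?o p q) r = ext_arr X Ta (\<Theta> p r) (Ident E.D q) \<cdot>\<^bsub>E.D\<^esub> ext_arr X Ta (Ident E.D p) (\<Theta> q r)"
    proof (rule extensionalityI)
      fix w assume w: "w \<in> topspace X"
      let ?a = "fst p" and ?b = "fst q" and ?c = "fst r"
      let ?e = "snd p w" and ?f = "snd q w" and ?g = "snd r w"
      note e = E.ext_objD(3)[OF p w] and f = E.ext_objD(3)[OF q w] and g = E.ext_objD(3)[OF r w]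
      note Ia = C.ident_arr[OF o(1)] and Ib = C.ident_arr[OF o(2)]
      note ac = fun_obj[OF o(1) o''] and ca = fun_obj[OF o'' o(1)] and bc = fun_obj[OF o(2) o''] and cb = fun_obj[OF o'' o(2)]
      let ?u = "\<theta> ?b ?c \<cdot>\<^bsub>C\<^esub> Ta ?f ?g"
      note Tbc = T[OF o(2,2) o'' o'' f g] and Tac = T[OF o(1,1) o'' o'' e g] and Tcb = T[OF o'' o'' o(2,2) g f]
      have u: "?u \<in> Arr C (To ?b ?c) (To ?c ?b)" by (rule C.comp_closed[OF bc bc cb th_arr(1)[OF o(2) o''] Tbc])
      let ?A = "Ta (\<theta> ?a ?c) (Ident C ?b)" and ?B = "Ta (Ident C ?a) (\<theta> ?b ?c)"
      have A: "?A \<in> Arr C (To ?a (To ?c ?b)) (To (To ?c ?a) ?b)"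
        using T[OF ac ca o(2,2) th_arr(1)[OF o(1) o''] Ib] obj_assoc[OF o(1) o'' o(2)] by simp
      note B = T[OF o(1,1) bc cb Ia th_arr(1)[OF o(2) o'']]
      note x1 = fun_obj[OF o(1) cb] and x2 = fun_obj[OF o(1) bc] and x3 = fun_obj[OF ca o(2)]
      (* All projections are moved to the right, so that the hexagon identity applies to what is left. *)
      have 1: "Ta (\<theta> ?a ?c \<cdot>\<^bsub>C\<^esub> Ta ?e ?g) ?f = ?A \<cdot>\<^bsub>C\<^esub> Ta ?e (Ta ?g ?f)"
        using fun_comp[OF ac ac ca o(2,2,2) Tac th_arr(1)[OF o(1) o''] f Ib] C.ident_left[OF o(2,2) f]
          arr_assoc[OF o(1,1) o'' o'' o(2,2) e g f] by simp
      have 2: "Ta ?e (Ta ?g ?f) \<cdot>\<^bsub>C\<^esub> Ta ?e ?u = Ta ?e ?u"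
        using fun_comp[OF o(1,1,1) bc cb cb e e u Tcb] E.ext_objD(4)[OF p w]
          point(2)[OF o(2) o'' E.ext_objD(3-5)[OF q w] E.ext_objD(3-5)[OF r w]] by simp
      have 3: "Ta ?e ?u = ?B \<cdot>\<^bsub>C\<^esub> Ta ?e (Ta ?f ?g)"
        using fun_comp[OF o(1,1,1) bc bc cb e Ia Tbc th_arr(1)[OF o(2) o'']] C.ident_left[OF o(1,1) e] by simp
      have "Ta (\<theta> ?a ?c \<cdot>\<^bsub>C\<^esub> Ta ?e ?g) ?f \<cdot>\<^bsub>C\<^esub> Ta ?e ?u = ?A \<cdot>\<^bsub>C\<^esub> (?B \<cdot>\<^bsub>C\<^esub> Ta ?e (Ta ?f ?g))"
        unfolding 1 using assoc[OF x2 x1 x1 x3 T[OF o(1,1) bc cb e u] T[OF o(1,1) cb cb e Tcb] A] 2 3 by simp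
      also have "\<dots> = \<theta> (To ?a ?b) ?c \<cdot>\<^bsub>C\<^esub> Ta (Ta ?e ?f) ?g"
        using assoc[OF x2 x2 x1 x3 T[OF o(1,1) bc bc e Tbc] B A] hex[OF o o'']
          arr_assoc[OF o(1,1) o(2,2) o'' o'' e f g] by simp
      finally show "\<Theta> (?o p q) r w =
          (ext_arr X Ta (\<Theta> p r) (Ident E.D q) \<cdot>\<^bsub>E.D\<^esub> ext_arr X Ta (Ident E.D p) (\<Theta> q r)) w"
        using w by (simp add: \<Theta>_def)
    qed (simp_all add: \<Theta>_def)
  next
    fix p p' q q' x y
    assume p: "p \<in> Obj E.D" and p': "p' \<in> Obj E.D" and q: "q \<in> Obj E.D" and q': "q' \<in> Obj E.D"
      and "x \<in> Arr E.D p p'" "y \<in> Arr E.D q q'"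
    then have x: "x \<in> corner X C p p'" and y: "y \<in> corner X C q q'" by (simp_all add: Arr_ext_cat)
    note a = E.ext_objD(1)[OF p] and a' = E.ext_objD(1)[OF p'] and b = E.ext_objD(1)[OF q] and b' = E.ext_objD(1)[OF q']
    show "\<Theta> p' q' \<cdot>\<^bsub>E.D\<^esub> ext_arr X Ta x y = ext_arr X Ta y x \<cdot>\<^bsub>E.D\<^esub> \<Theta> p q"
    proof (rule extensionalityI)
      fix w assume w: "w \<in> topspace X"
      note xv = E.corner_value[OF x p p' w] and yv = E.corner_value[OF y q q' w]
      note e = E.ext_objD(3)[OF p w] and f = E.ext_objD(3)[OF q w] and e' = E.ext_objD(3)[OF p' w] and f' = E.ext_objD(3)[OF q' w]
      let ?h = "\<theta> (fst p) (fst q)" and ?h' = "\<theta> (fst p') (fst q')"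
      let ?xy = "Ta (x w) (y w)" and ?yx = "Ta (y w) (x w)"
      note ab = fun_obj[OF a b] and ba = fun_obj[OF b a] and ab' = fun_obj[OF a' b'] and ba' = fun_obj[OF b' a']
      note xyT = T[OF a a' b b' xv yv] and yxT = T[OF b b' a a' yv xv]
      have "(?h' \<cdot>\<^bsub>C\<^esub> Ta (snd p' w) (snd q' w)) \<cdot>\<^bsub>C\<^esub> ?xy = ?h' \<cdot>\<^bsub>C\<^esub> ?xy"
        using assoc[OF ab ab' ab' ba' xyT T[OF a' a' b' b' e' f'] th_arr(1)[OF a' b']]
          fun_comp[OF a a' a' b b' b' xv e' yv f'] E.cornerD(3)[OF x w] E.cornerD(3)[OF y w] by simp
      also have "\<dots> = ?h' \<cdot>\<^bsub>C\<^esub> (?xy \<cdot>\<^bsub>C\<^esub> Ta (snd p w) (snd q w))"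
        using fun_comp[OF a a a' b b b' e xv f yv] E.cornerD(2)[OF x w] E.cornerD(2)[OF y w] by simp
      also have "\<dots> = (?yx \<cdot>\<^bsub>C\<^esub> ?h) \<cdot>\<^bsub>C\<^esub> Ta (snd p w) (snd q w)"
        using assoc[OF ab ab ab' ba' T[OF a a b b e f] xyT th_arr(1)[OF a' b']] nat[OF a a' b b' xv yv] by simp
      also have "\<dots> = ?yx \<cdot>\<^bsub>C\<^esub> (?h \<cdot>\<^bsub>C\<^esub> Ta (snd p w) (snd q w))"
        by (rule assoc[OF ab ab ba ba' T[OF a a b b e f] th_arr(1)[OF a b] yxT])
      finally show "(\<Theta> p' q' \<cdot>\<^bsub>E.D\<^esub> ext_arr X Ta x y) w = (ext_arr X Ta y x \<cdot>\<^bsub>E.D\<^esub> \<Theta> p q) w"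
        using w by (simp add: \<Theta>_def)
    qed simp_all
  qed
qed

end

section \<open>Conjugates\<close>

context cstar_category
begin

text \<open>Kaplansky's formula: with \<open>r = p\<^sup>*\<close>, the element \<open>h = 1 + (p - r) (r - p)\<close> has the form
  \<open>1 + y\<^sup>* y\<close>, so it is invertible because \<open>-1\<close> is not in the spectrum of \<open>y\<^sup>* y\<close>. From
  \<open>h p = p r p = p h\<close> it follows that \<open>h\<close> and its inverse \<open>t\<close> commute with \<open>p\<close> and \<open>r\<close>, and
  \<open>q = p r t\<close> is the required projection.\<close>

lemma idempotent_range_projection:
  assumes a: "a \<in> Obj C" and p: "p \<in> Arr C a a" and pp: "p \<cdot> p = p"
  shows "\<exists>q\<in>Arr C a a. q \<cdot> q = q \<and> Star C q = q \<and> p \<cdot> q = q \<and> q \<cdot> p = p"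
proof -
  interpret H: complex_banach "Hom C a a" by (rule hom_banach[OF a a])
  let ?one = "Ident C a"
  define r where "r = Star C p"
  note assoc = comp_assoc[OF a a a a] and cl = comp_closed[OF a a a] and I = ident_arr[OF a]
    and il = ident_left[OF a a] and ir = ident_right[OF a a] and st = star_comp[OF a a a]
  have r: "r \<in> Arr C a a" unfolding r_def by (rule star_arr[OF a a p])
  have sr: "Star C r = p" "Star C p = r" unfolding r_def using star_star[OF a a p] by simp_all
  have rr: "r \<cdot> r = r" using st[OF p p] pp by (simp add: r_def)
  let ?y = "H.minus_vec r p" and ?z = "H.minus_vec p r"
  have y: "?y \<in> Arr C a a" "?z \<in> Arr C a a" using p r by (simp_all add: H.diff_closed)
  have sy: "Star C ?y = ?z" using star_diff[OF a a r p] sr by simp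
  define k where "k = ?z \<cdot> ?y"
  have k: "k \<in> Arr C a a" unfolding k_def using y by (simp add: cl)
  define h where "h = H.minus_vec k ((-1) \<odot>\<^bsub>Hom C a a\<^esub> ?one)"
  have h: "h \<in> Arr C a a" unfolding h_def by (intro H.diff_closed H.scale_closed k I)
  have "positive_arrow C a k" using star_comp_positive[OF a a y(1)] sy by (simp add: k_def)
  moreover have "-1 \<notin> complex_of_real ` {0..}"
  proof
    assume "-1 \<in> complex_of_real ` {0..}"
    then obtain x :: real where "x \<ge> 0" "-1 = complex_of_real x" by auto
    then have "Re (-1) = x" by (metis Re_complex_of_real)
    then show False using \<open>x \<ge> 0\<close> by simp
  qed
  ultimately have "-1 \<notin> spectrum C a k" by (auto simp: positive_arrow_def)
  then obtain t where t: "t \<in> Arr C a a" "t \<cdot> h = ?one" "h \<cdot> t = ?one"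
    by (auto simp: spectrum_def Let_def h_def)
  have h_apply: "h \<cdot> s = k \<cdot> s \<oplus>\<^bsub>Hom C a a\<^esub> s" if s: "s \<in> Arr C a a" for s
    using comp_diff_left[OF a a a k H.scale_closed[OF I] s, of "-1"] il[OF s]
      bilinear_on_scale_left[OF comp_bilinear[OF a a a] I s, of "-1"]
    by (simp add: h_def ndiff_def H.scale_scale H.scale_one s)
  have hp: "h \<cdot> p = p \<cdot> (r \<cdot> p)"
  proof -
    have "?y \<cdot> p = H.minus_vec (r \<cdot> p) p" using comp_diff_left[OF a a a r p p] pp by simp
    then have "k \<cdot> p = ?z \<cdot> H.minus_vec (r \<cdot> p) p" using assoc[OF p y] by (simp add: k_def)
    also have "\<dots> = H.minus_vec (p \<cdot> H.minus_vec (r \<cdot> p) p) (r \<cdot> H.minus_vec (r \<cdot> p) p)"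
      using comp_diff_left[OF a a a p r] p r by (simp add: cl H.diff_closed)
    also have "p \<cdot> H.minus_vec (r \<cdot> p) p = H.minus_vec (p \<cdot> (r \<cdot> p)) p"
      using comp_diff_right[OF a a a p cl[OF r p] p] pp by simp
    also have "r \<cdot> H.minus_vec (r \<cdot> p) p = \<zero>\<^bsub>Hom C a a\<^esub>"
      using comp_diff_right[OF a a a r cl[OF r p] p] assoc[OF p r r] rr cl[OF r p] by (simp add: H.diff_self)
    finally have "k \<cdot> p = H.minus_vec (p \<cdot> (r \<cdot> p)) p"
      using p r by (simp add: ndiff_def[of _ _ "\<zero>\<^bsub>Hom C a a\<^esub>"] H.scale_zero_right H.add_zero_right H.diff_closed cl)
    then show ?thesis using h_apply[OF p] p r by (simp add: H.diff_add_cancel cl)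
  qed
  have hr: "h \<cdot> r = r \<cdot> (p \<cdot> r)"
  proof -
    have "?y \<cdot> r = H.minus_vec r (p \<cdot> r)" using comp_diff_left[OF a a a r p r] rr by simp
    then have "k \<cdot> r = ?z \<cdot> H.minus_vec r (p \<cdot> r)" using assoc[OF r y] by (simp add: k_def)
    also have "\<dots> = H.minus_vec (p \<cdot> H.minus_vec r (p \<cdot> r)) (r \<cdot> H.minus_vec r (p \<cdot> r))"
      using comp_diff_left[OF a a a p r] p r by (simp add: cl H.diff_closed)
    also have "p \<cdot> H.minus_vec r (p \<cdot> r) = \<zero>\<^bsub>Hom C a a\<^esub>"
      using comp_diff_right[OF a a a p r cl[OF p r]] assoc[OF r p p] pp cl[OF p r] by (simp add: H.diff_self)
    also have "r \<cdot> H.minus_vec r (p \<cdot> r) = H.minus_vec r (r \<cdot> (p \<cdot> r))"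
      using comp_diff_right[OF a a a r r cl[OF p r]] rr by simp
    also have "H.minus_vec \<zero>\<^bsub>Hom C a a\<^esub> (H.minus_vec r (r \<cdot> (p \<cdot> r))) = H.minus_vec (r \<cdot> (p \<cdot> r)) r"
      using p r H.diff_minus[of r "r \<cdot> (p \<cdot> r)"]
      by (simp add: ndiff_def[of _ "\<zero>\<^bsub>Hom C a a\<^esub>"] H.add_zero H.scale_closed H.diff_closed cl)
    finally show ?thesis using h_apply[OF r] p r by (simp add: H.diff_add_cancel cl)
  qed
  have sk: "Star C h = h"
  proof -
    have "Star C k = k" using st[OF y] sy star_star[OF a a y(1)] by (simp add: k_def)
    then show ?thesis
      unfolding h_def using star_diff[OF a a k H.scale_closed[OF I]] star_scale[OF a a I] star_ident[OF a] by simp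
  qed
  have ph: "p \<cdot> h = p \<cdot> (r \<cdot> p)"
    using arg_cong[OF hr, of "Star C"] st[OF r h] st[OF cl[OF p r] r] st[OF r p] sk sr assoc[OF p r p] by simp
  have rh: "r \<cdot> h = r \<cdot> (p \<cdot> r)"
    using arg_cong[OF hp, of "Star C"] st[OF p h] st[OF cl[OF r p] p] st[OF p r] sk sr assoc[OF r p r] by simp
  have comm: "t \<cdot> s = s \<cdot> t" if s: "s \<in> Arr C a a" and hs: "h \<cdot> s = s \<cdot> h" for s
  proof -
    have "t \<cdot> s = t \<cdot> ((s \<cdot> h) \<cdot> t)" using assoc[OF t(1) h s] t(3) ir[OF s] by simp
    also have "\<dots> = (t \<cdot> h) \<cdot> (s \<cdot> t)" unfolding hs[symmetric] using s h t(1) by (simp add: assoc cl)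
    also have "\<dots> = s \<cdot> t" using t s by (simp add: il cl)
    finally show ?thesis .
  qed
  have tp: "t \<cdot> p = p \<cdot> t" using comm[OF p] hp ph by simp
  have tr: "t \<cdot> r = r \<cdot> t" using comm[OF r] hr rh by simp
  have ts: "Star C t = t"
  proof -
    have s: "Star C t \<in> Arr C a a" by (rule star_arr[OF a a t(1)])
    have "Star C t \<cdot> h = Star C (h \<cdot> t)" using st[OF t(1) h] sk by simp
    also have "\<dots> = ?one" using t(3) star_ident[OF a] by simp
    finally have "Star C t \<cdot> h \<cdot> t = t" using il[OF t(1)] by simp
    then show ?thesis using assoc[OF t(1) h s] t(3) ir[OF s] by simp
  qed
  define q where "q = p \<cdot> (r \<cdot> t)"
  have q: "q \<in> Arr C a a" unfolding q_def using p r t(1) by (simp add: cl)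
  have pq: "p \<cdot> q = q" unfolding q_def using assoc[OF cl[OF r t(1)] p p] pp by simp
  have qp: "q \<cdot> p = p"
  proof -
    have "q \<cdot> p = (p \<cdot> (r \<cdot> p)) \<cdot> t" unfolding q_def using p r t(1) tp by (simp add: assoc cl)
    also have "\<dots> = p" unfolding ph[symmetric] using assoc[OF t(1) h p] t(3) ir[OF p] by simp
    finally show ?thesis .
  qed
  have sq: "Star C q = q"
  proof -
    have "Star C q = (t \<cdot> p) \<cdot> r" unfolding q_def using st[OF cl[OF r t(1)] p] st[OF t(1) r] ts sr by simp
    also have "\<dots> = q" unfolding q_def tp using p r t(1) by (simp add: assoc tr)
    finally show ?thesis .
  qed
  have "q \<cdot> q = (q \<cdot> p) \<cdot> (r \<cdot> t)" using assoc[OF cl[OF r t(1)] p q] by (simp add: q_def)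
  then have "q \<cdot> q = q" using qp by (simp add: q_def)
  then show ?thesis using q sq pq qp by blast
qed

end

context strict_tensor_cstar_category
begin

text \<open>The conclusion expresses, inside a category in which projections need not split, that the
  subobjects \<open>e\<close> of \<open>a\<close> and \<open>q\<close> of \<open>b\<close> are conjugate: the identities of the objects are replaced by
  the projections.\<close>

lemma conjugate_of_projection:
  assumes a: "a \<in> Obj C" and b: "b \<in> Obj C"
    and R: "R \<in> Arr C unit (To b a)" and R': "R' \<in> Arr C unit (To a b)"
    and zig: "Ta (Star C R') (Ident C a) \<cdot>\<^bsub>C\<^esub> Ta (Ident C a) R = Ident C a"
    and zag: "Ta (Star C R) (Ident C b) \<cdot>\<^bsub>C\<^esub> Ta (Ident C b) R' = Ident C b"
    and e: "e \<in> Arr C a a" and ee: "e \<cdot>\<^bsub>C\<^esub> e = e" and se: "Star C e = e"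
  shows "\<exists>q\<in>Arr C b b. q \<cdot>\<^bsub>C\<^esub> q = q \<and> Star C q = q \<and>
     (\<exists>S\<in>Arr C unit (To b a). \<exists>S'\<in>Arr C unit (To a b).
        Ta q e \<cdot>\<^bsub>C\<^esub> S = S \<and> Ta e q \<cdot>\<^bsub>C\<^esub> S' = S' \<and>
        Ta (Star C S') e \<cdot>\<^bsub>C\<^esub> Ta e S = e \<and> Ta (Star C S) q \<cdot>\<^bsub>C\<^esub> Ta q S' = q)"
proof -
  let ?u = unit
  let ?Ia = "Ident C a" and ?Ib = "Ident C b" and ?Iu = "Ident C unit"
  note u = unit_obj
  note ab = fun_obj[OF a b] and ba = fun_obj[OF b a]
  note Ia = C.ident_arr[OF a] and Ib = C.ident_arr[OF b] and Iu = C.ident_arr[OF u]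
  note assoc = C.comp_assoc and il = C.ident_left and ir = C.ident_right
  note oas = obj_assoc[OF b a b] obj_assoc[OF a b a]
  note bab = fun_obj[OF b ab] and aba = fun_obj[OF a ba]
  note sR' = C.star_arr[OF u ab R'] and sR = C.star_arr[OF u ba R]
  (* The types below use strictness: b = b unit = unit b, and brackets in products of objects are
     moved to the right. *)
  have bR': "Ta ?Ib (Star C R') \<in> Arr C (To b (To a b)) b"
    using fun_closed[OF b b ab u Ib sR'] obj_unit_right[OF b] by simp
  have aR': "Ta (Star C R') ?Ia \<in> Arr C (To a (To b a)) a"
    using fun_closed[OF ab u a a sR' Ia] obj_unit_left[OF a] oas by simp
  have aR: "Ta ?Ia R \<in> Arr C a (To a (To b a))"
    using fun_closed[OF a a u ba Ia R] obj_unit_right[OF a] by simp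
  have yb: "Ta y s \<in> Arr C b (To b (To a b))" if "y \<in> Arr C ?u (To b a)" "s \<in> Arr C b b" for y s
    using fun_closed[OF u ba b b that] obj_unit_left[OF b] oas by simp
  have bR'0: "Ta ?Ib R' \<in> Arr C b (To b (To a b))"
    using fun_closed[OF b b u ab Ib R'] obj_unit_right[OF b] by simp
  have Rb0: "Ta (Star C R) ?Ib \<in> Arr C (To b (To a b)) b"
    using fun_closed[OF ba u b b sR Ib] obj_unit_left[OF b] oas by simp
  have zag': "Ta ?Ib (Star C R') \<cdot>\<^bsub>C\<^esub> Ta R ?Ib = ?Ib"
    using arg_cong[OF zag, of "Star C"] C.star_comp[OF b bab b bR'0 Rb0]
      fun_star[OF b b u ab Ib R'] fun_star[OF ba u b b sR Ib] C.star_star[OF u ba R] C.star_ident[OF b] by simp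
  (* Frobenius reciprocity: J and the map from v to (v x 1) R are inverse bijections between
     (unit, b a) and (b, b). An arrow of (b, b) is thus determined by its effect on R. *)
  define J where "J y = Ta ?Ib (Star C R') \<cdot>\<^bsub>C\<^esub> Ta y ?Ib" for y
  have J_arr: "J y \<in> Arr C b b" if "y \<in> Arr C ?u (To b a)" for y
    unfolding J_def by (rule C.comp_closed[OF b bab b bR' yb[OF that Ib]])
  have J_tensor: "Ta (J y) ?Ia \<cdot>\<^bsub>C\<^esub> R = y" if y: "y \<in> Arr C ?u (To b a)" for y
  proof -
    have "Ta (J y) ?Ia = Ta (Ta ?Ib (Star C R')) ?Ia \<cdot>\<^bsub>C\<^esub> Ta (Ta y ?Ib) ?Ia"
      unfolding J_def using fun_comp[OF b bab b a a a yb[OF y Ib] bR' Ia Ia] il[OF a a Ia] by simp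
    moreover have "Ta (Ta y ?Ib) ?Ia = Ta y (Ident C (To b a))"
      using arr_assoc[OF u ba b b a a y Ib Ia] fun_ident[OF b a] by simp
    moreover have "Ta (Ta ?Ib (Star C R')) ?Ia = Ta ?Ib (Ta (Star C R') ?Ia)"
      by (rule arr_assoc[OF b b ab u a a Ib sR' Ia])
    ultimately have 1: "Ta (J y) ?Ia = Ta ?Ib (Ta (Star C R') ?Ia) \<cdot>\<^bsub>C\<^esub> Ta y (Ident C (To b a))"
      by simp
    have m1: "Ta y (Ident C (To b a)) \<in> Arr C (To b a) (To b (To a (To b a)))"
      using fun_closed[OF u ba ba ba y C.ident_arr[OF ba]] obj_unit_left[OF ba] obj_assoc[OF b a ba] by simp
    have m2: "Ta ?Ib (Ta (Star C R') ?Ia) \<in> Arr C (To b (To a (To b a))) (To b a)"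
      by (rule fun_closed[OF b b aba a Ib aR'])
    note baba = fun_obj[OF b aba]
    have "Ta y (Ident C (To b a)) \<cdot>\<^bsub>C\<^esub> R = Ta y (Ident C (To b a)) \<cdot>\<^bsub>C\<^esub> Ta ?Iu R"
      using arr_unit_left[OF u ba R] by simp
    also have "\<dots> = Ta y R"
      using fun_comp[OF u u ba u ba ba Iu y R C.ident_arr[OF ba]] ir[OF u ba y] il[OF u ba R] by simp
    also have "\<dots> = Ta (Ident C (To b a)) R \<cdot>\<^bsub>C\<^esub> Ta y ?Iu"
      using fun_comp[OF u ba ba u u ba y C.ident_arr[OF ba] Iu R] ir[OF u ba R] il[OF u ba y] by simp
    also have "Ta y ?Iu = y" by (rule arr_unit_right[OF u ba y])
    also have "Ta (Ident C (To b a)) R = Ta ?Ib (Ta ?Ia R)"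
      using arr_assoc[OF b b a a u ba Ib Ia R] fun_ident[OF b a] by simp
    finally have 2: "Ta y (Ident C (To b a)) \<cdot>\<^bsub>C\<^esub> R = Ta ?Ib (Ta ?Ia R) \<cdot>\<^bsub>C\<^esub> y" .
    have m3: "Ta ?Ib (Ta ?Ia R) \<in> Arr C (To b a) (To b (To a (To b a)))"
      by (rule fun_closed[OF b b a aba Ib aR])
    have "Ta (J y) ?Ia \<cdot>\<^bsub>C\<^esub> R = Ta ?Ib (Ta (Star C R') ?Ia) \<cdot>\<^bsub>C\<^esub> (Ta ?Ib (Ta ?Ia R) \<cdot>\<^bsub>C\<^esub> y)"
      unfolding 1 using assoc[OF u ba baba ba R m1 m2] 2 by simp
    also have "\<dots> = (Ta ?Ib (Ta (Star C R') ?Ia) \<cdot>\<^bsub>C\<^esub> Ta ?Ib (Ta ?Ia R)) \<cdot>\<^bsub>C\<^esub> y"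
      using assoc[OF u ba baba ba y m3 m2] by simp
    also have "Ta ?Ib (Ta (Star C R') ?Ia) \<cdot>\<^bsub>C\<^esub> Ta ?Ib (Ta ?Ia R) = Ident C (To b a)"
      using fun_comp[OF b b b a aba a Ib Ib aR aR'] il[OF b b Ib] zig fun_ident[OF b a] by simp
    finally show ?thesis using il[OF u ba y] by simp
  qed
  have tensor_J: "J (Ta v ?Ia \<cdot>\<^bsub>C\<^esub> R) = v" if v: "v \<in> Arr C b b" for v
  proof -
    have m: "Ta v ?Ia \<in> Arr C (To b a) (To b a)" by (rule fun_closed[OF b b a a v Ia])
    have m': "Ta v (Ident C (To a b)) \<in> Arr C (To b (To a b)) (To b (To a b))"
      by (rule fun_closed[OF b b ab ab v C.ident_arr[OF ab]])
    have "Ta (Ta v ?Ia \<cdot>\<^bsub>C\<^esub> R) ?Ib = Ta (Ta v ?Ia) ?Ib \<cdot>\<^bsub>C\<^esub> Ta R ?Ib"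
      using fun_comp[OF u ba ba b b b R m Ib Ib] il[OF b b Ib] by simp
    also have "Ta (Ta v ?Ia) ?Ib = Ta v (Ident C (To a b))"
      using arr_assoc[OF b b a a b b v Ia Ib] fun_ident[OF a b] by simp
    finally have "J (Ta v ?Ia \<cdot>\<^bsub>C\<^esub> R) = (Ta ?Ib (Star C R') \<cdot>\<^bsub>C\<^esub> Ta v (Ident C (To a b))) \<cdot>\<^bsub>C\<^esub> Ta R ?Ib"
      unfolding J_def using assoc[OF b bab bab b yb[OF R Ib] m' bR'] by simp
    also have "Ta ?Ib (Star C R') \<cdot>\<^bsub>C\<^esub> Ta v (Ident C (To a b)) = Ta v (Star C R')"
      using fun_comp[OF b b b ab ab u v Ib C.ident_arr[OF ab] sR'] il[OF b b v] ir[OF ab u sR'] by simp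
    also have "\<dots> = v \<cdot>\<^bsub>C\<^esub> Ta ?Ib (Star C R')"
      using fun_comp[OF b b b ab u u Ib v sR' Iu] ir[OF b b v] il[OF ab u sR'] arr_unit_right[OF b b v] by simp
    finally show ?thesis
      using assoc[OF b bab b b yb[OF R Ib] bR' v] zag' ir[OF b b v] by simp
  qed
  (* p = J S is the transpose of e. Moving an arrow across R turns the idempotence of e into that
     of p. *)
  have be: "Ta ?Ib e \<in> Arr C (To b a) (To b a)" by (rule fun_closed[OF b b a a Ib e])
  define S where "S = Ta ?Ib e \<cdot>\<^bsub>C\<^esub> R"
  have S: "S \<in> Arr C ?u (To b a)" unfolding S_def by (rule C.comp_closed[OF u ba ba be R])
  define p where "p = J S"
  have p: "p \<in> Arr C b b" unfolding p_def by (rule J_arr[OF S])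
  have pR: "Ta p ?Ia \<cdot>\<^bsub>C\<^esub> R = S" unfolding p_def by (rule J_tensor[OF S])
  have eS: "Ta ?Ib e \<cdot>\<^bsub>C\<^esub> S = S"
    unfolding S_def using assoc[OF u ba ba ba R be be] fun_comp[OF b b b a a a Ib Ib e e] ee il[OF b b Ib] by simp
  have slide: "Ta s ?Ia \<cdot>\<^bsub>C\<^esub> Ta ?Ib e = Ta s e" "Ta ?Ib e \<cdot>\<^bsub>C\<^esub> Ta s ?Ia = Ta s e" if s: "s \<in> Arr C b b" for s
    using fun_comp[OF b b b a a a Ib s e Ia] fun_comp[OF b b b a a a s Ib Ia e] il[OF b b s] ir[OF b b s]
      il[OF a a e] ir[OF a a e] by simp_all
  have T: "Ta s ?Ia \<in> Arr C (To b a) (To b a)" if "s \<in> Arr C b b" for s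
    by (rule fun_closed[OF b b a a that Ia])
  have pS: "Ta p ?Ia \<cdot>\<^bsub>C\<^esub> S = S"
  proof -
    have "Ta p ?Ia \<cdot>\<^bsub>C\<^esub> S = (Ta ?Ib e \<cdot>\<^bsub>C\<^esub> Ta p ?Ia) \<cdot>\<^bsub>C\<^esub> R"
      using assoc[OF u ba ba ba R be T[OF p]] slide[OF p] by (simp add: S_def)
    also have "\<dots> = S" using assoc[OF u ba ba ba R T[OF p] be] pR eS by simp
    finally show ?thesis .
  qed
  have pp: "p \<cdot>\<^bsub>C\<^esub> p = p"
  proof -
    have "Ta (p \<cdot>\<^bsub>C\<^esub> p) ?Ia \<cdot>\<^bsub>C\<^esub> R = S"
      using fun_comp[OF b b b a a a p p Ia Ia] il[OF a a Ia] assoc[OF u ba ba ba R T[OF p] T[OF p]] pR pS by simp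
    then show ?thesis using tensor_J[OF C.comp_closed[OF b b b p p]] by (simp add: p_def)
  qed
  obtain q where q: "q \<in> Arr C b b" "q \<cdot>\<^bsub>C\<^esub> q = q" "Star C q = q" "p \<cdot>\<^bsub>C\<^esub> q = q" "q \<cdot>\<^bsub>C\<^esub> p = p"
    using C.idempotent_range_projection[OF b p pp] by blast
  have qe: "Ta q e \<in> Arr C (To b a) (To b a)" and eq: "Ta e q \<in> Arr C (To a b) (To a b)"
    by (rule fun_closed[OF b b a a q(1) e], rule fun_closed[OF a a b b e q(1)])
  have qS: "Ta q e \<cdot>\<^bsub>C\<^esub> S = S"
  proof -
    have "Ta q e \<cdot>\<^bsub>C\<^esub> S = Ta q ?Ia \<cdot>\<^bsub>C\<^esub> S"
      using assoc[OF u ba ba ba S be T[OF q(1)]] slide(1)[OF q(1)] eS by simp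
    also have "\<dots> = Ta (q \<cdot>\<^bsub>C\<^esub> p) ?Ia \<cdot>\<^bsub>C\<^esub> R"
      using fun_comp[OF b b b a a a p q(1) Ia Ia] il[OF a a Ia] assoc[OF u ba ba ba R T[OF p] T[OF q(1)]] pR by simp
    finally show ?thesis using q(5) pR by simp
  qed
  define S' where "S' = Ta e q \<cdot>\<^bsub>C\<^esub> R'"
  have S': "S' \<in> Arr C ?u (To a b)" unfolding S'_def by (rule C.comp_closed[OF u ab ab eq R'])
  have eqS': "Ta e q \<cdot>\<^bsub>C\<^esub> S' = S'"
    unfolding S'_def using assoc[OF u ab ab ab R' eq eq] fun_comp[OF a a a b b b e e q(1,1)] ee q(2) by simp
  have sS': "Star C S' = Star C R' \<cdot>\<^bsub>C\<^esub> Ta e q"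
    unfolding S'_def using C.star_comp[OF u ab ab R' eq] fun_star[OF a a b b e q(1)] se q(3) by simp
  (* The projections in S' are absorbed by S; what remains is e, the first conjugate equation for R
     and R', and e again. *)
  have C1: "Ta (Star C S') e \<cdot>\<^bsub>C\<^esub> Ta e S = e"
  proof -
    have m1: "Ta e S \<in> Arr C a (To a (To b a))"
      using fun_closed[OF a a u ba e S] obj_unit_right[OF a] by simp
    have m2: "Ta e (Ta q e) \<in> Arr C (To a (To b a)) (To a (To b a))" by (rule fun_closed[OF a a ba ba e qe])
    have m3: "Ta ?Ia (Ta ?Ib e) \<in> Arr C (To a (To b a)) (To a (To b a))" by (rule fun_closed[OF a a ba ba Ia be])
    have "Ta (Star C S') e = Ta (Star C R') ?Ia \<cdot>\<^bsub>C\<^esub> Ta e (Ta q e)"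
      unfolding sS' using fun_comp[OF ab ab u a a a eq sR' e Ia] il[OF a a e] arr_assoc[OF a a b b a a e q(1) e] by simp
    then have 1: "Ta (Star C S') e \<cdot>\<^bsub>C\<^esub> Ta e S = Ta (Star C R') ?Ia \<cdot>\<^bsub>C\<^esub> Ta e S"
      using assoc[OF a aba aba a m1 m2 aR'] fun_comp[OF a a a u ba ba e e S qe] ee qS by simp
    have 2: "Ta e S = Ta ?Ia (Ta ?Ib e) \<cdot>\<^bsub>C\<^esub> Ta e R"
      unfolding S_def using fun_comp[OF a a a u ba ba e Ia R be] il[OF a a e] by simp
    have 3: "Ta e R = Ta ?Ia R \<cdot>\<^bsub>C\<^esub> e"
      using fun_comp[OF a a a u u ba e Ia Iu R] il[OF a a e] ir[OF u ba R] arr_unit_right[OF a a e] by simp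
    have "Ta (Star C R') ?Ia \<cdot>\<^bsub>C\<^esub> (Ta ?Ia (Ta ?Ib e) \<cdot>\<^bsub>C\<^esub> (Ta ?Ia R \<cdot>\<^bsub>C\<^esub> e)) =
        (Ta (Star C R') ?Ia \<cdot>\<^bsub>C\<^esub> Ta ?Ia (Ta ?Ib e)) \<cdot>\<^bsub>C\<^esub> (Ta ?Ia R \<cdot>\<^bsub>C\<^esub> e)"
      by (rule assoc[OF a aba aba a C.comp_closed[OF a a aba aR e] m3 aR', symmetric])
    also have "Ta (Star C R') ?Ia \<cdot>\<^bsub>C\<^esub> Ta ?Ia (Ta ?Ib e) = e \<cdot>\<^bsub>C\<^esub> Ta (Star C R') ?Ia"
      using arr_assoc[OF a a b b a a Ia Ib e] fun_ident[OF a b]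
        fun_comp[OF ab ab u a a a C.ident_arr[OF ab] sR' e Ia] fun_comp[OF ab u u a a a sR' Iu Ia e]
        ir[OF ab u sR'] il[OF ab u sR'] il[OF a a e] ir[OF a a e] arr_unit_left[OF a a e] by simp
    also have "(e \<cdot>\<^bsub>C\<^esub> Ta (Star C R') ?Ia) \<cdot>\<^bsub>C\<^esub> (Ta ?Ia R \<cdot>\<^bsub>C\<^esub> e) = e"
      using assoc[OF a aba a a C.comp_closed[OF a a aba aR e] aR' e] assoc[OF a a aba a e aR aR'] zig
        il[OF a a e] ee by simp
    finally show ?thesis unfolding 1 unfolding 2 3 .
  qed
  (* The adjoint of this equation reads J S q = q, and J S q = p q = q. *)
  have C2: "Ta (Star C S) q \<cdot>\<^bsub>C\<^esub> Ta q S' = q"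
  proof -
    note sS = C.star_arr[OF u ba S] and sS'm = C.star_arr[OF u ab S']
    have m1: "Ta q (Star C S') \<in> Arr C (To b (To a b)) b"
      using fun_closed[OF b b ab u q(1) sS'm] obj_unit_right[OF b] by simp
    have m2: "Ta q (Ta e q) \<in> Arr C (To b (To a b)) (To b (To a b))" by (rule fun_closed[OF b b ab ab q(1) eq])
    have "Ta q (Star C S') = Ta ?Ib (Star C R') \<cdot>\<^bsub>C\<^esub> Ta q (Ta e q)"
      unfolding sS' using fun_comp[OF b b b ab ab u q(1) Ib eq sR'] il[OF b b q(1)] by simp
    then have "Ta q (Star C S') \<cdot>\<^bsub>C\<^esub> Ta S q = Ta ?Ib (Star C R') \<cdot>\<^bsub>C\<^esub> Ta S q"
      using assoc[OF b bab bab b yb[OF S q(1)] m2 bR'] arr_assoc[OF b b a a b b q(1) e q(1)] fun_comp[OF u ba ba b b b S qe q(1) q(1)] qS q(2) by simp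
    moreover have "Ta S q = Ta S ?Ib \<cdot>\<^bsub>C\<^esub> q"
      using fun_comp[OF u u ba b b b Iu S q(1) Ib] ir[OF u ba S] il[OF b b q(1)] arr_unit_left[OF b b q(1)] by simp
    moreover have "Ta ?Ib (Star C R') \<cdot>\<^bsub>C\<^esub> (Ta S ?Ib \<cdot>\<^bsub>C\<^esub> q) = p \<cdot>\<^bsub>C\<^esub> q"
      unfolding p_def J_def by (rule assoc[OF b b bab b q(1) yb[OF S Ib] bR', symmetric])
    ultimately have eq': "Ta q (Star C S') \<cdot>\<^bsub>C\<^esub> Ta S q = q" using q(4) by simp
    have "Star C (Ta q (Star C S') \<cdot>\<^bsub>C\<^esub> Ta S q) = Ta (Star C S) q \<cdot>\<^bsub>C\<^esub> Ta q S'"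
      using C.star_comp[OF b bab b yb[OF S q(1)] m1] fun_star[OF u ba b b S q(1)] fun_star[OF b b ab u q(1) sS'm]
        q(3) C.star_star[OF u ab S'] by simp
    then show ?thesis using eq' q(3) by simp
  qed
  show ?thesis using q(1-3) S S' qS eqS' C1 C2 by blast
qed

text \<open>The constant functions with values \<open>R\<close> and \<open>R'\<close> solve the conjugate equations for \<open>1 \<otimes> 1\<^sub>a\<close> and
  \<open>1 \<otimes> 1\<^sub>b\<close>, and an object \<open>(a, e)\<close> is the subobject of \<open>1 \<otimes> 1\<^sub>a\<close> given by \<open>e\<close>.\<close>

theorem ext_has_conjugates:
  fixes X :: "'w topology"
  assumes X: "compact_space X" and conj: "has_conjugates C To Ta unit"
  shows "has_conjugates (ext_cat X C) (ext_obj X To Ta) (ext_arr X Ta) (ext_const X C unit)"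
proof -
  interpret E: ext_category C X by (intro ext_category.intro ext_category_axioms.intro C.cstar_category_axioms X)
  interpret F: strict_tensor_cstar_category E.D "ext_obj X To Ta" "ext_arr X Ta" "ext_const X C unit"
    by (rule ext_strict_tensor[OF X])
  let ?o = "ext_obj X To Ta" and ?c = "ext_const X C"
  show ?thesis
    unfolding has_conjugates_def
  proof
    fix p assume p: "p \<in> Obj E.D"
    define a e where "a = fst p" and "e = snd p"
    have a: "a \<in> Obj C" and e: "e \<in> E.CF a a" and ee: "ext_arr X (Comp C) e e = e" and se: "ext_star X C e = e"
      using p E.ext_objD(2)[OF p, THEN cfun_space_extensional]
      by (simp_all add: Obj_ext_cat a_def e_def ext_arr_eq_iff ext_star_eq_iff)
    obtain b R R' where b: "b \<in> Obj C" and R: "R \<in> Arr C unit (To b a)" and R': "R' \<in> Arr C unit (To a b)"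
      and zig: "Ta (Star C R') (Ident C a) \<cdot>\<^bsub>C\<^esub> Ta (Ident C a) R = Ident C a"
      and zag: "Ta (Star C R) (Ident C b) \<cdot>\<^bsub>C\<^esub> Ta (Ident C b) R' = Ident C b"
      using conj a unfolding has_conjugates_def by blast
    note ab = fun_obj[OF a b] and ba = fun_obj[OF b a]
    have o: "?o (?c b) (?c a) = ?c (To b a)" "?o (?c a) (?c b) = ?c (To a b)"
      using fun_ident a b ab ba
      by (auto simp: E.ext_const_eq ext_arr_eq_iff intro!: prod_eqI)
    have corner: "Arr E.D (?c x) (?c y) = E.CF x y" if "x \<in> Obj C" "y \<in> Obj C" for x y
      by (simp add: Arr_ext_cat E.corner_ext_const[OF that])
    let ?R = "\<lambda>w\<in>topspace X. R" and ?R' = "\<lambda>w\<in>topspace X. R'"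
    have "\<exists>q\<in>Arr E.D (?c b) (?c b). q \<cdot>\<^bsub>E.D\<^esub> q = q \<and> Star E.D q = q \<and>
     (\<exists>S\<in>Arr E.D (?c unit) (?o (?c b) (?c a)). \<exists>S'\<in>Arr E.D (?c unit) (?o (?c a) (?c b)).
        ext_arr X Ta q e \<cdot>\<^bsub>E.D\<^esub> S = S \<and> ext_arr X Ta e q \<cdot>\<^bsub>E.D\<^esub> S' = S' \<and>
        ext_arr X Ta (Star E.D S') e \<cdot>\<^bsub>E.D\<^esub> ext_arr X Ta e S = e \<and>
        ext_arr X Ta (Star E.D S) q \<cdot>\<^bsub>E.D\<^esub> ext_arr X Ta q S' = q)"
    proof (rule F.conjugate_of_projection)
      show "?c a \<in> Obj E.D" "?c b \<in> Obj E.D" using a b by (simp_all add: E.ext_const_obj)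
      show "?R \<in> Arr E.D (?c unit) (?o (?c b) (?c a))" "?R' \<in> Arr E.D (?c unit) (?o (?c a) (?c b))"
        unfolding o corner[OF unit_obj ab] corner[OF unit_obj ba]
        by (rule E.CF_const[OF unit_obj ba R], rule E.CF_const[OF unit_obj ab R'])
      show "ext_arr X Ta (Star E.D ?R') (Ident E.D (?c a)) \<cdot>\<^bsub>E.D\<^esub> ext_arr X Ta (Ident E.D (?c a)) ?R = Ident E.D (?c a)"
        "ext_arr X Ta (Star E.D ?R) (Ident E.D (?c b)) \<cdot>\<^bsub>E.D\<^esub> ext_arr X Ta (Ident E.D (?c b)) ?R' = Ident E.D (?c b)"
        using zig zag by (simp_all add: E.ext_const_eq a b ext_arr_eq_iff)
      show "e \<in> Arr E.D (?c a) (?c a)" using e by (simp add: corner[OF a a])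
    qed (simp_all add: ee se)
    then obtain q S S' where q: "q \<in> E.CF b b" "ext_arr X (Comp C) q q = q" "ext_star X C q = q"
      and S: "S \<in> E.CF unit (To b a)" "ext_arr X (Comp C) (ext_arr X Ta q e) S = S"
      and S': "S' \<in> E.CF unit (To a b)" "ext_arr X (Comp C) (ext_arr X Ta e q) S' = S'"
      and zigS: "ext_arr X Ta (Star E.D S') e \<cdot>\<^bsub>E.D\<^esub> ext_arr X Ta e S = e"
      and zagS: "ext_arr X Ta (Star E.D S) q \<cdot>\<^bsub>E.D\<^esub> ext_arr X Ta q S' = q"
      unfolding o corner[OF unit_obj ab] corner[OF unit_obj ba] corner[OF b b] by auto
    have qobj: "(b, q) \<in> Obj E.D"
      using b q cfun_space_extensional[OF q(1)] by (simp add: Obj_ext_cat ext_arr_eq_iff ext_star_eq_iff)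
    have ident: "s \<cdot>\<^bsub>C\<^esub> Ident C unit = s" if "s \<in> Arr C unit c" "c \<in> Obj C" for s c
      using C.ident_right[OF unit_obj that(2,1)] .
    have "S \<in> Arr E.D (?c unit) (?o (b, q) p)"
      using S cfun_space_extensional[OF S(1)] E.CF_value[OF unit_obj ba S(1)] ba
      by (simp add: Arr_ext_cat corner_def a_def e_def ext_arr_eq_iff E.ext_const_eq[OF unit_obj] ident[OF E.CF_value[OF unit_obj ba S(1)] ba])
    moreover have "S' \<in> Arr E.D (?c unit) (?o p (b, q))"
      using S' cfun_space_extensional[OF S'(1)] E.CF_value[OF unit_obj ab S'(1)] ab
      by (simp add: Arr_ext_cat corner_def a_def e_def ext_arr_eq_iff E.ext_const_eq[OF unit_obj] ident[OF E.CF_value[OF unit_obj ab S'(1)] ab])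
    ultimately show "\<exists>b\<in>Obj E.D. \<exists>R\<in>Arr E.D (?c unit) (?o b p). \<exists>R'\<in>Arr E.D (?c unit) (?o p b).
        ext_arr X Ta (Star E.D R') (Ident E.D p) \<cdot>\<^bsub>E.D\<^esub> ext_arr X Ta (Ident E.D p) R = Ident E.D p \<and>
        ext_arr X Ta (Star E.D R) (Ident E.D b) \<cdot>\<^bsub>E.D\<^esub> ext_arr X Ta (Ident E.D b) R' = Ident E.D b"
      using qobj zigS zagS unfolding ext_cat_simps(1) e_def
      by (intro bexI[of _ "(b, q)"] bexI[of _ S] bexI[of _ S']) simp_all
  qed
qed

end

theorem proposition3p5:
  fixes X :: "'w topology"
    and C :: "('o, 'a) cat" and C1 :: "('o1, 'a1) cat" and C2 :: "('o2, 'a2) cat"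
  assumes "compact_space X" and "Hausdorff_space X"
    and "cstar_category C" and "cstar_category C1" and "cstar_category C2"
  shows
    "(\<forall>Fo Fa. cstar_bifunctor C1 C1 C2 Fo Fa \<longrightarrow>
        cstar_bifunctor (ext_cat X C1) (ext_cat X C1) (ext_cat X C2)
          (ext_obj X Fo Fa) (ext_arr X Fa) \<and>
        (\<forall>a\<in>Obj C1. \<forall>b\<in>Obj C1. \<forall>a'\<in>Obj C1. \<forall>b'\<in>Obj C1.
           is_the_extension X (Hom C1 a b) (Hom C1 a' b') (Hom C2 (Fo a a') (Fo b b'))
             Fa (ext_arr X Fa)))
     \<and>
     (\<forall>To Ta unit. strict_tensor_cstar_category C To Ta unit \<longrightarrow>
        strict_tensor_cstar_category (ext_cat X C) (ext_obj X To Ta) (ext_arr X Ta)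
          (ext_const X C unit) \<and>
        Hom (ext_cat X C) (ext_const X C unit) (ext_const X C unit) = ctensor X (Hom C unit unit) \<and>
        extends_tensors X (Hom C unit unit) (Hom C unit unit) (Hom C unit unit)
          (Comp C) (Comp (ext_cat X C)) \<and>
        (\<forall>f s. continuous_map X euclidean f \<and> s \<in> Arr C unit unit \<longrightarrow>
           Star (ext_cat X C) (etensor X (Hom C unit unit) f s) =
             etensor X (Hom C unit unit) (\<lambda>w. cnj (f w)) (Star C s)))
     \<and>
     (\<forall>To Ta unit. strict_tensor_cstar_category C To Ta unit \<and> symmetric_tensor C To Ta \<longrightarrow>
        symmetric_tensor (ext_cat X C) (ext_obj X To Ta) (ext_arr X Ta))
     \<and>
     (\<forall>To Ta unit. strict_tensor_cstar_category C To Ta unit \<and> has_conjugates C To Ta unit \<longrightarrow>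
        has_conjugates (ext_cat X C) (ext_obj X To Ta) (ext_arr X Ta) (ext_const X C unit))"
proof (intro conjI allI impI ballI)
  fix Fo Fa assume F: "cstar_bifunctor C1 C1 C2 Fo Fa"
  interpret F: cstar_bifunctor C1 C1 C2 Fo Fa by (rule F)
  show "cstar_bifunctor (ext_cat X C1) (ext_cat X C1) (ext_cat X C2) (ext_obj X Fo Fa) (ext_arr X Fa)"
    by (rule F.ext_cstar_bifunctor[OF assms(1)])
  fix a b a' b' assume o: "a \<in> Obj C1" "b \<in> Obj C1" "a' \<in> Obj C1" "b' \<in> Obj C1"
  show "is_the_extension X (Hom C1 a b) (Hom C1 a' b') (Hom C2 (Fo a a') (Fo b b')) Fa (ext_arr X Fa)"
    by (rule ext_arr_is_the_extension[OF assms(1) F.C.hom_banach[OF o(1,2)] F.C.hom_banach[OF o(3,4)]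
          F.D.hom_banach[OF F.fun_obj[OF o(1,3)] F.fun_obj[OF o(2,4)]] F.fun_bilinear[OF o]])
next
  fix To Ta unit assume T: "strict_tensor_cstar_category C To Ta unit"
  interpret T: strict_tensor_cstar_category C To Ta unit by (rule T)
  interpret E: ext_category C X
    by (intro ext_category.intro ext_category_axioms.intro assms(1,3))
  note u = T.unit_obj
  show "strict_tensor_cstar_category (ext_cat X C) (ext_obj X To Ta) (ext_arr X Ta) (ext_const X C unit)"
    by (rule T.ext_strict_tensor[OF assms(1)])
  show "Hom (ext_cat X C) (ext_const X C unit) (ext_const X C unit) = ctensor X (Hom C unit unit)"
    by (rule E.Hom_ext_const[OF u u])
  show "extends_tensors X (Hom C unit unit) (Hom C unit unit) (Hom C unit unit) (Comp C) (Comp (ext_cat X C))"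
    using ext_arr_is_the_extension[OF assms(1) _ _ _ T.C.comp_bounded_bilinear[OF u u u]] T.C.hom_banach[OF u u]
    by (simp add: is_the_extension_def)
  show "Star (ext_cat X C) (etensor X (Hom C unit unit) f s) =
      etensor X (Hom C unit unit) (\<lambda>w. cnj (f w)) (Star C s)"
    if "continuous_map X euclidean f \<and> s \<in> Arr C unit unit" for f s
    using E.ext_star_etensor[OF u u] that by simp
next
  fix To Ta unit assume "strict_tensor_cstar_category C To Ta unit \<and> symmetric_tensor C To Ta"
  then show "symmetric_tensor (ext_cat X C) (ext_obj X To Ta) (ext_arr X Ta)"
    by (elim conjE) (rule strict_tensor_cstar_category.ext_symmetric[OF _ assms(1)])
next
  fix To Ta unit assume "strict_tensor_cstar_category C To Ta unit \<and> has_conjugates C To Ta unit"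
  then show "has_conjugates (ext_cat X C) (ext_obj X To Ta) (ext_arr X Ta) (ext_const X C unit)"
    by (elim conjE) (rule strict_tensor_cstar_category.ext_has_conjugates[OF _ assms(1)])
qed

end
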